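(* If $k_1=2\le d=t\le k_2$, $S\subseteq[2]\times[k_2]$ is nonempty, and the ideal $I_S$ is minimal with respect to inclusion among the ideals $\{I_{S'}:S'\subseteq[2]\times[k_2]\}$, then the dimension of $I_S$ is $$t^2+(t-1)k_2-(t-1)^2-1.$$
   Context: Let $k_2,d,t$ be integers with $2\le d=t\le k_2$; $[n]=\{1,\dots,n\}$. Let $X=(x_{i(j,\ell)})$ be the $d\times 2k_2$ matrix of indeterminates with rows $i\in[d]$ and columns $(j,\ell)\in[2]\times[k_2]$, and $\mathbb C[X]$ the polynomial ring over $\mathbb C$ in its entries. For $U\subseteq[2]\times[k_2]$, $X_U$ is the submatrix of $X$ with columns in $U$. For a submatrix $Y$ of $X$, $F_r(Y)$ is the set of $r$-minors of $Y$. Put $R_i=\{i\}\times[k_2]$ and $C_j=[2]\times\{j\}$. For $S\subseteq[2]\times[k_2]$ let $\mathcal C(S)$ be the union of all $C_j$ with $C_j\cap S=\emptyset$. Let $F_\emptyset=\bigcup_{j\in[k_2]}F_2(X_{C_j})\cup F_t(X)$ and, for $S\ne\emptyset$, $$F_S=F_1(X_S)\cup\bigcup_{j\in[k_2],\,C_j\cap S=\emptyset}F_2(X_{C_j})\cup G_S\cup F_t(X_{(R_1\setminus S)\cup\mathcal C(S)})\cup F_t(X_{(R_2\setminus S)\cup\mathcal C(S)}),$$ where $G_S=F_{t-1}(X_{\mathcal C(S)})$ if there is $j$ with $(1,j)\in S,(2,j)\notin S$ and there is $j'$ with $(2,j')\in S,(1,j')\notin S$, and $G_S=\emptyset$ otherwise.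 $I_S\subseteq\mathbb C[X]$ is the ideal generated by $F_S$. The dimension of an ideal $I\subseteq\mathbb C[X]$ is the Krull dimension of $\mathbb C[X]/I$, equivalently the dimension of $V(I)\subseteq\mathbb C^{d\times 2k_2}$. *)

theory Defs
  imports
    "HOL.Complex"
    "HOL-Library.Poly_Mapping"
    "HOL-Library.Extended_Real"
    "HOL-Algebra.QuotRing"
    "Jordan_Normal_Form.Determinant"
begin

text \<open>
  A polynomial over \<open>'a\<close> in variables from a type \<open>'v\<close> is a finitely supported map from monomials
  (finitely supported exponent functions) to coefficients; the ring structure on the type is the
  convolution product of \<open>Poly_Mapping\<close>. \<open>mpoly_ring V\<close> is its subring of the polynomials in which
  only variables from \<open>V\<close> occur.
\<close>

definition mpoly_ring :: "'v set \<Rightarrow> (('v \<Rightarrow>\<^sub>0 nat) \<Rightarrow>\<^sub>0 'a::comm_ring_1) ring" where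
  "mpoly_ring V =
     \<lparr> carrier = {p. \<forall>m \<in> Poly_Mapping.keys p. Poly_Mapping.keys m \<subseteq> V},
       monoid.mult = (*), one = 1, zero = 0, add = (+) \<rparr>"

definition mvar :: "'v \<Rightarrow> (('v \<Rightarrow>\<^sub>0 nat) \<Rightarrow>\<^sub>0 'a::comm_ring_1)" where
  "mvar v = Poly_Mapping.single (Poly_Mapping.single v 1) 1"

text \<open>
  The Krull dimension is the supremum of the lengths \<open>n\<close> of strictly increasing chains
  \<open>P 0 \<subset> \<dots> \<subset> P n\<close> of prime ideals; it is \<open>-\<infinity>\<close> for the zero ring.
\<close>

definition krull_dim :: "('a, 'm) ring_scheme \<Rightarrow> ereal" where
  "krull_dim R = Sup {ereal (real n) | n.
     \<exists>P :: nat \<Rightarrow> 'a set. (\<forall>i\<le>n. primeideal (P i) R) \<and> (\<forall>i<n. P i \<subset> P (Suc i))}"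

text \<open>
  Columns are pairs \<open>(j, l)\<close> in \<open>[2] \<times> [k2]\<close>, and the variable \<open>x\<^sub>i\<^sub>(\<^sub>j\<^sub>,\<^sub>l\<^sub>)\<close> is indexed by \<open>(i, (j, l))\<close>.
\<close>

type_synonym col = "nat \<times> nat"
type_synonym cpoly = "((nat \<times> col) \<Rightarrow>\<^sub>0 nat) \<Rightarrow>\<^sub>0 complex"

definition columns :: "nat \<Rightarrow> col set" where
  "columns k2 = {1..2} \<times> {1..k2}"

definition CX :: "nat \<Rightarrow> nat \<Rightarrow> cpoly ring" where
  "CX d k2 = mpoly_ring ({1..d} \<times> columns k2)"

text \<open>
  \<open>minors d r U\<close> is the set of \<open>r\<close>-minors of \<open>X\<^sub>U\<close>, where \<open>X\<close> has \<open>d\<close> rows. The selected rows \<open>rs\<close> and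
  columns \<open>cs\<close> are listed in strictly increasing order (columns lexicographically).
\<close>

definition minors :: "nat \<Rightarrow> nat \<Rightarrow> col set \<Rightarrow> cpoly set" where
  "minors d r U = {det (mat r r (\<lambda>(a, b). mvar (rs ! a, cs ! b))) | rs cs.
     length rs = r \<and> sorted_wrt (<) rs \<and> set rs \<subseteq> {1..d} \<and>
     length cs = r \<and> sorted_wrt (\<lambda>p q. (p, q) \<in> less_than <*lex*> less_than) cs \<and> set cs \<subseteq> U}"

definition Rset :: "nat \<Rightarrow> nat \<Rightarrow> col set" where
  "Rset k2 i = {i} \<times> {1..k2}"

definition Cset :: "nat \<Rightarrow> col set" where
  "Cset j = {1..2} \<times> {j}"

definition Cfree :: "nat \<Rightarrow> col set \<Rightarrow> col set" where
  "Cfree k2 S = \<Union> {Cset j | j. j \<in> {1..k2} \<and> Cset j \<inter> S = {}}"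

definition G_S :: "nat \<Rightarrow> nat \<Rightarrow> nat \<Rightarrow> col set \<Rightarrow> cpoly set" where
  "G_S d k2 t S =
     (if (\<exists>j\<in>{1..k2}. (1, j) \<in> S \<and> (2, j) \<notin> S) \<and> (\<exists>j'\<in>{1..k2}. (2, j') \<in> S \<and> (1, j') \<notin> S)
      then minors d (t - 1) (Cfree k2 S) else {})"

definition F_S :: "nat \<Rightarrow> nat \<Rightarrow> nat \<Rightarrow> col set \<Rightarrow> cpoly set" where
  "F_S d k2 t S =
     (if S = {} then (\<Union>j\<in>{1..k2}. minors d 2 (Cset j)) \<union> minors d t (columns k2)
      else minors d 1 S
         \<union> (\<Union>j\<in>{j \<in> {1..k2}. Cset j \<inter> S = {}}. minors d 2 (Cset j))
         \<union> G_S d k2 t S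
         \<union> minors d t ((Rset k2 1 - S) \<union> Cfree k2 S)
         \<union> minors d t ((Rset k2 2 - S) \<union> Cfree k2 S))"

definition I_S :: "nat \<Rightarrow> nat \<Rightarrow> nat \<Rightarrow> col set \<Rightarrow> cpoly set" where
  "I_S d k2 t S = Idl\<^bsub>CX d k2\<^esub> (F_S d k2 t S)"

definition ideal_dim :: "nat \<Rightarrow> nat \<Rightarrow> cpoly set \<Rightarrow> ereal" where
  "ideal_dim d k2 I = krull_dim (CX d k2 Quot I)"

lemma mpoly_carrier_mult:
  assumes "p \<in> carrier (mpoly_ring V)" "q \<in> carrier (mpoly_ring V)"
  shows "p * q \<in> carrier (mpoly_ring V)"
proof -
  have "Poly_Mapping.keys m \<subseteq> V" if "m \<in> Poly_Mapping.keys (p * q)" for m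
  proof -
    from that keys_mult[of p q] obtain a b
      where ab: "a \<in> Poly_Mapping.keys p" "b \<in> Poly_Mapping.keys q" "m = a + b" by blast
    then show ?thesis
      using assms Poly_Mapping.keys_add[of a b] by (force simp: mpoly_ring_def)
  qed
  then show ?thesis by (simp add: mpoly_ring_def)
qed

lemma mpoly_carrier_add:
  assumes "p \<in> carrier (mpoly_ring V)" "q \<in> carrier (mpoly_ring V)"
  shows "p + q \<in> carrier (mpoly_ring V)"
  using assms Poly_Mapping.keys_add[of p q] by (fastforce simp: mpoly_ring_def)

lemma mpoly_carrier_uminus:
  "p \<in> carrier (mpoly_ring V) \<Longrightarrow> - p \<in> carrier (mpoly_ring V)"
  by (simp add: mpoly_ring_def)

lemma mpoly_carrier_one: "1 \<in> carrier (mpoly_ring V)"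
  by (simp add: mpoly_ring_def)

lemma mpoly_carrier_mvar: "v \<in> V \<Longrightarrow> mvar v \<in> carrier (mpoly_ring V)"
  by (simp add: mpoly_ring_def mvar_def)

lemma cring_mpoly_ring:
  "cring (mpoly_ring V :: (('v \<Rightarrow>\<^sub>0 nat) \<Rightarrow>\<^sub>0 'a::comm_ring_1) ring)" (is "cring ?R")
proof (rule cringI)
  show "abelian_group ?R"
  proof (rule abelian_groupI)
    fix x assume "x \<in> carrier ?R"
    then show "\<exists>y\<in>carrier ?R. y \<oplus>\<^bsub>?R\<^esub> x = \<zero>\<^bsub>?R\<^esub>"
      by (intro bexI[of _ "- x"] mpoly_carrier_uminus) (simp_all add: mpoly_ring_def)
  next
    fix x y :: "('v \<Rightarrow>\<^sub>0 nat) \<Rightarrow>\<^sub>0 'a" assume "x \<in> carrier ?R" "y \<in> carrier ?R"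
    then show "x \<oplus>\<^bsub>?R\<^esub> y \<in> carrier ?R"
      using mpoly_carrier_add by (simp add: mpoly_ring_def)
  qed (simp_all add: mpoly_ring_def algebra_simps)
  show "comm_monoid ?R"
  proof (rule comm_monoidI)
    fix x y :: "('v \<Rightarrow>\<^sub>0 nat) \<Rightarrow>\<^sub>0 'a" assume "x \<in> carrier ?R" "y \<in> carrier ?R"
    then show "x \<otimes>\<^bsub>?R\<^esub> y \<in> carrier ?R"
      using mpoly_carrier_mult by (simp add: mpoly_ring_def)
  qed (simp_all add: mpoly_ring_def algebra_simps)
qed (simp add: mpoly_ring_def algebra_simps)

lemma mpoly_carrier_zero: "0 \<in> carrier (mpoly_ring V)"
  by (simp add: mpoly_ring_def)

lemma mpoly_carrier_sum:
  "(\<And>i. i \<in> A \<Longrightarrow> f i \<in> carrier (mpoly_ring V)) \<Longrightarrow> sum f A \<in> carrier (mpoly_ring V)"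
  by (induction A rule: infinite_finite_induct) (auto intro: mpoly_carrier_add mpoly_carrier_zero)

lemma mpoly_carrier_prod:
  "(\<And>i. i \<in> A \<Longrightarrow> f i \<in> carrier (mpoly_ring V)) \<Longrightarrow> prod f A \<in> carrier (mpoly_ring V)"
  by (induction A rule: infinite_finite_induct) (auto intro: mpoly_carrier_mult mpoly_carrier_one)

lemma minors_subset_carrier:
  assumes "U \<subseteq> columns k2"
  shows "minors d r U \<subseteq> carrier (CX d k2)"
proof
  fix p assume "p \<in> minors d r U"
  then obtain rs cs where p: "p = det (mat r r (\<lambda>(a, b). mvar (rs ! a, cs ! b)))"
    and l: "length rs = r" "set rs \<subseteq> {1..d}" "length cs = r" "set cs \<subseteq> U"
    by (auto simp: minors_def)
  let ?V = "{1..d} \<times> columns k2"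
  have v: "mvar (rs ! a, cs ! b) \<in> carrier (mpoly_ring ?V)" if "a < r" "b < r" for a b
    using l assms that by (intro mpoly_carrier_mvar SigmaI) (metis nth_mem subsetD)+
  have s: "signof \<pi> \<in> carrier (mpoly_ring ?V)" for \<pi>
    by (auto simp: sign_def intro: mpoly_carrier_one mpoly_carrier_uminus)
  have "signof \<pi> * (\<Prod>i = 0..<r. mat r r (\<lambda>(a, b). mvar (rs ! a, cs ! b)) $$ (i, \<pi> i))
      \<in> carrier (mpoly_ring ?V)" if \<pi>: "\<pi> permutes {0..<r}" for \<pi>
  proof (intro mpoly_carrier_mult s mpoly_carrier_prod)
    fix i assume "i \<in> {0..<r}"
    moreover from this have "\<pi> i < r" using permutes_in_image[OF \<pi>] by auto
    ultimately show "mat r r (\<lambda>(a, b). mvar (rs ! a, cs ! b)) $$ (i, \<pi> i) \<in> carrier (mpoly_ring ?V)"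
      using v by simp
  qed
  then show "p \<in> carrier (CX d k2)"
    unfolding p det_def CX_def by (auto intro!: mpoly_carrier_sum)
qed

lemma F_S_subset_carrier:
  assumes "S \<subseteq> columns k2"
  shows "F_S d k2 t S \<subseteq> carrier (CX d k2)"
proof -
  have 1: "Cset j \<subseteq> columns k2" if "j \<in> {1..k2}" for j
    using that by (auto simp: Cset_def columns_def)
  then have 2: "Cfree k2 S \<subseteq> columns k2"
    by (auto simp: Cfree_def)
  have 3: "(Rset k2 i - S) \<union> Cfree k2 S \<subseteq> columns k2" if "i \<in> {1, 2}" for i
    using that 2 by (auto simp: Rset_def columns_def)
  have 4: "G_S d k2 t S \<subseteq> carrier (CX d k2)"
    using minors_subset_carrier[OF 2] by (auto simp: G_S_def)
  have 5: "(\<Union>j\<in>J. minors d 2 (Cset j)) \<subseteq> carrier (CX d k2)" if "J \<subseteq> {1..k2}" for J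
    using that by (intro UN_least minors_subset_carrier 1) blast
  show ?thesis
  proof (cases "S = {}")
    case True
    then show ?thesis
      using 5[OF subset_refl] minors_subset_carrier[OF subset_refl] by (simp add: F_S_def)
  next
    case False
    then show ?thesis
      unfolding F_S_def if_not_P[OF False]
      by (intro Un_least 4 5 minors_subset_carrier[OF 3] minors_subset_carrier[OF assms]) auto
  qed
qed

end

theory Submission
  imports Defs "HOL-Library.Product_Lexorder"
begin

text \<open>
  Sort the pairs \<open>C\<^sub>j\<close> by how they meet \<open>S\<close>: let \<open>E\<close> be the set of \<open>j\<close> with \<open>C\<^sub>j\<close> disjoint from \<open>S\<close>, and for
  \<open>p = 1, 2\<close> let \<open>T\<^sub>p\<close> be the set of \<open>j\<close> for which only the column \<open>(p, j)\<close> of \<open>C\<^sub>j\<close> is outside \<open>S\<close>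
  (\<open>freeset\<close> and \<open>sideset\<close> below). If both \<open>T\<^sub>p\<close> are nonempty, then \<open>V(I\<^sub>S)\<close> consists of the
  \<open>t \<times> 2k\<^sub>2\<close> matrices whose columns in \<open>S\<close> vanish, whose pairs over \<open>E\<close> are proportional, whose columns
  over \<open>E\<close> have rank at most \<open>t - 2\<close>, and for which the columns over \<open>E\<close> together with those over
  \<open>T\<^sub>p\<close> have rank at most \<open>t - 1\<close>, for each \<open>p\<close>. With \<open>N = (t - 1) k\<^sub>2 + 2 (t - 1)\<close>, which is the number
  in the theorem, the proof has three parts.

  \<^item> Minimality. If a \<open>T\<^sub>p\<close> is empty, \<open>I\<^sub>\<emptyset>\<close> is strictly smaller than \<open>I\<^sub>S\<close>. If \<open>C\<^sub>j \<subseteq> S\<close> for some \<open>j\<close>,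
    deleting one of its columns from \<open>S\<close> gives a strictly smaller ideal. The same happens if \<open>t = 2\<close>,
    \<open>E\<close> is nonempty and a column over \<open>E\<close> is added to \<open>S\<close>, and if \<open>|E| + |T\<^sub>p| < t - 1\<close> and an index
    of the other side is moved into \<open>E\<close> by deleting a column from \<open>S\<close>. Each time inclusion is
    checked on generators, and a variable is separated from the smaller ideal by a matrix with a single nonzero entry
    (locale \<open>minimal_ideal\<close>).

  \<^item> Lower bound. The matrices of the shape above are parametrised polynomially with \<open>N\<close> parameters. The
    parameters are specialised one after the other, in an order in which each of them is literally a matrix
    entry when its turn comes. The images of these ever smaller parameter spaces have prime vanishing ideals,
    because any two of their points are joined by a polynomial curve, and the ideals increase strictly
    (\<open>specialization_chain\<close>, \<open>prime_chain_exists\<close>). This needs the numerical conditions from minimality.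

  \<^item> Upper bound. For a prime \<open>P \<supseteq> I\<^sub>S\<close>, extending minors outside \<open>P\<close> greedily and solving the vanishing
    bordered minors expresses every entry of \<open>X\<close> modulo \<open>P\<close> as a rational function of at most \<open>N\<close>
    elements (\<open>entries_generated\<close>). A chain of \<open>n\<close> strict inclusions of primes starting at \<open>P\<close> yields \<open>n\<close>
    elements that are algebraically independent modulo \<open>P\<close>, and counting monomials gives \<open>n \<le> N\<close>
    (\<open>affine_prime_chain_bound\<close>).
\<close>

section \<open>Counting monomials modulo a prime\<close>

definition exponents :: "nat \<Rightarrow> nat \<Rightarrow> nat list set" where
  "exponents n D = {\<beta>. length \<beta> = n \<and> set \<beta> \<subseteq> {..D}}"

definition pmonom :: "'a::comm_ring_1 list \<Rightarrow> nat list \<Rightarrow> 'a" where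
  "pmonom zs \<beta> = prod_list (map2 (^) zs \<beta>)"

lemma finite_exponents [simp]: "finite (exponents n D)"
  using finite_lists_length_eq[of "{..D}" n] by (simp add: exponents_def conj_commute)

lemma card_exponents: "card (exponents n D) = Suc D ^ n"
  using card_lists_length_eq[of "{..D}" n] by (simp add: exponents_def conj_commute)

lemma exponents_Suc: "exponents (Suc n) D = case_prod (#) ` ({..D} \<times> exponents n D)"
  by (auto simp: exponents_def length_Suc_conv image_iff)

lemma pmonom_Cons [simp]: "pmonom (z # zs) (a # \<beta>) = z ^ a * pmonom zs \<beta>"
  by (simp add: pmonom_def)

lemma pmonom_Nil [simp]: "pmonom [] \<beta> = 1" "pmonom zs [] = 1"
  by (simp_all add: pmonom_def)

lemma pmonom_replicate_0: "pmonom zs (replicate n 0) = 1"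
proof (induction zs arbitrary: n)
  case (Cons z zs)
  then show ?case by (cases n) auto
qed simp

lemma pmonom_add:
  "length \<beta> = length zs \<Longrightarrow> length \<gamma> = length zs \<Longrightarrow>
    pmonom zs (map2 (+) \<beta> \<gamma>) = pmonom zs \<beta> * pmonom zs \<gamma>"
proof (induction zs arbitrary: \<beta> \<gamma>)
  case (Cons z zs)
  then obtain b \<beta>' c \<gamma>' where "\<beta> = b # \<beta>'" "\<gamma> = c # \<gamma>'"
    by (metis length_Suc_conv)
  with Cons show ?case by (simp add: power_add mult_ac)
qed simp

lemma exponents_add:
  "\<beta> \<in> exponents n D \<Longrightarrow> \<gamma> \<in> exponents n D' \<Longrightarrow> map2 (+) \<beta> \<gamma> \<in> exponents n (D + D')"
proof -
  assume *: "\<beta> \<in> exponents n D" "\<gamma> \<in> exponents n D'"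
  have "b + c \<le> D + D'" if "(b, c) \<in> set (zip \<beta> \<gamma>)" for b c
    using set_zip_leftD[OF that] set_zip_rightD[OF that] *
    by (intro add_mono) (auto simp: exponents_def)
  with * show ?thesis by (auto simp: exponents_def)
qed

lemma exists_pmonom_eq:
  "z \<in> set zs \<Longrightarrow> \<exists>\<beta>\<in>exponents (length zs) 1. pmonom zs \<beta> = z"
proof (induction zs)
  case (Cons y zs)
  show ?case
  proof (cases "z = y")
    case True
    then show ?thesis
      by (intro bexI[of _ "1 # replicate (length zs) 0"])
         (auto simp: pmonom_replicate_0 exponents_def)
  next
    case False
    with Cons obtain \<beta> where "\<beta> \<in> exponents (length zs) 1" "pmonom zs \<beta> = z" by auto
    then show ?thesis
      by (intro bexI[of _ "0 # \<beta>"]) (auto simp: exponents_def)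
  qed
qed simp

text \<open>
  Induction on the equations: an equation with a nonzero coefficient is solved for one unknown, which is
  eliminated from the others.
\<close>

lemma underdetermined_system:
  fixes q :: "'a \<Rightarrow> 'b \<Rightarrow> 'k::field"
  assumes "finite B" "finite A" "card B < card A"
  shows "\<exists>c. (\<exists>a\<in>A. c a \<noteq> 0) \<and> (\<forall>b\<in>B. (\<Sum>a\<in>A. c a * q a b) = 0)"
  using assms
proof (induction B arbitrary: A q rule: finite_induct)
  case empty
  then obtain a where "a \<in> A" by fastforce
  then show ?case by (intro exI[of _ "\<lambda>_. 1"]) auto
next
  case (insert b B)
  show ?case
  proof (cases "\<forall>a\<in>A. q a b = 0")
    case True
    from insert have "card B < card A" by simp
    from insert.IH[OF insert.prems(1) this, of q] True show ?thesis by auto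
  next
    case False
    then obtain p where p: "p \<in> A" "q p b \<noteq> 0" by auto
    define q' where "q' a b' = q a b' - q a b / q p b * q p b'" for a b'
    have "card B < card (A - {p})" using insert p by simp
    from insert.IH[OF _ this, of q'] insert.prems(1)
    obtain c where c: "\<exists>a\<in>A - {p}. c a \<noteq> 0" "\<forall>b'\<in>B. (\<Sum>a\<in>A - {p}. c a * q' a b') = 0"
      by auto
    define d where "d a = (if a = p then - (\<Sum>a\<in>A - {p}. c a * q a b) / q p b else c a)" for a
    have d: "(\<Sum>a\<in>A. d a * q a b') = (\<Sum>a\<in>A - {p}. c a * q' a b')" for b'
    proof -
      have "(\<Sum>a\<in>A. d a * q a b') = d p * q p b' + (\<Sum>a\<in>A - {p}. d a * q a b')"
        using insert.prems(1) p(1) by (simp add: sum.remove)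
      also have "(\<Sum>a\<in>A - {p}. d a * q a b') = (\<Sum>a\<in>A - {p}. c a * q a b')"
        by (intro sum.cong) (auto simp: d_def)
      also have "d p * q p b' = - (\<Sum>a\<in>A - {p}. c a * (q a b / q p b * q p b'))"
        by (simp add: d_def sum_distrib_right sum_divide_distrib mult.assoc flip: sum_negf)
      finally show ?thesis
        by (simp add: q'_def algebra_simps sum_subtractf)
    qed
    have "(\<Sum>a\<in>A - {p}. c a * q' a b) = 0"
      using p(2) by (simp add: q'_def)
    with d c(2) have "\<forall>b'\<in>insert b B. (\<Sum>a\<in>A. d a * q a b') = 0" by simp
    moreover have "\<exists>a\<in>A. d a \<noteq> 0" using c(1) by (auto simp: d_def)
    ultimately show ?thesis by blast
  qed
qed

text \<open>
  Every element of \<open>R\<close> is a polynomial in elements of \<open>X\<close>; subtraction is available through the constant \<open>- 1\<close>.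
\<close>

definition ring_generated :: "('k \<Rightarrow> 'a::comm_ring_1) \<Rightarrow> 'a set \<Rightarrow> 'a set \<Rightarrow> bool" where
  "ring_generated \<kappa> X R \<longleftrightarrow>
    (\<forall>Y. X \<union> range \<kappa> \<subseteq> Y \<longrightarrow> (\<forall>x\<in>Y. \<forall>y\<in>Y. x + y \<in> Y \<and> x * y \<in> Y) \<longrightarrow> R \<subseteq> Y)"

lemma ring_generatedD:
  assumes "ring_generated \<kappa> X R" "X \<subseteq> Y" "range \<kappa> \<subseteq> Y"
    "\<And>x y. x \<in> Y \<Longrightarrow> y \<in> Y \<Longrightarrow> x + y \<in> Y \<and> x * y \<in> Y"
  shows "R \<subseteq> Y"
  using assms unfolding ring_generated_def by (metis Un_least)

text \<open>
  A prime ideal \<open>P\<close> of a subring \<open>R\<close> that contains a field of constants. Both are subsets of a type, so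
  that several primes of the same polynomial ring can be compared without passing to quotients.
\<close>

locale affine_prime =
  fixes R P :: "'a::comm_ring_1 set" and \<kappa> :: "'k::field \<Rightarrow> 'a"
  assumes R_add: "x \<in> R \<Longrightarrow> y \<in> R \<Longrightarrow> x + y \<in> R"
    and R_mult: "x \<in> R \<Longrightarrow> y \<in> R \<Longrightarrow> x * y \<in> R"
    and kappa_R: "\<kappa> c \<in> R"
    and kappa_1: "\<kappa> 1 = 1"
    and kappa_add: "\<kappa> (c + d) = \<kappa> c + \<kappa> d"
    and kappa_mult: "\<kappa> (c * d) = \<kappa> c * \<kappa> d"
    and P_R: "P \<subseteq> R"
    and P_zero: "0 \<in> P"
    and P_add: "x \<in> P \<Longrightarrow> y \<in> P \<Longrightarrow> x + y \<in> P"
    and P_absorb: "r \<in> R \<Longrightarrow> x \<in> P \<Longrightarrow> r * x \<in> P"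
    and P_one: "1 \<notin> P"
    and P_prime: "x \<in> R \<Longrightarrow> y \<in> R \<Longrightarrow> x * y \<in> P \<Longrightarrow> x \<in> P \<or> y \<in> P"
begin

lemma kappa_0: "\<kappa> 0 = 0"
  using kappa_add[of 0 0] by simp

lemma kappa_uminus: "\<kappa> (- c) = - \<kappa> c"
  using kappa_add[of "- c" c] by (simp add: kappa_0 eq_neg_iff_add_eq_0)

lemma kappa_sum: "\<kappa> (sum f A) = (\<Sum>a\<in>A. \<kappa> (f a))"
  by (induction A rule: infinite_finite_induct) (simp_all add: kappa_0 kappa_add)

lemma R_zero: "0 \<in> R" and R_one: "1 \<in> R"
  using kappa_R[of 0] kappa_R[of 1] by (simp_all add: kappa_0 kappa_1)

lemma R_uminus: "x \<in> R \<Longrightarrow> - x \<in> R"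
  using R_mult[of "\<kappa> (- 1)" x] kappa_R[of "- 1"] by (simp add: kappa_uminus kappa_1)

lemma R_power: "x \<in> R \<Longrightarrow> x ^ n \<in> R"
  by (induction n) (auto intro: R_mult R_one)

lemma R_sum: "(\<And>a. a \<in> A \<Longrightarrow> f a \<in> R) \<Longrightarrow> sum f A \<in> R"
  by (induction A rule: infinite_finite_induct) (auto intro: R_add R_zero)

lemma P_uminus: "x \<in> P \<Longrightarrow> - x \<in> P"
  using P_absorb[of "- 1" x] R_uminus[OF R_one] by simp

lemma P_diff: "x \<in> P \<Longrightarrow> y \<in> P \<Longrightarrow> x - y \<in> P"
  using P_add[of x "- y"] P_uminus by simp

lemma P_sum: "(\<And>a. a \<in> A \<Longrightarrow> f a \<in> P) \<Longrightarrow> sum f A \<in> P"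
  by (induction A rule: infinite_finite_induct) (auto intro: P_add P_zero)

lemma P_add_iff: "y \<in> P \<Longrightarrow> x + y \<in> P \<longleftrightarrow> x \<in> P"
  using P_add[of x y] P_diff[of "x + y" y] by auto

lemma P_power: "x \<in> R \<Longrightarrow> x ^ n \<in> P \<Longrightarrow> x \<in> P"
  by (induction n) (use P_one P_prime R_power in auto)

lemma kappa_P: "\<kappa> c \<in> P \<longleftrightarrow> c = 0"
proof
  assume *: "\<kappa> c \<in> P"
  show "c = 0"
  proof (rule ccontr)
    assume "c \<noteq> 0"
    then have "\<kappa> (inverse c) * \<kappa> c = 1" by (simp add: kappa_1 flip: kappa_mult)
    with P_absorb[OF kappa_R *, of "inverse c"] P_one show False by simp
  qed
qed (simp add: kappa_0 P_zero)

lemma pmonom_R: "set zs \<subseteq> R \<Longrightarrow> pmonom zs \<beta> \<in> R"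
proof (induction zs arbitrary: \<beta>)
  case (Cons z zs)
  then show ?case by (cases \<beta>) (auto intro!: R_mult R_power R_one)
qed (simp add: R_one)

definition poly_value :: "'a list \<Rightarrow> nat \<Rightarrow> (nat list \<Rightarrow> 'k) \<Rightarrow> 'a" where
  "poly_value zs D q = (\<Sum>\<beta>\<in>exponents (length zs) D. \<kappa> (q \<beta>) * pmonom zs \<beta>)"

text \<open>
  The bound \<open>D\<close> applies to each exponent separately, which makes the number of monomials a power of
  \<open>D + 1\<close>.
\<close>

definition bounded_polys :: "'a list \<Rightarrow> nat \<Rightarrow> 'a set" where
  "bounded_polys zs D = range (poly_value zs D)"

lemma bounded_polys_pmonom:
  assumes "\<beta> \<in> exponents (length zs) D"
  shows "\<kappa> c * pmonom zs \<beta> \<in> bounded_polys zs D"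
proof -
  have "poly_value zs D (\<lambda>\<gamma>. if \<gamma> = \<beta> then c else 0) =
      (\<Sum>\<gamma>\<in>exponents (length zs) D. if \<gamma> = \<beta> then \<kappa> c * pmonom zs \<beta> else 0)"
    unfolding poly_value_def by (intro sum.cong) (auto simp: kappa_0)
  also have "\<dots> = \<kappa> c * pmonom zs \<beta>" using assms by simp
  finally show ?thesis unfolding bounded_polys_def by (metis rangeI)
qed

lemma bounded_polys_add:
  assumes "g \<in> bounded_polys zs D" "h \<in> bounded_polys zs D"
  shows "g + h \<in> bounded_polys zs D"
proof -
  have "poly_value zs D q + poly_value zs D q' = poly_value zs D (\<lambda>\<beta>. q \<beta> + q' \<beta>)" for q q'
    by (simp add: poly_value_def kappa_add sum.distrib distrib_right)
  with assms show ?thesis by (auto simp: bounded_polys_def)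
qed

lemma bounded_polys_const: "\<kappa> c \<in> bounded_polys zs D"
proof -
  have "replicate (length zs) 0 \<in> exponents (length zs) D" by (auto simp: exponents_def)
  from bounded_polys_pmonom[OF this, of c] show ?thesis by (simp add: pmonom_replicate_0)
qed

lemma bounded_polys_sum:
  "(\<And>a. a \<in> A \<Longrightarrow> f a \<in> bounded_polys zs D) \<Longrightarrow> sum f A \<in> bounded_polys zs D"
  using bounded_polys_const[of 0 zs D]
  by (induction A rule: infinite_finite_induct) (auto intro: bounded_polys_add simp: kappa_0)

lemma bounded_polys_mult:
  assumes "g \<in> bounded_polys zs D" "h \<in> bounded_polys zs D'"
  shows "g * h \<in> bounded_polys zs (D + D')"
proof -
  let ?n = "length zs"
  obtain q q' where g: "g = poly_value zs D q" and h: "h = poly_value zs D' q'"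
    using assms by (auto simp: bounded_polys_def)
  have "g * h = (\<Sum>\<beta>\<in>exponents ?n D. \<Sum>\<gamma>\<in>exponents ?n D'.
      \<kappa> (q \<beta> * q' \<gamma>) * pmonom zs (map2 (+) \<beta> \<gamma>))"
    unfolding g h poly_value_def sum_product
    by (intro sum.cong refl) (auto simp: exponents_def pmonom_add kappa_mult mult_ac)
  also have "\<dots> \<in> bounded_polys zs (D + D')"
    by (intro bounded_polys_sum bounded_polys_pmonom exponents_add)
  finally show ?thesis .
qed

lemma bounded_polys_mono: "g \<in> bounded_polys zs D \<Longrightarrow> D \<le> D' \<Longrightarrow> g \<in> bounded_polys zs D'"
  using bounded_polys_mult[of g zs D 1 "D' - D"] bounded_polys_const[of 1] by (simp add: kappa_1)

lemma bounded_polys_var: "z \<in> set zs \<Longrightarrow> z \<in> bounded_polys zs 1"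
  using exists_pmonom_eq[of z zs] bounded_polys_pmonom[of _ zs 1 1] by (auto simp: kappa_1)

lemma bounded_polys_power: "g \<in> bounded_polys zs D \<Longrightarrow> g ^ m \<in> bounded_polys zs (m * D)"
proof (induction m)
  case 0
  then show ?case using bounded_polys_const[of 1 zs 0] by (simp add: kappa_1)
next
  case (Suc m)
  then show ?case using bounded_polys_mult[of g zs D "g ^ m" "m * D"] by simp
qed

lemma bounded_polys_R: "set zs \<subseteq> R \<Longrightarrow> g \<in> bounded_polys zs D \<Longrightarrow> g \<in> R"
  by (auto simp: bounded_polys_def poly_value_def intro!: R_sum R_mult kappa_R pmonom_R)

text \<open>
  The elements of \<open>R\<close> whose classes lie in the subfield generated by \<open>zs\<close> of the fraction field of
  \<open>R / P\<close>, described by clearing denominators.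
\<close>

definition rational_closure :: "'a list \<Rightarrow> 'a set" where
  "rational_closure zs = {g \<in> R. \<exists>D. \<exists>h \<in> bounded_polys zs D - P. \<exists>q \<in> bounded_polys zs D. h * g - q \<in> P}"

lemma rational_closureI:
  assumes "g \<in> R" "h \<in> bounded_polys zs D" "h \<notin> P" "q \<in> bounded_polys zs D'" "h * g - q \<in> P"
  shows "g \<in> rational_closure zs"
  unfolding rational_closure_def using assms bounded_polys_mono[of h zs D "max D D'"]
    bounded_polys_mono[of q zs D' "max D D'"] by auto

lemma rational_closure_R: "rational_closure zs \<subseteq> R"
  by (auto simp: rational_closure_def)

lemma rational_closure_of_bounded_polys:
  assumes "set zs \<subseteq> R" "g \<in> bounded_polys zs D"
  shows "g \<in> rational_closure zs"
  using bounded_polys_const[of 1 zs 0] bounded_polys_R[OF assms] assms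
  by (intro rational_closureI[of g 1 zs 0 g D]) (simp_all add: kappa_1 P_one P_zero)

lemma rational_closure_var: "set zs \<subseteq> R \<Longrightarrow> z \<in> set zs \<Longrightarrow> z \<in> rational_closure zs"
  by (auto intro: rational_closure_of_bounded_polys bounded_polys_var)

lemma rational_closure_const: "set zs \<subseteq> R \<Longrightarrow> \<kappa> c \<in> rational_closure zs"
  by (auto intro: rational_closure_of_bounded_polys bounded_polys_const)

lemma rational_closureE:
  assumes "g \<in> rational_closure zs" "set zs \<subseteq> R"
  obtains D h q where "g \<in> R" "h \<in> R" "q \<in> R" "h \<in> bounded_polys zs D" "h \<notin> P"
    "q \<in> bounded_polys zs D" "h * g - q \<in> P"
  using assms bounded_polys_R[of zs] unfolding rational_closure_def by blast

lemma rational_closure_cong: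
  assumes "g \<in> rational_closure zs" "g' \<in> R" "g - g' \<in> P" "set zs \<subseteq> R"
  shows "g' \<in> rational_closure zs"
proof -
  from assms obtain D h q where h: "h \<in> R" "h \<in> bounded_polys zs D" "h \<notin> P"
    "q \<in> bounded_polys zs D" "h * g - q \<in> P" by (auto elim: rational_closureE)
  have "h * g - q - h * (g - g') \<in> P"
    by (rule P_diff[OF h(5) P_absorb[OF h(1) assms(3)]])
  then show ?thesis using h assms by (intro rational_closureI[of g' h zs D q D]) (auto simp: algebra_simps)
qed

lemma rational_closure_P: "set zs \<subseteq> R \<Longrightarrow> g \<in> P \<Longrightarrow> g \<in> rational_closure zs"
  using rational_closure_cong[of 0 zs g] rational_closure_const[of zs 0] P_R P_uminus by (auto simp: kappa_0)

lemma rational_closure_add: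
  assumes "set zs \<subseteq> R" "f \<in> rational_closure zs" "g \<in> rational_closure zs"
  shows "f + g \<in> rational_closure zs"
proof -
  from assms obtain D h q where h: "f \<in> R" "h \<in> R" "q \<in> R" "h \<in> bounded_polys zs D" "h \<notin> P"
    "q \<in> bounded_polys zs D" "h * f - q \<in> P" by (auto elim: rational_closureE)
  from assms obtain D' h' q' where h': "g \<in> R" "h' \<in> R" "q' \<in> R" "h' \<in> bounded_polys zs D'"
    "h' \<notin> P" "q' \<in> bounded_polys zs D'" "h' * g - q' \<in> P" by (auto elim: rational_closureE)
  have "h' * (h * f - q) + h * (h' * g - q') \<in> P"
    by (rule P_add[OF P_absorb[OF h'(2) h(7)] P_absorb[OF h(2) h'(7)]])
  also have "h' * (h * f - q) + h * (h' * g - q') = (h * h') * (f + g) - (q * h' + h * q')"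
    by (simp add: algebra_simps)
  finally show ?thesis using h h' P_prime
    by (intro rational_closureI[of _ "h * h'" zs "D + D'" "q * h' + h * q'" "D + D'"])
       (auto intro: R_add bounded_polys_mult bounded_polys_add)
qed

lemma rational_closure_mult:
  assumes "set zs \<subseteq> R" "f \<in> rational_closure zs" "g \<in> rational_closure zs"
  shows "f * g \<in> rational_closure zs"
proof -
  from assms obtain D h q where h: "f \<in> R" "h \<in> R" "q \<in> R" "h \<in> bounded_polys zs D" "h \<notin> P"
    "q \<in> bounded_polys zs D" "h * f - q \<in> P" by (auto elim: rational_closureE)
  from assms obtain D' h' q' where h': "g \<in> R" "h' \<in> R" "q' \<in> R" "h' \<in> bounded_polys zs D'"
    "h' \<notin> P" "q' \<in> bounded_polys zs D'" "h' * g - q' \<in> P" by (auto elim: rational_closureE)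
  have "(h' * g) * (h * f - q) + q * (h' * g - q') \<in> P"
    by (rule P_add[OF P_absorb[OF R_mult[OF h'(2,1)] h(7)] P_absorb[OF h(3) h'(7)]])
  also have "(h' * g) * (h * f - q) + q * (h' * g - q') = (h * h') * (f * g) - q * q'"
    by (simp add: algebra_simps)
  finally show ?thesis using h h' P_prime
    by (intro rational_closureI[of _ "h * h'" zs "D + D'" "q * q'" "D + D'"])
       (auto intro: R_mult bounded_polys_mult)
qed

lemma rational_closure_uminus: "set zs \<subseteq> R \<Longrightarrow> g \<in> rational_closure zs \<Longrightarrow> - g \<in> rational_closure zs"
  using rational_closure_mult[of zs "\<kappa> (- 1)" g] rational_closure_const[of zs "- 1"] by (simp add: kappa_uminus kappa_1)

lemma rational_closure_sum:
  "set zs \<subseteq> R \<Longrightarrow> (\<And>a. a \<in> A \<Longrightarrow> f a \<in> rational_closure zs) \<Longrightarrow> sum f A \<in> rational_closure zs"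
  using rational_closure_const[of zs 0]
  by (induction A rule: infinite_finite_induct) (auto intro: rational_closure_add simp: kappa_0)

lemma rational_closure_prod:
  "set zs \<subseteq> R \<Longrightarrow> (\<And>a. a \<in> A \<Longrightarrow> f a \<in> rational_closure zs) \<Longrightarrow> prod f A \<in> rational_closure zs"
  using rational_closure_const[of zs 1]
  by (induction A rule: infinite_finite_induct) (auto intro: rational_closure_mult simp: kappa_1)

text \<open>
  Together with closure under sums and products, this lets \<open>rational_closure\<close> be used like a subfield: a linear
  equation modulo \<open>P\<close> with leading coefficient outside \<open>P\<close> can be solved.
\<close>

lemma rational_closure_divide:
  assumes "set zs \<subseteq> R" "f \<in> rational_closure zs" "f \<notin> P" "g \<in> R" "f * g \<in> rational_closure zs"
  shows "g \<in> rational_closure zs"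
proof -
  from assms obtain D h q where h: "f \<in> R" "h \<in> R" "q \<in> R" "h \<in> bounded_polys zs D" "h \<notin> P"
    "q \<in> bounded_polys zs D" "h * f - q \<in> P" by (auto elim: rational_closureE)
  from assms obtain D' h' q' where h': "h' \<in> R" "q' \<in> R" "h' \<in> bounded_polys zs D'"
    "h' \<notin> P" "q' \<in> bounded_polys zs D'" "h' * (f * g) - q' \<in> P" by (auto elim: rational_closureE)
  have "q \<notin> P"
    using h P_add[OF h(7), of q] P_prime[of h f] assms(3) by auto
  have "h * (h' * (f * g) - q') - (h' * g) * (h * f - q) \<in> P"
    by (rule P_diff[OF P_absorb[OF h(2) h'(6)] P_absorb[OF R_mult[OF h'(1) assms(4)] h(7)]])
  also have "h * (h' * (f * g) - q') - (h' * g) * (h * f - q) = (h' * q) * g - h * q'"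
    by (simp add: algebra_simps)
  finally show ?thesis using h h' P_prime assms(4) \<open>q \<notin> P\<close>
    by (intro rational_closureI[of _ "h' * q" zs "D' + D" "h * q'" "D + D'"])
       (auto intro: bounded_polys_mult)
qed

lemma common_denominator:
  assumes "finite X" "X \<subseteq> rational_closure zs" "set zs \<subseteq> R"
  shows "\<exists>h D. h \<in> bounded_polys zs D \<and> h \<notin> P \<and> (\<forall>x\<in>X. \<exists>q\<in>bounded_polys zs D. h * x - q \<in> P)"
  using assms(1,2)
proof (induction X rule: finite_induct)
  case empty
  show ?case using bounded_polys_const[of 1 zs 0] P_one by (auto simp: kappa_1)
next
  case (insert x X)
  then obtain h D where h: "h \<in> bounded_polys zs D" "h \<notin> P"
    "\<forall>x\<in>X. \<exists>q\<in>bounded_polys zs D. h * x - q \<in> P" by auto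
  from insert assms(3) obtain D' h' q' where h': "x \<in> R" "h' \<in> R" "q' \<in> R"
    "h' \<in> bounded_polys zs D'" "h' \<notin> P" "q' \<in> bounded_polys zs D'" "h' * x - q' \<in> P"
    by (auto elim: rational_closureE)
  note hR = bounded_polys_R[OF assms(3) h(1)]
  have "\<exists>q\<in>bounded_polys zs (D + D'). (h * h') * y - q \<in> P" if "y \<in> insert x X" for y
  proof (cases "y = x")
    case True
    with P_absorb[OF hR h'(7)] bounded_polys_mult[OF h(1) h'(6)] show ?thesis
      by (intro bexI[of _ "h * q'"]) (simp_all add: right_diff_distrib mult.assoc)
  next
    case False
    with that h(3) obtain q where q: "q \<in> bounded_polys zs D" "h * y - q \<in> P" by auto
    with P_absorb[OF h'(2) q(2)] bounded_polys_mult[OF q(1) h'(4)] show ?thesis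
      by (intro bexI[of _ "q * h'"]) (simp_all add: algebra_simps)
  qed
  moreover have "h * h' \<notin> P" using P_prime[OF hR h'(2)] h(2) h'(5) by auto
  ultimately show ?case using bounded_polys_mult[OF h(1) h'(4)] by blast
qed

text \<open>
  The degree of the numerator is bounded linearly in the exponent \<open>m\<close> of the denominator \<open>h\<close>; the monomial
  count depends on this.
\<close>

definition clears :: "'a list \<Rightarrow> 'a \<Rightarrow> nat \<Rightarrow> nat \<Rightarrow> 'a \<Rightarrow> bool" where
  "clears zs h D m g \<longleftrightarrow> g \<in> R \<and> (\<exists>q\<in>bounded_polys zs (m * D). h ^ m * g - q \<in> P)"

lemma clears_mult:
  assumes "h \<in> R" "set zs \<subseteq> R" "clears zs h D m f" "clears zs h D m' g"
  shows "clears zs h D (m + m') (f * g)"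
proof -
  from assms obtain q q' where q: "f \<in> R" "g \<in> R" "q \<in> bounded_polys zs (m * D)"
    "h ^ m * f - q \<in> P" "q' \<in> bounded_polys zs (m' * D)" "h ^ m' * g - q' \<in> P"
    by (auto simp: clears_def)
  have "(h ^ m' * g) * (h ^ m * f - q) + q * (h ^ m' * g - q') \<in> P"
    by (rule P_add[OF P_absorb[OF R_mult[OF R_power[OF assms(1)] q(2)] q(4)]
          P_absorb[OF bounded_polys_R[OF assms(2) q(3)] q(6)]])
  moreover have "(h ^ m' * g) * (h ^ m * f - q) + q * (h ^ m' * g - q')
      = h ^ (m + m') * (f * g) - q * q'"
    by (simp add: algebra_simps power_add)
  ultimately show ?thesis using q R_mult
    by (auto simp: clears_def add_mult_distrib intro!: bexI[of _ "q * q'"] bounded_polys_mult)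
qed

lemma clears_const: "set zs \<subseteq> R \<Longrightarrow> clears zs h D 0 (\<kappa> c)"
  using bounded_polys_const[of c zs 0] P_zero kappa_R
  by (auto simp: clears_def intro!: bexI[of _ "\<kappa> c"])

lemma clears_mono:
  assumes "h \<in> bounded_polys zs D" "set zs \<subseteq> R" "clears zs h D m f" "m \<le> m'"
  shows "clears zs h D m' f"
proof -
  have "h \<in> R" using assms bounded_polys_R by blast
  from assms obtain q where q: "f \<in> R" "q \<in> bounded_polys zs (m * D)" "h ^ m * f - q \<in> P"
    by (auto simp: clears_def)
  have "h ^ (m' - m) * (h ^ m * f - q) \<in> P" by (intro P_absorb R_power q \<open>h \<in> R\<close>)
  moreover have "h ^ (m' - m) * (h ^ m * f - q) = h ^ m' * f - h ^ (m' - m) * q"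
    using \<open>m \<le> m'\<close> by (simp add: algebra_simps flip: power_add)
  moreover have "h ^ (m' - m) * q \<in> bounded_polys zs (m' * D)"
    using bounded_polys_mult[OF bounded_polys_power[OF assms(1), of "m' - m"] q(2)] \<open>m \<le> m'\<close>
    by (simp flip: add_mult_distrib)
  ultimately show ?thesis using q by (auto simp: clears_def)
qed

lemma clears_add:
  assumes "clears zs h D m f" "clears zs h D m g"
  shows "clears zs h D m (f + g)"
proof -
  from assms obtain q q' where q: "f \<in> R" "g \<in> R" "q \<in> bounded_polys zs (m * D)"
    "h ^ m * f - q \<in> P" "q' \<in> bounded_polys zs (m * D)" "h ^ m * g - q' \<in> P"
    by (auto simp: clears_def)
  from P_add[OF q(4,6)] q show ?thesis
    by (auto simp: clears_def algebra_simps intro!: bexI[of _ "q + q'"] bounded_polys_add R_add)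
qed

lemma clears_pmonom:
  assumes "h \<in> R" "set zs \<subseteq> R" "\<forall>f\<in>set fs. clears zs h D m f" "length \<alpha> = length fs"
  shows "clears zs h D (m * sum_list \<alpha>) (pmonom fs \<alpha>)"
  using assms(3,4)
proof (induction fs arbitrary: \<alpha>)
  case Nil
  then show ?case using clears_const[OF assms(2), of h D 1] by (simp add: kappa_1)
next
  case (Cons f fs)
  then obtain a \<beta> where \<alpha>: "\<alpha> = a # \<beta>" by (cases \<alpha>) auto
  have "clears zs h D (m * a) (f ^ a)"
  proof (induction a)
    case 0
    then show ?case using clears_const[OF assms(2), of h D 1] by (simp add: kappa_1)
  next
    case (Suc a)
    with Cons.prems show ?case
      using clears_mult[OF assms(1,2), of D m f "m * a" "f ^ a"] by simp
  qed
  then show ?case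
    using clears_mult[OF assms(1,2)] Cons unfolding \<alpha> by (auto simp: distrib_left)
qed

definition independent_mod :: "'a list \<Rightarrow> bool" where
  "independent_mod fs \<longleftrightarrow>
    (\<forall>s c. poly_value fs s c \<in> P \<longrightarrow> (\<forall>\<alpha>\<in>exponents (length fs) s. c \<alpha> = 0))"

text \<open>
  Algebraically independent elements are no more numerous than generators of the fraction field. There are
  \<open>(s + 1)\<^sup>n\<close> monomials in the \<open>n\<close> elements \<open>fs\<close> with exponents at most \<open>s\<close>. After multiplication with one
  power of a common denominator, all of them are polynomials in the \<open>N\<close> generators with exponents of order
  \<open>s\<close>, a space of dimension of order \<open>s\<^sup>N\<close>. If \<open>n > N\<close>, then for large \<open>s\<close> the monomials are linearly
  dependent modulo \<open>P\<close>.
\<close>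

lemma independent_mod_length_le:
  assumes zs: "set zs \<subseteq> R" and X: "finite X" "X \<subseteq> rational_closure zs"
    and gen: "ring_generated \<kappa> X R"
    and fs: "set fs \<subseteq> R" "independent_mod fs"
  shows "length fs \<le> length zs"
proof (rule ccontr)
  assume "\<not> length fs \<le> length zs"
  then have lt: "length zs < length fs" by simp
  define n N where "n = length fs" and "N = length zs"
  obtain h D where h: "h \<in> bounded_polys zs D" "h \<notin> P"
    and hX: "\<forall>x\<in>X. \<exists>q\<in>bounded_polys zs D. h * x - q \<in> P"
    using common_denominator[OF X zs] by auto
  have hR: "h \<in> R" using h zs bounded_polys_R by blast
  have all: "R \<subseteq> {g. \<exists>m. clears zs h D m g}"
  proof (rule ring_generatedD[OF gen])
    show "X \<subseteq> {g. \<exists>m. clears zs h D m g}"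
      using hX X rational_closure_R by (auto simp: clears_def intro!: exI[of _ 1])
    show "range \<kappa> \<subseteq> {g. \<exists>m. clears zs h D m g}"
      using clears_const[OF zs] by auto
    fix x y assume "x \<in> {g. \<exists>m. clears zs h D m g}" "y \<in> {g. \<exists>m. clears zs h D m g}"
    then obtain m m' where m: "clears zs h D m x" "clears zs h D m' y" by auto
    then have "clears zs h D (m + m') x" "clears zs h D (m + m') y"
      using clears_mono[OF h(1) zs] by auto
    from clears_add[OF this] clears_mult[OF hR zs m]
    show "x + y \<in> {g. \<exists>m. clears zs h D m g} \<and> x * y \<in> {g. \<exists>m. clears zs h D m g}" by auto
  qed
  have "\<exists>m. \<forall>f\<in>set fs. clears zs h D m f"
    using fs(1)
  proof (induction fs)
    case (Cons f fs)
    with all obtain m m' where "\<forall>f\<in>set fs. clears zs h D m f" "clears zs h D m' f" by auto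
    then have "\<forall>f\<in>set (f # fs). clears zs h D (m + m') f"
      using clears_mono[OF h(1) zs] by auto
    then show ?case by blast
  qed simp
  then obtain m where m: "\<forall>f\<in>set fs. clears zs h D m f" by blast
  (* On the side of the generators an exponent takes M * D + 1 <= K * (s + 1) values, and
     s = K ^ N makes (K * (s + 1)) ^ N smaller than (s + 1) ^ (N + 1). *)
  define K where "K = m * n * D + 1"
  define s where "s = K ^ N"
  define M where "M = m * (n * s)"
  have card: "card (exponents N (M * D)) < card (exponents n s)"
  proof -
    have "Suc (M * D) \<le> K * Suc s"
      by (simp add: M_def K_def algebra_simps)
    then have "card (exponents N (M * D)) \<le> (K * Suc s) ^ N"
      unfolding card_exponents by (rule power_mono) simp
    also have "\<dots> = s * Suc s ^ N" unfolding power_mult_distrib s_def ..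
    also have "\<dots> < Suc s * Suc s ^ N" by simp
    also have "\<dots> \<le> Suc s ^ n"
      using lt power_increasing[of "Suc N" n "Suc s"] by (simp add: n_def N_def)
    finally show ?thesis by (simp add: card_exponents)
  qed
  have "\<exists>q. h ^ M * pmonom fs \<alpha> - poly_value zs (M * D) q \<in> P" if "\<alpha> \<in> exponents n s" for \<alpha>
  proof -
    have len: "length \<alpha> = n" "\<forall>a\<in>set \<alpha>. a \<le> s" using that by (auto simp: exponents_def)
    have "sum_list \<alpha> \<le> n * s"
      using len by (induction \<alpha> arbitrary: n) (auto intro: add_mono)
    then have "m * sum_list \<alpha> \<le> M" by (simp add: M_def)
    with clears_pmonom[OF hR zs m, of \<alpha>] len clears_mono[OF h(1) zs]
    have "clears zs h D M (pmonom fs \<alpha>)" by (auto simp: n_def)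
    then show ?thesis by (auto simp: clears_def bounded_polys_def)
  qed
  then obtain Q where Q: "\<And>\<alpha>. \<alpha> \<in> exponents n s \<Longrightarrow>
      h ^ M * pmonom fs \<alpha> - poly_value zs (M * D) (Q \<alpha>) \<in> P" by metis
  obtain c where c: "\<exists>\<alpha>\<in>exponents n s. c \<alpha> \<noteq> 0"
    "\<forall>\<beta>\<in>exponents N (M * D). (\<Sum>\<alpha>\<in>exponents n s. c \<alpha> * Q \<alpha> \<beta>) = 0"
    using underdetermined_system[OF _ _ card, of Q] by auto
  have "(\<Sum>\<alpha>\<in>exponents n s. \<kappa> (c \<alpha>) * poly_value zs (M * D) (Q \<alpha>))
      = (\<Sum>\<beta>\<in>exponents N (M * D). \<kappa> (\<Sum>\<alpha>\<in>exponents n s. c \<alpha> * Q \<alpha> \<beta>) * pmonom zs \<beta>)"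
    unfolding poly_value_def kappa_sum kappa_mult sum_distrib_left sum_distrib_right N_def
    by (subst sum.swap) (simp add: mult_ac)
  also have "\<dots> = 0" using c(2) by (simp add: kappa_0)
  finally have "h ^ M * poly_value fs s c
      = (\<Sum>\<alpha>\<in>exponents n s. \<kappa> (c \<alpha>) * (h ^ M * pmonom fs \<alpha> - poly_value zs (M * D) (Q \<alpha>)))"
    by (simp add: poly_value_def sum_distrib_left right_diff_distrib sum_subtractf n_def mult_ac)
  also have "\<dots> \<in> P" by (intro P_sum P_absorb kappa_R Q)
  finally have "h ^ M * poly_value fs s c \<in> P" .
  moreover have "poly_value fs s c \<in> R" using fs(1) bounded_polys_R[of fs _ s] by (auto simp: bounded_polys_def)
  ultimately have "poly_value fs s c \<in> P"
    using P_prime R_power[OF hR] P_power[OF hR] h(2) by blast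
  with fs(2) c(1) show False by (auto simp: independent_mod_def n_def)
qed

lemma poly_value_Cons:
  "poly_value (f # fs) s c = (\<Sum>a\<le>s. f ^ a * poly_value fs s (\<lambda>\<alpha>. c (a # \<alpha>)))"
proof -
  have "poly_value (f # fs) s c = (\<Sum>(a, \<alpha>)\<in>{..s} \<times> exponents (length fs) s.
      f ^ a * (\<kappa> (c (a # \<alpha>)) * pmonom fs \<alpha>))"
    unfolding poly_value_def
    by (simp add: exponents_Suc sum.reindex inj_on_def case_prod_unfold mult_ac)
  also have "\<dots> = (\<Sum>a\<le>s. f ^ a * poly_value fs s (\<lambda>\<alpha>. c (a # \<alpha>)))"
    by (simp add: poly_value_def sum_distrib_left flip: sum.cartesian_product)
  finally show ?thesis .
qed

lemma poly_value_zero: "(\<And>\<alpha>. \<alpha> \<in> exponents (length fs) s \<Longrightarrow> c \<alpha> = 0) \<Longrightarrow> poly_value fs s c = 0"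
  by (simp add: poly_value_def kappa_0)

lemma poly_value_R: "set fs \<subseteq> R \<Longrightarrow> poly_value fs s c \<in> R"
  using bounded_polys_R[of fs _ s] by (auto simp: bounded_polys_def)

lemma independent_mod_Nil: "independent_mod []"
proof -
  have "exponents 0 s = {[]}" for s by (auto simp: exponents_def)
  then show ?thesis by (auto simp: independent_mod_def poly_value_def kappa_P)
qed

end

text \<open>
  In a relation modulo \<open>P\<close>, the powers of \<open>f\<close> common to all terms can be cancelled because \<open>f \<notin> P\<close>. The
  terms that remain without \<open>f\<close> form a relation modulo \<open>Q\<close> between the other elements, because \<open>f \<in> Q\<close>.
\<close>

lemma independent_mod_Cons:
  assumes P: "affine_prime R P \<kappa>" and Q: "affine_prime R Q \<kappa>" and "P \<subseteq> Q"
    and f: "f \<in> Q" "f \<notin> P" and fs: "set fs \<subseteq> R" "affine_prime.independent_mod Q \<kappa> fs"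
  shows "affine_prime.independent_mod P \<kappa> (f # fs)"
proof -
  interpret P: affine_prime R P \<kappa> by fact
  interpret Q: affine_prime R Q \<kappa> by fact
  have fR: "f \<in> R" using f Q.P_R by auto
  show ?thesis
    unfolding P.independent_mod_def
  proof (intro allI impI)
    fix s c assume lc: "P.poly_value (f # fs) s c \<in> P"
    define g where "g a = P.poly_value fs s (\<lambda>\<alpha>. c (a # \<alpha>))" for a
    have gR: "g a \<in> R" for a unfolding g_def by (rule P.poly_value_R[OF fs(1)])
    have sum: "(\<Sum>a\<le>s. f ^ a * g a) \<in> P"
      using lc unfolding P.poly_value_Cons g_def .
    have coeffs: "\<forall>\<alpha>\<in>exponents (length fs) s. c (a # \<alpha>) = 0" if "a \<le> s" for a
      using that
    proof (induction a rule: less_induct)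
      case (less a)
      have 0: "g b = 0" if "b < a" for b
        unfolding g_def using less that by (intro P.poly_value_zero) auto
      have "(\<Sum>b\<le>s. f ^ b * g b) = (\<Sum>b\<in>{a..s}. f ^ b * g b)"
        using 0 by (intro sum.mono_neutral_right) auto
      also have "\<dots> = f ^ a * (\<Sum>b\<in>{a..s}. f ^ (b - a) * g b)"
        by (simp add: sum_distrib_left flip: mult.assoc power_add)
      finally have "f ^ a * (\<Sum>b\<in>{a..s}. f ^ (b - a) * g b) \<in> P" using sum by simp
      moreover have "(\<Sum>b\<in>{a..s}. f ^ (b - a) * g b) \<in> R"
        by (intro P.R_sum P.R_mult P.R_power fR gR)
      ultimately have "(\<Sum>b\<in>{a..s}. f ^ (b - a) * g b) \<in> P"
        using P.P_prime P.R_power[OF fR] P.P_power[OF fR] f(2) by blast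
      moreover have "(\<Sum>b\<in>{a..s}. f ^ (b - a) * g b)
          = g a + (\<Sum>b\<in>{a<..s}. g b * f ^ (b - a))"
        using less.prems by (simp add: sum.head mult.commute)
      moreover have "(\<Sum>b\<in>{a<..s}. g b * f ^ (b - a)) \<in> Q"
      proof (intro Q.P_sum Q.P_absorb gR)
        fix b assume "b \<in> {a<..s}"
        then obtain d where "b - a = Suc d" by (auto dest: less_imp_Suc_add)
        then show "f ^ (b - a) \<in> Q"
          using Q.P_absorb[OF Q.R_power[OF fR] f(1), of d] by (simp add: mult.commute)
      qed
      ultimately have "g a \<in> Q" using \<open>P \<subseteq> Q\<close> Q.P_add_iff by auto
      then show ?case using fs(2) unfolding Q.independent_mod_def g_def by blast
    qed
    show "\<forall>\<alpha>\<in>exponents (length (f # fs)) s. c \<alpha> = 0"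
    proof
      fix \<alpha> assume "\<alpha> \<in> exponents (length (f # fs)) s"
      then obtain a \<beta> where "\<alpha> = a # \<beta>" "a \<le> s" "\<beta> \<in> exponents (length fs) s"
        by (auto simp: exponents_Suc)
      then show "c \<alpha> = 0" using coeffs by auto
    qed
  qed
qed

text \<open>
  Elements chosen from the successive differences of the chain are algebraically independent modulo its
  bottom.
\<close>

theorem affine_prime_chain_bound:
  fixes Q :: "nat \<Rightarrow> 'a::comm_ring_1 set" and \<kappa> :: "'k::field \<Rightarrow> 'a"
  assumes primes: "\<And>i. i \<le> n \<Longrightarrow> affine_prime R (Q i) \<kappa>"
    and strict: "\<And>i. i < n \<Longrightarrow> Q i \<subset> Q (Suc i)"
    and zs: "set zs \<subseteq> R" and X: "finite X" "X \<subseteq> affine_prime.rational_closure R (Q 0) \<kappa> zs"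
    and gen: "ring_generated \<kappa> X R"
  shows "n \<le> length zs"
proof -
  have "\<exists>fs. length fs = n \<and> set fs \<subseteq> R \<and> affine_prime.independent_mod (Q 0) \<kappa> fs"
    using primes strict
  proof (induction n arbitrary: Q)
    case 0
    then have "affine_prime R (Q 0) \<kappa>" by simp
    then show ?case using affine_prime.independent_mod_Nil by (intro exI[of _ "[]"]) auto
  next
    case (Suc n)
    have "\<exists>fs. length fs = n \<and> set fs \<subseteq> R \<and> affine_prime.independent_mod (Q (Suc 0)) \<kappa> fs"
      using Suc.IH[of "\<lambda>i. Q (Suc i)"] Suc.prems by simp
    then obtain fs where fs: "length fs = n" "set fs \<subseteq> R"
      "affine_prime.independent_mod (Q (Suc 0)) \<kappa> fs" by blast
    from Suc.prems(2)[of 0] obtain f where f: "f \<in> Q (Suc 0)" "f \<notin> Q 0" by auto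
    have Q1: "affine_prime R (Q (Suc 0)) \<kappa>" using Suc.prems(1)[of "Suc 0"] by simp
    have "affine_prime.independent_mod (Q 0) \<kappa> (f # fs)"
      using Suc.prems fs f Q1 by (intro independent_mod_Cons[of R "Q 0" \<kappa> "Q (Suc 0)"]) auto
    moreover have "f \<in> R" using f affine_prime.P_R[OF Q1] by auto
    ultimately show ?case using fs by (intro exI[of _ "f # fs"]) auto
  qed
  then obtain fs where fs: "length fs = n" "set fs \<subseteq> R"
    "affine_prime.independent_mod (Q 0) \<kappa> fs" by blast
  have "affine_prime R (Q 0) \<kappa>" by (rule primes) simp
  from affine_prime.independent_mod_length_le[OF this zs X gen fs(2,3)] fs(1)
  show ?thesis by simp
qed

section \<open>Krull dimension of a quotient\<close>

lemma primeideal_quot_vimage: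
  assumes "cring R" "ideal I R" "primeideal Q (R Quot I)"
  shows "primeideal {r \<in> carrier R. I +>\<^bsub>R\<^esub> r \<in> Q} R" "I \<subseteq> {r \<in> carrier R. I +>\<^bsub>R\<^esub> r \<in> Q}"
proof -
  interpret R: cring R by fact
  interpret I: ideal I R by fact
  interpret Q: primeideal Q "R Quot I" by fact
  interpret h: ring_hom_ring R "R Quot I" "(+>\<^bsub>R\<^esub>) I" by (rule I.rcos_ring_hom_ring)
  let ?P = "{r \<in> carrier R. I +>\<^bsub>R\<^esub> r \<in> Q}"
  show "primeideal ?P R"
  proof (rule primeidealI)
    show "ideal ?P R" by (rule h.ideal_vimage[OF Q.is_ideal])
    show "cring R" by fact
    show "carrier R \<noteq> ?P"
    proof
      assume "carrier R = ?P"
      then have "I +>\<^bsub>R\<^esub> \<one>\<^bsub>R\<^esub> \<in> Q" using R.one_closed by blast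
      then have "\<one>\<^bsub>R Quot I\<^esub> \<in> Q" using h.hom_one by simp
      then show False using Q.one_imp_carrier Q.I_notcarr by auto
    qed
    fix a b assume "a \<in> carrier R" "b \<in> carrier R" "a \<otimes>\<^bsub>R\<^esub> b \<in> ?P"
    then show "a \<in> ?P \<or> b \<in> ?P"
      using Q.I_prime[of "I +>\<^bsub>R\<^esub> a" "I +>\<^bsub>R\<^esub> b"] h.hom_mult h.hom_closed by auto
  qed
  show "I \<subseteq> ?P"
  proof
    fix a assume a: "a \<in> I"
    then have "I +>\<^bsub>R\<^esub> a = I" using I.a_rcos_const by auto
    moreover have "\<zero>\<^bsub>R Quot I\<^esub> = I" unfolding FactRing_def by simp
    then have "I \<in> Q" using additive_subgroup.zero_closed[OF Q.additive_subgroup_axioms] by simp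
    ultimately show "a \<in> ?P" using I.Icarr[OF a] by (metis (mono_tags, lifting) mem_Collect_eq)
  qed
qed

lemma quot_carrier_obtain:
  assumes "x \<in> carrier (R Quot I)"
  obtains r where "r \<in> carrier R" "x = I +>\<^bsub>R\<^esub> r"
  using assms unfolding FactRing_def A_RCOSETS_def' by auto

lemma rcos_in_image_iff:
  assumes "cring R" "ideal I R" "ideal P R" "I \<subseteq> P" "a \<in> carrier R"
  shows "I +>\<^bsub>R\<^esub> a \<in> (+>\<^bsub>R\<^esub>) I ` P \<longleftrightarrow> a \<in> P"
proof
  interpret R: cring R by fact
  interpret I: ideal I R by fact
  interpret P: ideal P R by fact
  assume "I +>\<^bsub>R\<^esub> a \<in> (+>\<^bsub>R\<^esub>) I ` P"
  then obtain p where p: "p \<in> P" "I +>\<^bsub>R\<^esub> a = I +>\<^bsub>R\<^esub> p" by auto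
  then have "a \<ominus>\<^bsub>R\<^esub> p \<in> P"
    using R.quotient_eq_iff_same_a_r_cos[OF assms(2,5), of p] P.Icarr assms(4) by auto
  then have "(a \<ominus>\<^bsub>R\<^esub> p) \<oplus>\<^bsub>R\<^esub> p \<in> P" using p by (intro P.a_closed)
  moreover have "(a \<ominus>\<^bsub>R\<^esub> p) \<oplus>\<^bsub>R\<^esub> p = a"
    using assms(5) P.Icarr[OF p(1)] by (simp add: R.minus_eq R.a_assoc R.l_neg)
  ultimately show "a \<in> P" by simp
qed auto

lemma primeideal_quot_image:
  assumes "cring R" "ideal I R" "primeideal P R" "I \<subseteq> P"
  shows "primeideal ((+>\<^bsub>R\<^esub>) I ` P) (R Quot I)"
proof (rule primeidealI)
  interpret R: cring R by fact
  interpret I: ideal I R by fact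
  interpret P: primeideal P R by fact
  interpret h: ring_hom_ring R "R Quot I" "(+>\<^bsub>R\<^esub>) I" by (rule I.rcos_ring_hom_ring)
  note iff = rcos_in_image_iff[OF assms(1,2) P.is_ideal assms(4)]
  show "ideal ((+>\<^bsub>R\<^esub>) I ` P) (R Quot I)"
    by (rule R.ring_ideal_imp_quot_ideal[OF assms(2) P.is_ideal])
  show "cring (R Quot I)" by (rule I.quotient_is_cring[OF assms(1)])
  have "\<one>\<^bsub>R\<^esub> \<notin> P" using P.one_imp_carrier P.I_notcarr by auto
  then show "carrier (R Quot I) \<noteq> (+>\<^bsub>R\<^esub>) I ` P"
    using iff[OF R.one_closed] h.hom_closed[OF R.one_closed] by auto
  fix x y assume x: "x \<in> carrier (R Quot I)" and y: "y \<in> carrier (R Quot I)"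
    and xy: "x \<otimes>\<^bsub>R Quot I\<^esub> y \<in> (+>\<^bsub>R\<^esub>) I ` P"
  from x y obtain a b where a: "a \<in> carrier R" "x = I +>\<^bsub>R\<^esub> a"
    and b: "b \<in> carrier R" "y = I +>\<^bsub>R\<^esub> b" by (metis quot_carrier_obtain)
  from xy have "I +>\<^bsub>R\<^esub> (a \<otimes>\<^bsub>R\<^esub> b) \<in> (+>\<^bsub>R\<^esub>) I ` P" using a b h.hom_mult by simp
  then have "a \<otimes>\<^bsub>R\<^esub> b \<in> P" using iff[OF R.m_closed[OF a(1) b(1)]] by simp
  then have "a \<in> P \<or> b \<in> P" using P.I_prime a b by blast
  then show "x \<in> (+>\<^bsub>R\<^esub>) I ` P \<or> y \<in> (+>\<^bsub>R\<^esub>) I ` P" using a b by auto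
qed

text \<open>
  Images and preimages under the canonical projection match the primes of the quotient with the primes
  above \<open>I\<close>, and they preserve strict inclusions.
\<close>

lemma krull_dim_quot_eqI:
  assumes R: "cring R" and I: "ideal I R"
    and lower: "\<forall>i\<le>N. primeideal (P i) R \<and> I \<subseteq> P i" "\<forall>i<N. P i \<subset> P (Suc i)"
    and upper: "\<And>n Q. \<forall>i\<le>n. primeideal (Q i) R \<and> I \<subseteq> Q i \<Longrightarrow> \<forall>i<n. Q i \<subset> Q (Suc i) \<Longrightarrow> n \<le> N"
  shows "krull_dim (R Quot I) = ereal (real N)"
proof (rule antisym)
  show "krull_dim (R Quot I) \<le> ereal (real N)"
    unfolding krull_dim_def
  proof (rule Sup_least)
    fix z assume "z \<in> {ereal (real n) | n.
      \<exists>P. (\<forall>i\<le>n. primeideal (P i) (R Quot I)) \<and> (\<forall>i<n. P i \<subset> P (Suc i))}"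
    then obtain n Q where n: "z = ereal (real n)" and Q: "\<forall>i\<le>n. primeideal (Q i) (R Quot I)"
      "\<forall>i<n. Q i \<subset> Q (Suc i)" by blast
    define Q' where "Q' i = {r \<in> carrier R. I +>\<^bsub>R\<^esub> r \<in> Q i}" for i
    have "Q' i \<subset> Q' (Suc i)" if "i < n" for i
    proof -
      from Q that obtain x where x: "x \<in> Q (Suc i)" "x \<notin> Q i" by blast
      interpret Qs: primeideal "Q (Suc i)" "R Quot I" using Q(1) that by simp
      from x Qs.Icarr obtain r where "r \<in> carrier R" "x = I +>\<^bsub>R\<^esub> r"
        by (metis quot_carrier_obtain)
      with x Q(2) that show ?thesis unfolding Q'_def by blast
    qed
    moreover have "\<forall>i\<le>n. primeideal (Q' i) R \<and> I \<subseteq> Q' i"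
      unfolding Q'_def using primeideal_quot_vimage[OF R I] Q(1) by blast
    ultimately have "n \<le> N" by (intro upper[of n Q']) auto
    then show "z \<le> ereal (real N)" by (simp add: n)
  qed
  have "(+>\<^bsub>R\<^esub>) I ` P i \<subset> (+>\<^bsub>R\<^esub>) I ` P (Suc i)" if "i < N" for i
  proof -
    from lower that obtain r where r: "r \<in> P (Suc i)" "r \<notin> P i" by blast
    interpret P: primeideal "P i" R using lower(1) that by simp
    interpret Ps: primeideal "P (Suc i)" R using lower(1) that by simp
    have "I +>\<^bsub>R\<^esub> r \<notin> (+>\<^bsub>R\<^esub>) I ` P i"
      using rcos_in_image_iff[OF R I P.is_ideal _ Ps.Icarr[OF r(1)]] lower(1) that r(2) by auto
    with r lower(2) that show ?thesis by blast
  qed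
  moreover have "primeideal ((+>\<^bsub>R\<^esub>) I ` P i) (R Quot I)" if "i \<le> N" for i
    using primeideal_quot_image[OF R I] lower(1) that by blast
  ultimately have "\<exists>P'. (\<forall>i\<le>N. primeideal (P' i) (R Quot I)) \<and> (\<forall>i<N. P' i \<subset> P' (Suc i))"
    by (intro exI[of _ "\<lambda>i. (+>\<^bsub>R\<^esub>) I ` P i"] conjI allI impI)
  then show "ereal (real N) \<le> krull_dim (R Quot I)"
    unfolding krull_dim_def by (intro Sup_upper CollectI exI[of _ N] conjI refl)
qed

section \<open>Evaluation of polynomials\<close>

definition const_poly :: "'a::comm_ring_1 \<Rightarrow> (('v \<Rightarrow>\<^sub>0 nat) \<Rightarrow>\<^sub>0 'a)" where
  "const_poly c = Poly_Mapping.single 0 c"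

definition monom_eval :: "('v \<Rightarrow> 'a::comm_ring_1) \<Rightarrow> ('v \<Rightarrow>\<^sub>0 nat) \<Rightarrow> 'a" where
  "monom_eval x m = (\<Prod>v\<in>Poly_Mapping.keys m. x v ^ Poly_Mapping.lookup m v)"

definition peval :: "('v \<Rightarrow> 'a::comm_ring_1) \<Rightarrow> (('v \<Rightarrow>\<^sub>0 nat) \<Rightarrow>\<^sub>0 'a) \<Rightarrow> 'a" where
  "peval x p = (\<Sum>m\<in>Poly_Mapping.keys p. Poly_Mapping.lookup p m * monom_eval x m)"

lemma monom_eval_superset:
  "finite K \<Longrightarrow> Poly_Mapping.keys m \<subseteq> K \<Longrightarrow> monom_eval x m = (\<Prod>v\<in>K. x v ^ Poly_Mapping.lookup m v)"
  unfolding monom_eval_def by (rule prod.mono_neutral_left) (auto simp: in_keys_iff)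

lemma monom_eval_add: "monom_eval x (m + n) = monom_eval x m * monom_eval x n"
proof -
  let ?K = "Poly_Mapping.keys m \<union> Poly_Mapping.keys n"
  have "Poly_Mapping.keys (m + n) \<subseteq> ?K" by (rule Poly_Mapping.keys_add)
  then show ?thesis
    by (simp add: monom_eval_superset[of ?K] lookup_add power_add prod.distrib)
qed

lemma peval_superset:
  "finite K \<Longrightarrow> Poly_Mapping.keys p \<subseteq> K \<Longrightarrow> peval x p = (\<Sum>m\<in>K. Poly_Mapping.lookup p m * monom_eval x m)"
  unfolding peval_def by (rule sum.mono_neutral_left) (auto simp: in_keys_iff)

lemma peval_add: "peval x (p + q) = peval x p + peval x q"
proof -
  let ?K = "Poly_Mapping.keys p \<union> Poly_Mapping.keys q"
  have "Poly_Mapping.keys (p + q) \<subseteq> ?K" by (rule Poly_Mapping.keys_add)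
  then show ?thesis
    by (simp add: peval_superset[of ?K] lookup_add distrib_right sum.distrib)
qed

lemma peval_0 [simp]: "peval x 0 = 0"
  by (simp add: peval_def)

lemma peval_sum: "peval x (sum f A) = (\<Sum>a\<in>A. peval x (f a))"
  by (induction A rule: infinite_finite_induct) (simp_all add: peval_add)

lemma peval_single: "peval x (Poly_Mapping.single m c) = c * monom_eval x m"
  by (simp add: peval_def)

lemma poly_mapping_eq_sum_single:
  "p = (\<Sum>m\<in>Poly_Mapping.keys p. Poly_Mapping.single m (Poly_Mapping.lookup p m))"
  by (rule poly_mapping_eqI)
     (simp add: lookup_sum lookup_single when_def in_keys_iff flip: sum.inter_filter)

lemma peval_mult: "peval x (p * q) = peval x p * peval x q"
proof -
  have "peval x (p * q) = peval x
      ((\<Sum>m\<in>Poly_Mapping.keys p. Poly_Mapping.single m (Poly_Mapping.lookup p m)) *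
       (\<Sum>n\<in>Poly_Mapping.keys q. Poly_Mapping.single n (Poly_Mapping.lookup q n)))"
    by (simp flip: poly_mapping_eq_sum_single)
  also have "\<dots> = peval x p * peval x q"
    unfolding sum_product peval_sum mult_single peval_single monom_eval_add
    by (simp add: peval_def sum_product mult_ac)
  finally show ?thesis .
qed

lemma peval_pconst [simp]: "peval x (const_poly c) = c"
  by (simp add: const_poly_def peval_single monom_eval_def)

lemma peval_mvar [simp]: "peval x (mvar v) = x v"
  by (simp add: mvar_def peval_single monom_eval_def)

lemma const_poly_1: "const_poly 1 = 1"
  by (simp add: const_poly_def)

lemma const_poly_add: "const_poly (c + d) = const_poly c + const_poly d"
  by (simp add: const_poly_def single_add)

lemma const_poly_mult: "const_poly (c * d) = const_poly c * const_poly d"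
  by (simp add: const_poly_def mult_single)

lemma const_poly_0: "const_poly 0 = 0"
  by (simp add: const_poly_def)

lemma peval_1 [simp]: "peval x 1 = 1"
  using peval_pconst[of x 1] by (simp add: const_poly_1)

lemma comm_ring_hom_peval: "comm_ring_hom (peval x)"
  by standard (simp_all add: peval_add peval_mult)

lemma peval_uminus: "peval x (- p) = - peval x p"
  using peval_add[of x "- p" p] by (simp add: eq_neg_iff_add_eq_0)

lemma peval_diff: "peval x (p - q) = peval x p - peval x q"
  using peval_add[of x p "- q"] by (simp add: peval_uminus)

lemma peval_det_mvar:
  "peval w (det (mat r r (\<lambda>(a, b). mvar (rs ! a, cs ! b)))) = det (mat r r (\<lambda>(a, b). w (rs ! a, cs ! b)))"
proof -
  interpret comm_ring_hom "peval w" by (rule comm_ring_hom_peval)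
  have "map_mat (peval w) (mat r r (\<lambda>(a, b). mvar (rs ! a, cs ! b)))
      = mat r r (\<lambda>(a, b). w (rs ! a, cs ! b))"
    by (rule eq_matI) auto
  then show ?thesis by (simp flip: hom_det)
qed

lemma single_sum_eq_prod:
  "Poly_Mapping.single (sum f A) (1::'a::comm_ring_1) = (\<Prod>a\<in>A. Poly_Mapping.single (f a) 1)"
proof (induction A rule: infinite_finite_induct)
  case (insert a A)
  have "Poly_Mapping.single (f a) (1::'a) * Poly_Mapping.single (sum f A) 1
      = Poly_Mapping.single (f a + sum f A) 1"
    by (simp add: mult_single)
  with insert show ?case by simp
qed simp_all

lemma mvar_power: "mvar v ^ n = Poly_Mapping.single (Poly_Mapping.single v n) 1"
  by (induction n) (simp_all add: mvar_def mult_single single_add[symmetric])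

lemma single_eq_monomial:
  fixes c :: "'a::comm_ring_1"
  shows "Poly_Mapping.single m c
    = const_poly c * (\<Prod>v\<in>Poly_Mapping.keys m. mvar v ^ Poly_Mapping.lookup m v)"
proof -
  have "(\<Prod>v\<in>Poly_Mapping.keys m. mvar v ^ Poly_Mapping.lookup m v) = Poly_Mapping.single m (1::'a)"
    unfolding mvar_power by (simp flip: single_sum_eq_prod poly_mapping_eq_sum_single)
  then show ?thesis by (simp add: const_poly_def mult_single)
qed

lemma mpoly_ring_generated:
  "ring_generated const_poly (mvar ` V) (carrier (mpoly_ring V :: (('v \<Rightarrow>\<^sub>0 nat) \<Rightarrow>\<^sub>0 'a::comm_ring_1) ring))"
  unfolding ring_generated_def
proof (intro allI impI)
  fix Y :: "(('v \<Rightarrow>\<^sub>0 nat) \<Rightarrow>\<^sub>0 'a) set"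
  assume gens: "mvar ` V \<union> range const_poly \<subseteq> Y" and closed: "\<forall>x\<in>Y. \<forall>y\<in>Y. x + y \<in> Y \<and> x * y \<in> Y"
  have 0: "0 \<in> Y" and 1: "1 \<in> Y"
    using gens const_poly_1 const_poly_0 by (metis UnCI rangeI subsetD)+
  have sum: "sum f A \<in> Y" if "\<And>a. a \<in> A \<Longrightarrow> f a \<in> Y" for f :: "('v \<Rightarrow>\<^sub>0 nat) \<Rightarrow> _" and A
    using that by (induction A rule: infinite_finite_induct) (use closed 0 in auto)
  have prod: "prod f A \<in> Y" if "\<And>a. a \<in> A \<Longrightarrow> f a \<in> Y" for f :: "'v \<Rightarrow> _" and A
    using that by (induction A rule: infinite_finite_induct) (use closed 1 in auto)
  have power: "x ^ n \<in> Y" if "x \<in> Y" for x n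
    by (induction n) (use closed 1 that in auto)
  show "carrier (mpoly_ring V) \<subseteq> Y"
  proof
    fix p :: "('v \<Rightarrow>\<^sub>0 nat) \<Rightarrow>\<^sub>0 'a" assume "p \<in> carrier (mpoly_ring V)"
    then have keys: "Poly_Mapping.keys m \<subseteq> V" if "m \<in> Poly_Mapping.keys p" for m
      using that by (simp add: mpoly_ring_def)
    have "Poly_Mapping.single m (Poly_Mapping.lookup p m) \<in> Y" if "m \<in> Poly_Mapping.keys p" for m
    proof -
      have "(\<Prod>v\<in>Poly_Mapping.keys m. mvar v ^ Poly_Mapping.lookup m v) \<in> Y"
      proof (intro prod power)
        fix v assume "v \<in> Poly_Mapping.keys m"
        with keys[OF that] gens show "mvar v \<in> Y" by auto
      qed
      moreover have "const_poly (Poly_Mapping.lookup p m) \<in> Y" using gens by auto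
      ultimately show ?thesis unfolding single_eq_monomial using closed by blast
    qed
    then show "p \<in> Y"
      by (subst poly_mapping_eq_sum_single) (rule sum)
  qed
qed

lemma const_poly_carrier: "const_poly c \<in> carrier (mpoly_ring V)"
  by (simp add: mpoly_ring_def const_poly_def)

lemma primeideal_imp_affine_prime:
  fixes P :: "(('v \<Rightarrow>\<^sub>0 nat) \<Rightarrow>\<^sub>0 'a::field) set"
  assumes "primeideal P (mpoly_ring V)"
  shows "affine_prime (carrier (mpoly_ring V)) P const_poly"
proof -
  interpret P: primeideal P "mpoly_ring V" by fact
  have ops: "\<zero>\<^bsub>mpoly_ring V\<^esub> = 0" "\<one>\<^bsub>mpoly_ring V\<^esub> = 1" "add (mpoly_ring V) = (+)" "monoid.mult (mpoly_ring V) = (*)"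
    by (simp_all add: mpoly_ring_def)
  show ?thesis
  proof
    show "1 \<notin> P" using P.one_imp_carrier P.I_notcarr by (auto simp: ops)
    show "0 \<in> P" using additive_subgroup.zero_closed[OF P.additive_subgroup_axioms] by (simp add: ops)
    show "x + y \<in> P" if "x \<in> P" "y \<in> P" for x y using additive_subgroup.a_closed[OF P.additive_subgroup_axioms that] by (simp add: ops)
    show "r * x \<in> P" if "r \<in> carrier (mpoly_ring V)" "x \<in> P" for r x
      using P.I_l_closed[OF that(2,1)] by (simp add: ops)
    show "x \<in> P \<or> y \<in> P" if "x \<in> carrier (mpoly_ring V)" "y \<in> carrier (mpoly_ring V)" "x * y \<in> P" for x y
      using P.I_prime[OF that(1,2)] that(3) by (simp add: ops)
    show "P \<subseteq> carrier (mpoly_ring V)" using P.Icarr by auto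
  qed (simp_all add: mpoly_carrier_add mpoly_carrier_mult const_poly_carrier const_poly_1 const_poly_add const_poly_mult)
qed

section \<open>Vanishing ideals\<close>

definition vanishing :: "'v set \<Rightarrow> ('v \<Rightarrow> 'a::comm_ring_1) set \<Rightarrow> (('v \<Rightarrow>\<^sub>0 nat) \<Rightarrow>\<^sub>0 'a) set" where
  "vanishing V W = {p \<in> carrier (mpoly_ring V). \<forall>w\<in>W. peval w p = 0}"

lemma mpoly_ring_ops:
  "\<zero>\<^bsub>mpoly_ring V\<^esub> = 0" "\<one>\<^bsub>mpoly_ring V\<^esub> = 1"
  "add (mpoly_ring V) = (+)" "monoid.mult (mpoly_ring V) = (*)"
  by (simp_all add: mpoly_ring_def)

lemma ideal_vanishing: "ideal (vanishing V W) (mpoly_ring V)"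
proof (rule idealI)
  interpret R: cring "mpoly_ring V :: (('a \<Rightarrow>\<^sub>0 nat) \<Rightarrow>\<^sub>0 'b) ring" by (rule cring_mpoly_ring)
  show "ring (mpoly_ring V :: (('a \<Rightarrow>\<^sub>0 nat) \<Rightarrow>\<^sub>0 'b) ring)" by (rule R.ring_axioms)
  show "subgroup (vanishing V W) (add_monoid (mpoly_ring V))"
  proof (rule group.subgroupI[OF R.a_group])
    show "vanishing V W \<subseteq> carrier (add_monoid (mpoly_ring V))" by (auto simp: vanishing_def)
    show "vanishing V W \<noteq> {}"
      using mpoly_carrier_zero[of V] by (auto simp: vanishing_def intro!: exI[of _ 0])
    fix a assume a: "a \<in> vanishing V W"
    then have car: "a \<in> carrier (mpoly_ring V)" by (simp add: vanishing_def)
    have "\<ominus>\<^bsub>mpoly_ring V\<^esub> a = - a"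
      by (rule R.minus_equality) (use car mpoly_carrier_uminus in \<open>auto simp: mpoly_ring_ops\<close>)
    then show "inv\<^bsub>add_monoid (mpoly_ring V)\<^esub> a \<in> vanishing V W"
      unfolding a_inv_def[symmetric] using a car
      by (simp add: vanishing_def mpoly_carrier_uminus peval_uminus)
    fix b assume "b \<in> vanishing V W"
    with a show "a \<otimes>\<^bsub>add_monoid (mpoly_ring V)\<^esub> b \<in> vanishing V W"
      by (simp add: vanishing_def mpoly_ring_ops mpoly_carrier_add peval_add)
  qed
qed (auto simp: vanishing_def mpoly_ring_ops mpoly_carrier_mult peval_mult)

text \<open>
  A convenient substitute for irreducibility: images of affine spaces under polynomial maps are
  \<open>curve_connected\<close> since lines are mapped to polynomial curves.
\<close>

definition curve_connected :: "('v \<Rightarrow> 'a::comm_ring_1) set \<Rightarrow> bool" where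
  "curve_connected W \<longleftrightarrow> (\<forall>w\<in>W. \<forall>w'\<in>W. \<exists>Z. (\<lambda>v. poly (Z v) 0) = w \<and> (\<lambda>v. poly (Z v) 1) = w' \<and>
     (\<forall>s. (\<lambda>v. poly (Z v) s) \<in> W))"

lemma peval_along_curve:
  fixes p :: "('v \<Rightarrow>\<^sub>0 nat) \<Rightarrow>\<^sub>0 'a::comm_ring_1"
  assumes "p \<in> carrier (mpoly_ring V)"
  shows "\<exists>F. \<forall>s. poly F s = peval (\<lambda>v. poly (Z v) s) p"
proof -
  let ?Y = "{p. \<exists>F. \<forall>s. poly F s = peval (\<lambda>v. poly (Z v) s) p}"
  have "carrier (mpoly_ring V) \<subseteq> ?Y"
  proof (rule ring_generatedD[OF mpoly_ring_generated])
    show "mvar ` V \<subseteq> ?Y" by auto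
    have "poly [:c:] s = peval (\<lambda>v. poly (Z v) s) (const_poly c)" for c s by simp
    then show "range const_poly \<subseteq> ?Y" by blast
    fix p q assume "p \<in> ?Y" "q \<in> ?Y"
    then obtain F G where "\<And>s. poly F s = peval (\<lambda>v. poly (Z v) s) p"
      "\<And>s. poly G s = peval (\<lambda>v. poly (Z v) s) q" by auto
    then have "\<forall>s. poly (F + G) s = peval (\<lambda>v. poly (Z v) s) (p + q)"
      "\<forall>s. poly (F * G) s = peval (\<lambda>v. poly (Z v) s) (p * q)"
      by (simp_all add: peval_add peval_mult)
    then show "p + q \<in> ?Y \<and> p * q \<in> ?Y" by blast
  qed
  with assms show ?thesis by auto
qed

text \<open>
  Along a curve from a point where \<open>p\<close> does not vanish to a point where \<open>q\<close> does not vanish, both become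
  nonzero polynomials in one variable, so their product is not zero on the curve.
\<close>

lemma primeideal_vanishing:
  fixes W :: "('v \<Rightarrow> 'a::field_char_0) set"
  assumes "W \<noteq> {}" "curve_connected W"
  shows "primeideal (vanishing V W) (mpoly_ring V)"
proof (rule primeidealI)
  show "ideal (vanishing V W) (mpoly_ring V)" by (rule ideal_vanishing)
  show "cring (mpoly_ring V :: (('v \<Rightarrow>\<^sub>0 nat) \<Rightarrow>\<^sub>0 'a) ring)" by (rule cring_mpoly_ring)
  have "1 \<notin> vanishing V W" using assms(1) by (auto simp: vanishing_def)
  then show "carrier (mpoly_ring V) \<noteq> vanishing V W" using mpoly_carrier_one by blast
  fix p q assume p: "p \<in> carrier (mpoly_ring V)" and q: "q \<in> carrier (mpoly_ring V)"
    and pq: "p \<otimes>\<^bsub>mpoly_ring V\<^esub> q \<in> vanishing V W"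
  show "p \<in> vanishing V W \<or> q \<in> vanishing V W"
  proof (rule ccontr)
    assume "\<not> ?thesis"
    with p q obtain w w' where w: "w \<in> W" "peval w p \<noteq> 0" "w' \<in> W" "peval w' q \<noteq> 0"
      by (auto simp: vanishing_def)
    with assms(2) obtain Z where Z: "(\<lambda>v. poly (Z v) 0) = w" "(\<lambda>v. poly (Z v) 1) = w'"
      "\<And>s. (\<lambda>v. poly (Z v) s) \<in> W" unfolding curve_connected_def by metis
    obtain F G where F: "\<And>s. poly F s = peval (\<lambda>v. poly (Z v) s) p"
      and G: "\<And>s. poly G s = peval (\<lambda>v. poly (Z v) s) q"
      using peval_along_curve[OF p, of Z] peval_along_curve[OF q, of Z] by auto
    have "poly (F * G) s = 0" for s
      using pq Z(3)[of s] by (simp add: F G vanishing_def mpoly_ring_ops peval_mult)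
    then have "F * G = 0" using poly_all_0_iff_0 by blast
    then have "F = 0 \<or> G = 0" by simp
    with F[of 0] G[of 1] Z w show False by auto
  qed
qed

text \<open>
  Fixing the parameters one at a time at the values \<open>c\<close>, by increasing stage, shrinks the image of \<open>x\<close>.
  By \<open>coord\<close> the parameter that is fixed next is still a coordinate of the image, so the polynomial \<open>v - c\<close>
  for this coordinate \<open>v\<close> witnesses that the vanishing ideal grows.
\<close>

lemma specialization_chain:
  fixes x :: "('q \<Rightarrow> 'a::field_char_0) \<Rightarrow> 'v \<Rightarrow> 'a" and stage :: "'q \<Rightarrow> nat"
  assumes Q: "finite Q"
    and lines: "\<And>y y'. \<exists>Z. \<forall>s v. poly (Z v) s = x (\<lambda>q. y q + s * (y' q - y q)) v"
    and coord: "\<And>q. q \<in> Q \<Longrightarrow> \<exists>v\<in>V. \<forall>y. (\<forall>q'\<in>Q. stage q' < stage q \<longrightarrow> y q' = c q') \<longrightarrow> x y v = y q"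
  shows "\<exists>P. (\<forall>i\<le>card Q. primeideal (P i) (mpoly_ring V) \<and> vanishing V (range x) \<subseteq> P i) \<and>
    (\<forall>i<card Q. P i \<subset> P (Suc i))"
proof -
  obtain qs0 where "set qs0 = Q" "distinct qs0" using finite_distinct_list[OF Q] by auto
  define qs where "qs = sort_key stage qs0"
  have qs: "set qs = Q" "distinct qs" "length qs = card Q"
    using \<open>set qs0 = Q\<close> \<open>distinct qs0\<close> by (auto simp: qs_def distinct_card)
  have sorted: "sorted (map stage qs)" by (simp add: qs_def)
  define Y where "Y i = {y. \<forall>k<i. y (qs ! k) = c (qs ! k)}" for i
  define P where "P i = vanishing V (x ` Y i)" for i
  have conn: "curve_connected (x ` Y i)" for i
    unfolding curve_connected_def
  proof (intro ballI)
    fix w w' assume "w \<in> x ` Y i" "w' \<in> x ` Y i"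
    then obtain y y' where y: "y \<in> Y i" "w = x y" "y' \<in> Y i" "w' = x y'" by auto
    obtain Z where Z: "\<And>s v. poly (Z v) s = x (\<lambda>q. y q + s * (y' q - y q)) v"
      using lines[of y y'] by auto
    have "(\<lambda>q. y q + s * (y' q - y q)) \<in> Y i" for s using y by (auto simp: Y_def)
    then show "\<exists>Z. (\<lambda>v. poly (Z v) 0) = w \<and> (\<lambda>v. poly (Z v) 1) = w' \<and>
        (\<forall>s. (\<lambda>v. poly (Z v) s) \<in> x ` Y i)"
      using y by (intro exI[of _ Z]) (auto simp: Z)
  qed
  have "c \<in> Y i" for i by (auto simp: Y_def)
  then have "primeideal (P i) (mpoly_ring V)" for i
    unfolding P_def using conn by (intro primeideal_vanishing) auto
  moreover have "vanishing V (range x) \<subseteq> P i" for i by (auto simp: P_def vanishing_def)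
  moreover have "P i \<subset> P (Suc i)" if i: "i < card Q" for i
  proof -
    let ?q = "qs ! i"
    have "?q \<in> Q" using qs i by (metis nth_mem)
    from coord[OF this] obtain v where v: "v \<in> V"
      "\<And>y. (\<forall>q'\<in>Q. stage q' < stage ?q \<longrightarrow> y q' = c q') \<Longrightarrow> x y v = y ?q" by blast
    have xv: "x y v = y ?q" if "y \<in> Y i" for y
    proof (rule v(2), intro ballI impI)
      fix q' assume "q' \<in> Q" and less: "stage q' < stage ?q"
      then obtain k where k: "k < length qs" "q' = qs ! k" using qs by (metis in_set_conv_nth)
      have "k < i"
      proof (rule ccontr)
        assume "\<not> k < i"
        then have "stage ?q \<le> stage q'"
          using sorted_nth_mono[OF sorted, of i k] k qs i by simp
        with less show False by simp
      qed
      with that k show "y q' = c q'" by (auto simp: Y_def)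
    qed
    let ?f = "mvar v - const_poly (c ?q)"
    have car: "?f \<in> carrier (mpoly_ring V)"
      using mpoly_carrier_add[OF mpoly_carrier_mvar[OF v(1)] mpoly_carrier_uminus[OF const_poly_carrier]]
      by simp
    have "?f \<in> P (Suc i)"
    proof -
      have "peval (x y) ?f = 0" if "y \<in> Y (Suc i)" for y
        using xv[of y] that by (auto simp: Y_def peval_diff)
      with car show ?thesis by (auto simp: P_def vanishing_def)
    qed
    moreover have "?f \<notin> P i"
    proof
      assume *: "?f \<in> P i"
      let ?y = "c(?q := c ?q + 1)"
      have "?y \<in> Y i" using qs i by (auto simp: Y_def nth_eq_iff_index_eq)
      with * have "peval (x ?y) ?f = 0" by (auto simp: P_def vanishing_def)
      then show False using xv[OF \<open>?y \<in> Y i\<close>] by (simp add: peval_diff)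
    qed
    moreover have "P i \<subseteq> P (Suc i)" by (auto simp: P_def vanishing_def Y_def)
    ultimately show ?thesis by blast
  qed
  ultimately show ?thesis by blast
qed

section \<open>Subdeterminants\<close>

text \<open>
  Rows and columns are lists in any order, possibly with repetitions, because minors are enlarged below by
  appending a row and a column.
\<close>

definition subdet :: "('r \<Rightarrow> 'c \<Rightarrow> 'a::comm_ring_1) \<Rightarrow> 'r list \<Rightarrow> 'c list \<Rightarrow> 'a" where
  "subdet f rs cs = det (mat (length rs) (length rs) (\<lambda>(a, b). f (rs ! a) (cs ! b)))"

lemma subdet_transpose:
  assumes "length rs = length cs"
  shows "subdet f rs cs = subdet (\<lambda>c r. f r c) cs rs"
proof -
  let ?A = "mat (length rs) (length rs) (\<lambda>(a, b). f (rs ! a) (cs ! b))"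
  have "transpose_mat ?A = mat (length cs) (length cs) (\<lambda>(a, b). f (rs ! b) (cs ! a))"
    using assms by (intro eq_matI) auto
  with det_transpose[of ?A "length rs"] show ?thesis by (simp add: subdet_def)
qed

lemma subdet_not_distinct_rows:
  assumes "\<not> distinct rs"
  shows "subdet f rs cs = 0"
proof -
  from assms obtain i j where "i < length rs" "j < length rs" "i \<noteq> j" "rs ! i = rs ! j"
    by (auto simp: distinct_conv_nth)
  then show ?thesis unfolding subdet_def
    by (intro det_identical_rows[of _ "length rs" i j]) (auto intro: eq_vecI)
qed

lemma subdet_not_distinct_cols:
  assumes "\<not> distinct cs" "length rs = length cs"
  shows "subdet f rs cs = 0"
  unfolding subdet_transpose[OF assms(2)] by (rule subdet_not_distinct_rows[OF assms(1)])

lemma subdet_mset_rows: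
  assumes "mset rs = mset rs'"
  shows "subdet f rs cs = subdet f rs' cs \<or> subdet f rs cs = - subdet f rs' cs"
proof -
  obtain p where p: "p permutes {..<length rs'}" "permute_list p rs' = rs"
    using mset_eq_permutation[OF assms] by blast
  let ?n = "length rs'"
  let ?A = "mat ?n ?n (\<lambda>(a, b). f (rs' ! a) (cs ! b))"
  have p': "p permutes {0..<?n}" using p(1) by (simp add: atLeast0LessThan)
  have "subdet f rs cs = det (mat ?n ?n (\<lambda>(i, j). ?A $$ (p i, j)))"
    unfolding subdet_def p(2)[symmetric] length_permute_list
  proof (intro arg_cong[of _ _ det] eq_matI, goal_cases)
    case (1 i j)
    moreover from this have "p i < ?n" using permutes_in_image[OF p(1), of i] by simp
    ultimately show ?case by (simp add: permute_list_nth[OF p(1)])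
  qed auto
  also have "\<dots> = signof p * det ?A" by (rule det_permute_rows[OF _ p']) simp
  finally have "subdet f rs cs = signof p * subdet f rs' cs" by (simp add: subdet_def)
  then show ?thesis by (auto simp: sign_def)
qed

lemma subdet_mset:
  assumes "mset rs = mset rs'" "mset cs = mset cs'" "length rs = length cs"
  shows "subdet f rs cs = subdet f rs' cs' \<or> subdet f rs cs = - subdet f rs' cs'"
proof -
  have len: "length rs' = length cs" "length cs = length cs'" using assms mset_eq_length by metis+
  have "subdet f rs' cs = subdet f rs' cs' \<or> subdet f rs' cs = - subdet f rs' cs'"
    using subdet_mset_rows[OF assms(2), of "\<lambda>c r. f r c" rs'] len
    by (simp only: subdet_transpose[of rs' cs f] subdet_transpose[of rs' cs' f])
  with subdet_mset_rows[OF assms(1), of f cs] show ?thesis by auto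
qed

text \<open>
  The matrix is a product through a space of dimension \<open>card K\<close>; padded to square factors, the left one has
  a zero column.
\<close>

lemma subdet_low_rank:
  fixes f :: "'r \<Rightarrow> 'c \<Rightarrow> 'a::comm_ring_1" and K :: "'k set"
  assumes "\<And>i c. i \<in> set rs \<Longrightarrow> c \<in> set cs \<Longrightarrow> f i c = (\<Sum>k\<in>K. g k i * h k c)"
    and "finite K" "card K < length rs" "length rs = length cs"
  shows "subdet f rs cs = 0"
proof -
  define n where "n = length rs"
  define m where "m = card K"
  have mn: "m < n" using assms by (simp add: n_def m_def)
  obtain \<phi> where \<phi>: "bij_betw \<phi> {..<m} K"
    using ex_bij_betw_nat_finite[OF assms(2)] by (auto simp: m_def atLeast0LessThan)
  define A where "A = mat n n (\<lambda>(a, k). if k < m then g (\<phi> k) (rs ! a) else 0)"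
  define B where "B = mat n n (\<lambda>(k, b). if k < m then h (\<phi> k) (cs ! b) else 0)"
  have AB: "A \<in> carrier_mat n n" "B \<in> carrier_mat n n" by (simp_all add: A_def B_def)
  have "mat n n (\<lambda>(a, b). f (rs ! a) (cs ! b)) = A * B"
  proof (intro eq_matI)
    fix a b assume "a < dim_row (A * B)" "b < dim_col (A * B)"
    then have ab: "a < n" "b < n" using AB by auto
    have "(A * B) $$ (a, b) = (\<Sum>k = 0..<n. A $$ (a, k) * B $$ (k, b))"
      using ab AB by (simp add: scalar_prod_def)
    also have "\<dots> = (\<Sum>k = 0..<n. if k < m then g (\<phi> k) (rs ! a) * h (\<phi> k) (cs ! b) else 0)"
      using ab by (intro sum.cong) (auto simp: A_def B_def)
    also have "\<dots> = (\<Sum>k<m. g (\<phi> k) (rs ! a) * h (\<phi> k) (cs ! b))"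
      using mn by (intro sum.mono_neutral_cong_right) auto
    also have "\<dots> = (\<Sum>k\<in>K. g k (rs ! a) * h k (cs ! b))"
      by (rule sum.reindex_bij_betw[OF \<phi>])
    also have "\<dots> = f (rs ! a) (cs ! b)"
      using ab assms(4) by (intro assms(1)[symmetric]) (auto simp: n_def)
    finally show "mat n n (\<lambda>(a, b). f (rs ! a) (cs ! b)) $$ (a, b) = (A * B) $$ (a, b)"
      using ab by simp
  qed (use AB in auto)
  then have "subdet f rs cs = det A * det B"
    using det_mult[OF AB] by (simp add: subdet_def n_def)
  moreover have "det A = 0"
    using mn by (subst laplace_expansion_column[OF AB(1), of "n - 1"]) (auto simp: A_def intro!: sum.neutral)
  ultimately show ?thesis by simp
qed

section \<open>Determinants in ideals\<close>

locale ideal_of =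
  fixes R J :: "'a::comm_ring_1 set"
  assumes R_add: "x \<in> R \<Longrightarrow> y \<in> R \<Longrightarrow> x + y \<in> R"
    and R_mult: "x \<in> R \<Longrightarrow> y \<in> R \<Longrightarrow> x * y \<in> R"
    and R_uminus: "x \<in> R \<Longrightarrow> - x \<in> R"
    and R_one: "1 \<in> R"
    and J_zero: "0 \<in> J"
    and J_add: "x \<in> J \<Longrightarrow> y \<in> J \<Longrightarrow> x + y \<in> J"
    and J_absorb: "r \<in> R \<Longrightarrow> x \<in> J \<Longrightarrow> r * x \<in> J"
begin

lemma J_uminus: "x \<in> J \<Longrightarrow> - x \<in> J"
  using J_absorb[OF R_uminus[OF R_one], of x] by simp

lemma J_sum: "(\<And>a. a \<in> A \<Longrightarrow> f a \<in> J) \<Longrightarrow> sum f A \<in> J"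
  by (induction A rule: infinite_finite_induct) (auto intro: J_add J_zero)

lemma R_zero: "0 \<in> R"
  using R_add[OF R_one R_uminus[OF R_one]] by simp

lemma R_sum: "(\<And>a. a \<in> A \<Longrightarrow> f a \<in> R) \<Longrightarrow> sum f A \<in> R"
  by (induction A rule: infinite_finite_induct) (auto intro: R_add R_zero)

lemma R_prod: "(\<And>a. a \<in> A \<Longrightarrow> f a \<in> R) \<Longrightarrow> prod f A \<in> R"
  by (induction A rule: infinite_finite_induct) (auto intro: R_mult R_one)

lemma R_neg_one_power: "(- 1) ^ n \<in> R"
  by (induction n) (auto intro: R_mult R_one R_uminus)

lemma R_det:
  assumes "A \<in> carrier_mat n n" "\<And>i j. i < n \<Longrightarrow> j < n \<Longrightarrow> A $$ (i, j) \<in> R"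
  shows "det A \<in> R"
  unfolding det_def'[OF assms(1)]
proof (intro R_sum R_mult R_prod)
  fix p i assume "p \<in> {p. p permutes {0..<n}}" "i \<in> {0..<n}"
  then show "A $$ (i, p i) \<in> R" using permutes_in_image[of p "{0..<n}" i] assms(2) by auto
qed (auto simp: sign_def intro: R_one R_uminus)

lemma det_zero_column:
  assumes A: "A \<in> carrier_mat n n" "\<And>i j. i < n \<Longrightarrow> j < n \<Longrightarrow> A $$ (i, j) \<in> R"
    and q: "q < n" "\<And>i. i < n \<Longrightarrow> A $$ (i, q) \<in> J"
  shows "det A \<in> J"
proof (subst laplace_expansion_column[OF A(1) q(1)], rule J_sum)
  fix i assume i: "i \<in> {..<n}"
  have "det (mat_delete A i q) \<in> R"
    using A(1) i q(1)
    by (intro R_det[OF mat_delete_carrier[OF A(1)]]) (auto simp: mat_delete_def intro!: A(2))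
  then have "cofactor A i q \<in> R" by (auto simp: cofactor_def intro: R_mult R_neg_one_power)
  then show "A $$ (i, q) * cofactor A i q \<in> J"
    using J_absorb q(2) i by (auto simp: mult.commute)
qed

text \<open>
  Expanding along any third column leaves smaller determinants that still contain both dependent columns,
  down to the \<open>2 \<times> 2\<close> case.
\<close>

lemma det_dependent_columns:
  assumes "A \<in> carrier_mat n n" "\<And>i j. i < n \<Longrightarrow> j < n \<Longrightarrow> A $$ (i, j) \<in> R"
    and "p < q" "q < n"
    and "\<And>i i'. i < n \<Longrightarrow> i' < n \<Longrightarrow> A $$ (i, p) * A $$ (i', q) - A $$ (i', p) * A $$ (i, q) \<in> J"
  shows "det A \<in> J"
  using assms
proof (induction n arbitrary: A p q)
  case (Suc n)
  show ?case
  proof (cases "n = 1")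
    case True
    with Suc.prems have pq: "p = 0" "q = 1" by auto
    have "det A = A $$ (0, 0) * A $$ (1, 1) - A $$ (1, 0) * A $$ (0, 1)"
      using Suc.prems(1) True
      by (subst laplace_expansion_column[OF Suc.prems(1), of 0])
         (simp_all add: numeral_2_eq_2 cofactor_def det_single mat_delete_def)
    with Suc.prems(5)[of 0 1] True pq show ?thesis by simp
  next
    case False
    with Suc.prems have "2 \<le> n" by auto
    then have "card {p, q} < card {..<Suc n}" using Suc.prems by simp
    then obtain k where k: "k < Suc n" "k \<noteq> p" "k \<noteq> q"
      by (metis card_mono finite.emptyI finite.insertI insertCI lessThan_iff linorder_not_le subsetI)
    define p' q' where "p' = (if p < k then p else p - 1)" and "q' = (if q < k then q else q - 1)"
    show ?thesis
    proof (subst laplace_expansion_column[OF Suc.prems(1) k(1)], rule J_sum)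
      fix i assume i: "i \<in> {..<Suc n}"
      let ?B = "mat_delete A i k"
      let ?s = "\<lambda>a. if a < i then a else Suc a"
      have idx: "?B $$ (a, b) = A $$ (?s a, if b < k then b else Suc b)" if "a < n" "b < n" for a b
        using that Suc.prems(1) by (auto simp: mat_delete_def)
      have p'q': "p' < q'" "q' < n" "(if p' < k then p' else Suc p') = p" "(if q' < k then q' else Suc q') = q"
        using k Suc.prems(3,4) by (auto simp: p'_def q'_def)
      have "det ?B \<in> J"
      proof (rule Suc.IH[OF _ _ p'q'(1,2)])
        show "?B \<in> carrier_mat n n" using mat_delete_carrier[OF Suc.prems(1)] by simp
        show "?B $$ (a, b) \<in> R" if "a < n" "b < n" for a b
          unfolding idx[OF that] using that by (intro Suc.prems(2)) auto
        show "?B $$ (a, p') * ?B $$ (a', q') - ?B $$ (a', p') * ?B $$ (a, q') \<in> J"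
          if "a < n" "a' < n" for a a'
        proof -
          have "p' < n" using p'q' by simp
          show ?thesis
            unfolding idx[OF that(1) \<open>p' < n\<close>] idx[OF that(2) \<open>p' < n\<close>]
              idx[OF that(1) p'q'(2)] idx[OF that(2) p'q'(2)] p'q'(3,4)
            using that by (intro Suc.prems(5)) auto
        qed
      qed
      then have "cofactor A i k \<in> J" by (auto simp: cofactor_def intro: J_absorb R_neg_one_power)
      then show "A $$ (i, k) * cofactor A i k \<in> J"
        using i k(1) by (intro J_absorb Suc.prems(2)) auto
    qed
  qed
qed simp

end

context affine_prime
begin

lemma rational_closure_det:
  assumes "set zs \<subseteq> R" "A \<in> carrier_mat n n" "\<And>i j. i < n \<Longrightarrow> j < n \<Longrightarrow> A $$ (i, j) \<in> rational_closure zs"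
  shows "det A \<in> rational_closure zs"
  unfolding det_def'[OF assms(2)]
proof (intro rational_closure_sum rational_closure_mult rational_closure_prod assms(1))
  fix p i assume "p \<in> {p. p permutes {0..<n}}" "i \<in> {0..<n}"
  then show "A $$ (i, p i) \<in> rational_closure zs" using permutes_in_image[of p "{0..<n}" i] assms(3) by auto
next
  fix p :: "nat \<Rightarrow> nat"
  show "signof p \<in> rational_closure zs"
    using rational_closure_const[OF assms(1), of 1] rational_closure_uminus[OF assms(1)] by (auto simp: sign_def kappa_1)
qed

lemma subdet_rational_closure:
  assumes "set zs \<subseteq> R" "length rs = length cs"
    "\<And>i c. i \<in> set rs \<Longrightarrow> c \<in> set cs \<Longrightarrow> f i c \<in> rational_closure zs"
  shows "subdet f rs cs \<in> rational_closure zs"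
  unfolding subdet_def using assms by (intro rational_closure_det) auto

text \<open>
  Cramer's rule: expanded along its last row, the bordered minor is a linear equation for \<open>f i c\<close> whose
  leading coefficient is the minor \<open>subdet f rs cs\<close>.
\<close>

lemma rational_closure_bordered:
  assumes zs: "set zs \<subseteq> R" and f: "f i c \<in> R"
    and len: "length rs = length cs"
    and core: "subdet f rs cs \<notin> P" and bordered: "subdet f (rs @ [i]) (cs @ [c]) \<in> P"
    and rows: "\<And>i' c'. i' \<in> set rs \<Longrightarrow> c' \<in> insert c (set cs) \<Longrightarrow> f i' c' \<in> rational_closure zs"
    and last: "\<And>c'. c' \<in> set cs \<Longrightarrow> f i c' \<in> rational_closure zs"
  shows "f i c \<in> rational_closure zs"
proof -
  define n where "n = length rs"
  define A where "A = mat (Suc n) (Suc n) (\<lambda>(a, b). f ((rs @ [i]) ! a) ((cs @ [c]) ! b))"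
  have A: "A \<in> carrier_mat (Suc n) (Suc n)" by (simp add: A_def)
  have cof: "cofactor A n j \<in> rational_closure zs" if "j \<le> n" for j
  proof -
    have "det (mat_delete A n j) \<in> rational_closure zs"
    proof (rule rational_closure_det[OF zs])
      show "mat_delete A n j \<in> carrier_mat n n" using mat_delete_carrier[OF A] by simp
      fix a b assume "a < n" "b < n"
      then show "mat_delete A n j $$ (a, b) \<in> rational_closure zs"
        using len that by (auto simp: mat_delete_def A_def nth_append n_def intro!: rows)
    qed
    moreover have "(- 1) ^ (n + j) \<in> rational_closure zs"
      using rational_closure_const[OF zs, of "(- 1) ^ (n + j)"]
      by (induction "n + j") (auto simp: kappa_1 kappa_mult kappa_uminus minus_one_power_iff)
    ultimately show ?thesis unfolding cofactor_def by (intro rational_closure_mult zs)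
  qed
  have "mat_delete A n n = mat n n (\<lambda>(a, b). f (rs ! a) (cs ! b))"
    using len by (intro eq_matI) (auto simp: mat_delete_def A_def nth_append n_def)
  then have cofn: "cofactor A n n = subdet f rs cs"
    by (simp add: cofactor_def subdet_def n_def flip: mult_2)
  define q where "q = (\<Sum>j<n. A $$ (n, j) * cofactor A n j)"
  have q: "q \<in> rational_closure zs" unfolding q_def
  proof (intro rational_closure_sum rational_closure_mult zs cof)
    fix j assume "j \<in> {..<n}"
    then show "A $$ (n, j) \<in> rational_closure zs"
      using len by (auto simp: A_def nth_append n_def intro!: last)
  qed auto
  have "subdet f (rs @ [i]) (cs @ [c]) = det A" by (simp add: subdet_def A_def n_def)
  also have "\<dots> = (\<Sum>j<Suc n. A $$ (n, j) * cofactor A n j)"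
    by (rule laplace_expansion_row[OF A]) simp
  also have "\<dots> = q + f i c * subdet f rs cs"
    using len by (simp add: q_def cofn) (simp add: A_def nth_append n_def)
  finally have X: "q + f i c * subdet f rs cs \<in> P" using bordered by simp
  have \<delta>: "subdet f rs cs \<in> rational_closure zs" using subdet_rational_closure[OF zs len] rows by blast
  then have \<delta>R: "subdet f rs cs \<in> R" using rational_closure_R by blast
  have "- q \<in> rational_closure zs" by (rule rational_closure_uminus[OF zs q])
  moreover have "- q - f i c * subdet f rs cs \<in> P" using P_uminus[OF X] by simp
  ultimately have "f i c * subdet f rs cs \<in> rational_closure zs"
    using rational_closure_cong[of "- q" zs "f i c * subdet f rs cs"] zs R_mult[OF f \<delta>R] by blast
  then show ?thesis
    using rational_closure_divide[OF zs \<delta> core f] by (simp add: mult.commute)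
qed

text \<open>
  A minor outside \<open>P\<close> is enlarged as long as possible; \<open>m\<close>-minors lie in \<open>P\<close>, so this stops below size \<open>m\<close>
  with all bordered minors in \<open>P\<close>.
\<close>

lemma maximal_minor:
  assumes len: "length rs0 = length cs0" "length rs0 < m" and core: "subdet f rs0 cs0 \<notin> P"
    and vanish: "\<And>rs cs. length rs = m \<Longrightarrow> length cs = m \<Longrightarrow> set rs \<subseteq> set rs0 \<union> \<Omega> \<Longrightarrow>
      set cs \<subseteq> set cs0 \<union> U \<Longrightarrow> subdet f rs cs \<in> P"
  obtains rs1 cs1 where "length rs1 = length cs1" "length rs0 + length rs1 < m"
    "set rs1 \<subseteq> \<Omega>" "set cs1 \<subseteq> U" "subdet f (rs0 @ rs1) (cs0 @ cs1) \<notin> P"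
    "\<And>i c. i \<in> \<Omega> \<Longrightarrow> c \<in> U \<Longrightarrow> subdet f ((rs0 @ rs1) @ [i]) ((cs0 @ cs1) @ [c]) \<in> P"
proof -
  define ok where "ok s \<longleftrightarrow> (\<exists>rs1 cs1. length rs1 = s \<and> length cs1 = s \<and> length rs0 + s < m \<and>
    set rs1 \<subseteq> \<Omega> \<and> set cs1 \<subseteq> U \<and> subdet f (rs0 @ rs1) (cs0 @ cs1) \<notin> P)" for s
  have "ok 0" using len core by (simp add: ok_def)
  moreover have "s \<le> m" if "ok s" for s using that by (auto simp: ok_def)
  ultimately obtain s where s: "ok s" "\<And>s'. ok s' \<Longrightarrow> s' \<le> s"
    using GreatestI_nat[of ok 0 m] Greatest_le_nat[of ok _ m] by blast
  from s(1) obtain rs1 cs1 where 1: "length rs1 = s" "length cs1 = s" "length rs0 + s < m"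
    "set rs1 \<subseteq> \<Omega>" "set cs1 \<subseteq> U" "subdet f (rs0 @ rs1) (cs0 @ cs1) \<notin> P"
    unfolding ok_def by blast
  have "subdet f ((rs0 @ rs1) @ [i]) ((cs0 @ cs1) @ [c]) \<in> P" if ic: "i \<in> \<Omega>" "c \<in> U" for i c
  proof (cases "length rs0 + Suc s = m")
    case True
    then show ?thesis using 1 ic len by (intro vanish) auto
  next
    case False
    show ?thesis
    proof (rule ccontr)
      assume "subdet f ((rs0 @ rs1) @ [i]) ((cs0 @ cs1) @ [c]) \<notin> P"
      then have "ok (Suc s)"
        unfolding ok_def using 1 ic False
        by (intro exI[of _ "rs1 @ [i]"] exI[of _ "cs1 @ [c]"]) auto
      with s(2) show False by fastforce
    qed
  qed
  with 1 show ?thesis by (intro that[of rs1 cs1]) auto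
qed

lemma bounded_polys_rational_closure:
  assumes "set zs' \<subseteq> R" "set zs \<subseteq> set zs'" "g \<in> bounded_polys zs D"
  shows "g \<in> rational_closure zs'"
proof -
  have pow: "z ^ n \<in> rational_closure zs'" if "z \<in> rational_closure zs'" for z n
    by (induction n)
       (use that rational_closure_mult[OF assms(1)] rational_closure_const[OF assms(1), of 1] in \<open>auto simp: kappa_1\<close>)
  have "pmonom zs \<beta> \<in> rational_closure zs'" for \<beta>
    using assms(2)
  proof (induction zs arbitrary: \<beta>)
    case Nil
    show ?case using rational_closure_const[OF assms(1), of 1] by (simp add: kappa_1)
  next
    case (Cons z zs)
    show ?case
    proof (cases \<beta>)
      case Nil
      then show ?thesis using rational_closure_const[OF assms(1), of 1] by (simp add: kappa_1)
    next
      case (Cons a \<gamma>)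
      then show ?thesis
        using Cons.IH[of \<gamma>] Cons.prems rational_closure_var[OF assms(1), of z]
        by (auto intro!: rational_closure_mult[OF assms(1)] pow)
    qed
  qed
  then show ?thesis
    using assms(3) unfolding bounded_polys_def poly_value_def
    by (auto intro!: rational_closure_sum rational_closure_mult rational_closure_const assms(1))
qed

lemma rational_closure_mono:
  assumes "set zs' \<subseteq> R" "set zs \<subseteq> set zs'"
  shows "rational_closure zs \<subseteq> rational_closure zs'"
proof
  fix g assume "g \<in> rational_closure zs"
  then obtain D h q where h: "g \<in> R" "h \<in> R" "q \<in> R" "h \<in> bounded_polys zs D" "h \<notin> P"
    "q \<in> bounded_polys zs D" "h * g - q \<in> P" using assms by (auto elim!: rational_closureE)
  have "h \<in> rational_closure zs'" "q \<in> rational_closure zs'" using bounded_polys_rational_closure[OF assms] h by auto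
  moreover from this have "h * g \<in> rational_closure zs'"
    using rational_closure_cong[of q zs' "h * g"] P_uminus[OF h(7)] R_mult h assms by auto
  ultimately show "g \<in> rational_closure zs'" using rational_closure_divide[OF assms(1), of h g] h by auto
qed

text \<open>
  A parameter count for matrices of bounded rank over the fraction field of \<open>R / P\<close>, relative to columns
  \<open>cs0\<close> that are already known. With a maximal minor on rows \<open>rs0 @ rs1\<close> and columns \<open>cs0 @ cs1\<close>, the new
  generators are all entries of the new columns \<open>cs1\<close> and, for the remaining columns of \<open>U\<close>, the entries in
  the rows of the minor. The bordered minors determine all other entries.
\<close>

lemma columns_generated_by_minor:
  assumes zs0: "set zs0 \<subseteq> R" and \<Omega>: "finite \<Omega>" and U: "finite U"
    and f: "\<And>i c. f i c \<in> R"
    and len: "length rs0 = length cs0" "length rs0 < m" and core: "subdet f rs0 cs0 \<notin> P"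
    and rs0: "set rs0 \<subseteq> \<Omega>"
    and cs0: "\<And>i c. i \<in> \<Omega> \<Longrightarrow> c \<in> set cs0 \<Longrightarrow> f i c \<in> rational_closure zs0"
    and vanish: "\<And>rs cs. length rs = m \<Longrightarrow> length cs = m \<Longrightarrow> set rs \<subseteq> \<Omega> \<Longrightarrow>
      set cs \<subseteq> set cs0 \<union> U \<Longrightarrow> subdet f rs cs \<in> P"
  obtains rs1 cs1 zs1 where "length rs1 = length cs1" "length rs0 + length rs1 < m"
    "set rs1 \<subseteq> \<Omega>" "set cs1 \<subseteq> U" "length cs1 \<le> card U" "subdet f (rs0 @ rs1) (cs0 @ cs1) \<notin> P"
    "set zs1 \<subseteq> R" "\<And>i c. i \<in> \<Omega> \<Longrightarrow> c \<in> U \<Longrightarrow> f i c \<in> rational_closure (zs0 @ zs1)"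
    "length zs1 = length rs1 * card \<Omega> + (card U - length rs1) * (length rs0 + length rs1)"
proof -
  obtain rs1 cs1 where 1: "length rs1 = length cs1" "length rs0 + length rs1 < m"
    "set rs1 \<subseteq> \<Omega>" "set cs1 \<subseteq> U" "subdet f (rs0 @ rs1) (cs0 @ cs1) \<notin> P"
    and bordered: "\<And>i c. i \<in> \<Omega> \<Longrightarrow> c \<in> U \<Longrightarrow> subdet f ((rs0 @ rs1) @ [i]) ((cs0 @ cs1) @ [c]) \<in> P"
    using maximal_minor[OF len core, of \<Omega> U] vanish rs0 by (metis sup.absorb2)
  have "distinct (cs0 @ cs1)"
    using subdet_not_distinct_cols[of "cs0 @ cs1" "rs0 @ rs1" f] 1(1,5) len(1) P_zero
    by (metis length_append)
  then have dist: "distinct cs1" by simp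
  then have card: "length cs1 \<le> card U"
    using 1(4) U by (metis card_mono distinct_card)
  obtain \<omega> where \<omega>: "set \<omega> = \<Omega>" "distinct \<omega>" using finite_distinct_list[OF \<Omega>] by auto
  obtain us where us: "set us = U - set cs1" "distinct us"
    using finite_distinct_list[of "U - set cs1"] U by auto
  have lus: "length us = card U - length cs1"
    using us dist 1(4) U by (metis card_Diff_subset distinct_card finite_set)
  define zs1 where "zs1 = map (\<lambda>(c, i). f i c) (List.product cs1 \<omega>)
    @ map (\<lambda>(c, i). f i c) (List.product us (rs0 @ rs1))"
  have R1: "set zs1 \<subseteq> R" using f by (auto simp: zs1_def)
  then have R01: "set (zs0 @ zs1) \<subseteq> R" using zs0 by simp
  have z1: "f i c \<in> rational_closure (zs0 @ zs1)" if "i \<in> \<Omega>" "c \<in> set cs1" for i c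
    using that \<omega> by (intro rational_closure_var[OF R01]) (auto simp: zs1_def image_iff)
  have z0: "f i c \<in> rational_closure (zs0 @ zs1)" if "i \<in> \<Omega>" "c \<in> set cs0" for i c
    using rational_closure_mono[OF R01, of zs0] cs0[OF that] by auto
  have zr: "f i c \<in> rational_closure (zs0 @ zs1)" if "i \<in> set (rs0 @ rs1)" "c \<in> U - set cs1" for i c
    using that us by (intro rational_closure_var[OF R01]) (force simp: zs1_def image_iff)
  have "f i c \<in> rational_closure (zs0 @ zs1)" if ic: "i \<in> \<Omega>" "c \<in> U" for i c
  proof (cases "c \<in> set cs1")
    case True
    with z1 ic show ?thesis by blast
  next
    case False
    show ?thesis
    proof (rule rational_closure_bordered[OF R01 f _ 1(5) bordered[OF ic]])
      show "length (rs0 @ rs1) = length (cs0 @ cs1)" using 1 len by simp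
      show "f i' c' \<in> rational_closure (zs0 @ zs1)"
        if "i' \<in> set (rs0 @ rs1)" "c' \<in> insert c (set (cs0 @ cs1))" for i' c'
      proof -
        have "i' \<in> \<Omega>" using that 1(3) rs0 by auto
        with that zr z0 z1 ic False show ?thesis by auto
      qed
      show "f i c' \<in> rational_closure (zs0 @ zs1)" if "c' \<in> set (cs0 @ cs1)" for c'
        using that z0 z1 ic by auto
    qed
  qed
  moreover have "length zs1 = length rs1 * card \<Omega> + (card U - length rs1) * (length rs0 + length rs1)"
    using lus 1(1) \<omega> by (simp add: zs1_def distinct_card[symmetric] distinct_card)
  ultimately show ?thesis using 1 R1 card by (intro that[of rs1 cs1 zs1]) auto
qed

end

section \<open>Minors in arbitrary order\<close>

lemma subdet_cong:
  assumes "length rs = length cs" "\<And>i c. i \<in> set rs \<Longrightarrow> c \<in> set cs \<Longrightarrow> f i c = g i c"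
  shows "subdet f rs cs = subdet g rs cs"
proof -
  have "mat (length rs) (length rs) (\<lambda>(a, b). f (rs ! a) (cs ! b))
      = mat (length rs) (length rs) (\<lambda>(a, b). g (rs ! a) (cs ! b))"
    using assms by (intro eq_matI) auto
  then show ?thesis by (simp add: subdet_def)
qed

lemma subdet_single: "subdet f [i] [c] = f i c"
  by (simp add: subdet_def det_single)

lemma subdet_pair: "subdet f [i, i'] [c, c'] = f i c * f i' c' - f i c' * f i' c"
proof -
  let ?A = "mat 2 2 (\<lambda>(a, b). f ([i, i'] ! a) ([c, c'] ! b))"
  have A: "?A \<in> carrier_mat 2 2" by simp
  have "subdet f [i, i'] [c, c'] = det ?A" by (simp add: subdet_def numeral_2_eq_2)
  also have "\<dots> = f i c * f i' c' - f i c' * f i' c"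
    by (subst laplace_expansion_row[OF A, of 0])
       (simp_all add: numeral_2_eq_2 cofactor_def det_single mat_delete_def)
  finally show ?thesis .
qed

lemma minorsE:
  assumes "p \<in> minors d r U"
  obtains rs cs where "p = subdet (\<lambda>i c. mvar (i, c)) rs cs" "length rs = r" "length cs = r"
    "set rs \<subseteq> {1..d}" "set cs \<subseteq> U" "distinct rs" "distinct cs"
proof -
  from assms obtain rs cs where *: "p = det (mat r r (\<lambda>(a, b). mvar (rs ! a, cs ! b)))"
    "length rs = r" "sorted_wrt (<) rs" "set rs \<subseteq> {1..d}"
    "length cs = r" "sorted_wrt (\<lambda>p q. (p, q) \<in> less_than <*lex*> less_than) cs" "set cs \<subseteq> U"
    by (auto simp: minors_def)
  have "sorted_wrt (<) cs"
    by (rule sorted_wrt_mono_rel[OF _ *(6)]) (auto simp: less_prod_def')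
  with * show ?thesis by (intro that[of rs cs]) (auto simp: subdet_def strict_sorted_iff)
qed

lemma subdet_mem_of_minors:
  assumes J: "minors d r U \<subseteq> J" "0 \<in> J" "\<And>x. x \<in> J \<Longrightarrow> - x \<in> J"
    and len: "length rs = r" "length cs = r" and sub: "set rs \<subseteq> {1..d}" "set cs \<subseteq> U"
  shows "subdet (\<lambda>i c. mvar (i, c)) rs cs \<in> J"
proof (cases "distinct rs \<and> distinct cs")
  case True
  let ?f = "\<lambda>i c. mvar (i, c) :: cpoly"
  have "subdet ?f (sort rs) (sort cs) \<in> minors d r U"
    unfolding minors_def subdet_def
  proof (intro CollectI exI conjI)
    show "sorted_wrt (<) (sort rs)" using True by (simp add: strict_sorted_iff)
    have "sorted_wrt (<) (sort cs)" using True by (simp add: strict_sorted_iff)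
    then show "sorted_wrt (\<lambda>p q. (p, q) \<in> less_than <*lex*> less_than) (sort cs)"
      by (rule sorted_wrt_mono_rel[rotated]) (auto simp: less_prod_def')
  qed (use len sub in auto)
  then have "subdet ?f (sort rs) (sort cs) \<in> J" using J(1) by blast
  then show ?thesis
    using subdet_mset[of rs "sort rs" cs "sort cs" ?f] J(3) len by auto
next
  case False
  then have "subdet (\<lambda>i c. mvar (i, c) :: cpoly) rs cs = 0"
    using subdet_not_distinct_rows subdet_not_distinct_cols len by metis
  with J(2) show ?thesis by simp
qed

section \<open>The shape of \<open>F_S\<close>\<close>

text \<open>
  Indices \<open>j\<close> for which \<open>S\<close> misses both columns of \<open>C\<^sub>j\<close>, or misses only the column in \<open>R\<^sub>p\<close>; the index
  \<open>3 - p\<close> is the other element of \<open>{1, 2}\<close>.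
\<close>

definition freeset :: "nat \<Rightarrow> col set \<Rightarrow> nat set" where
  "freeset k2 S = {j \<in> {1..k2}. (1, j) \<notin> S \<and> (2, j) \<notin> S}"

definition sideset :: "nat \<Rightarrow> col set \<Rightarrow> nat \<Rightarrow> nat set" where
  "sideset k2 S p = {j \<in> {1..k2}. (p, j) \<notin> S \<and> (3 - p, j) \<in> S}"

lemma atLeastAtMost_1_2: "{1..2::nat} = {1, 2}"
  by auto

lemma Cset_eq: "Cset j = {(1, j), (2, j)}"
  by (auto simp: Cset_def atLeastAtMost_1_2)

lemma Cfree_eq: "Cfree k2 S = {1, 2} \<times> freeset k2 S"
  by (auto simp: Cfree_def Cset_eq freeset_def)

lemma columns_eq: "columns k2 = {1, 2} \<times> {1..k2}"
  unfolding columns_def atLeastAtMost_1_2 ..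

lemma finite_freeset [simp]: "finite (freeset k2 S)" and finite_sideset [simp]: "finite (sideset k2 S p)"
  by (simp_all add: freeset_def sideset_def)

lemma card_free_sides:
  "card (freeset k2 S \<union> sideset k2 S 1 \<union> sideset k2 S 2)
    = card (freeset k2 S) + card (sideset k2 S 1) + card (sideset k2 S 2)"
  by (subst card_Un_disjoint; (subst card_Un_disjoint)?) (auto simp: freeset_def sideset_def)

lemma card_free_sides_le: "card (freeset k2 S) + card (sideset k2 S 1) + card (sideset k2 S 2) \<le> k2"
proof -
  have "card (freeset k2 S \<union> sideset k2 S 1 \<union> sideset k2 S 2) \<le> card {1..k2}"
    by (intro card_mono) (auto simp: freeset_def sideset_def)
  then show ?thesis unfolding card_free_sides by simp
qed

text \<open>
  This form treats \<open>R\<^sub>1\<close> and \<open>R\<^sub>2\<close> alike: \<open>G\<^sub>S\<close> occurs exactly if both sides are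
  nonempty.
\<close>

lemma F_S_eq:
  assumes "S \<noteq> {}"
  shows "F_S d k2 t S = minors d 1 S \<union> (\<Union>j\<in>freeset k2 S. minors d 2 (Cset j))
    \<union> (if sideset k2 S 1 \<noteq> {} \<and> sideset k2 S 2 \<noteq> {} then minors d (t - 1) (Cfree k2 S) else {})
    \<union> (\<Union>p\<in>{1, 2}. minors d t ((Rset k2 p - S) \<union> Cfree k2 S))"
proof -
  have "{j \<in> {1..k2}. Cset j \<inter> S = {}} = freeset k2 S"
    by (auto simp: freeset_def Cset_eq)
  moreover have "(\<exists>j\<in>{1..k2}. (1, j) \<in> S \<and> (2, j) \<notin> S) \<longleftrightarrow> sideset k2 S 2 \<noteq> {}"
    "(\<exists>j\<in>{1..k2}. (2, j) \<in> S \<and> (1, j) \<notin> S) \<longleftrightarrow> sideset k2 S 1 \<noteq> {}"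
    by (auto simp: sideset_def)
  ultimately show ?thesis
    using assms unfolding F_S_def G_S_def by auto
qed

section \<open>Generators modulo a prime and the upper bound\<close>

text \<open>
  The generators needed for one side: \<open>r\<close> is the rank of the columns over \<open>freeset\<close>, \<open>s\<close> the additional rank,
  and \<open>b\<close> the number of columns of the side.
\<close>

lemma side_count:
  fixes r s t b :: nat
  assumes "r + s < t" "s \<le> b"
  shows "s * t + (b - s) * (r + s) \<le> b * (t - 1) + (t - 1 - r)"
proof -
  obtain q where q: "t = r + s + q + 1" using assms(1) less_imp_Suc_add by force
  obtain b' where b: "b = s + b'" using assms(2) le_Suc_ex by blast
  show ?thesis unfolding q b by (simp add: algebra_simps)
qed

text \<open>
  The generators for \<open>e\<close> columns of rank \<open>r\<close>, the \<open>e\<close> factors of proportionality, and the terms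
  \<open>t - 1 - r\<close> left over from both sides. The difference of the two sides is \<open>(e - r) (t - 2 - r)\<close>.
\<close>

lemma free_count:
  fixes r t e :: nat
  assumes "r < t - 1" "r \<le> e"
  shows "r * t + (e - r) * r + e + 2 * (t - 1 - r) \<le> e * (t - 1) + 2 * (t - 1)"
proof -
  have "r + 2 \<le> t" using assms(1) by simp
  then obtain w where w: "t = r + 2 + w" using le_Suc_ex by blast
  obtain e' where e: "e = r + e'" using assms(2) le_Suc_ex by blast
  show ?thesis unfolding w e by (simp add: algebra_simps)
qed

text \<open>
  The generic matrix, extended by zero so that all its values lie in the polynomial ring.
\<close>

definition entry :: "nat \<Rightarrow> nat \<Rightarrow> nat \<Rightarrow> col \<Rightarrow> cpoly" where
  "entry d k2 i c = (if i \<in> {1..d} \<and> c \<in> columns k2 then mvar (i, c) else 0)"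

text \<open>
  The generators are chosen as one would parametrise the matrices in \<open>V(I\<^sub>S)\<close> generically. One column
  of each pair over \<open>freeset\<close> is taken first, then one further entry for the other column
  of each pair, then the two sides over the space spanned by the free columns.
\<close>

lemma entries_generated:
  assumes prime: "affine_prime (carrier (CX t k2)) P const_poly"
    and F: "F_S t k2 t S \<subseteq> P" and S: "S \<subseteq> columns k2" "S \<noteq> {}"
    and sides: "sideset k2 S 1 \<noteq> {}" "sideset k2 S 2 \<noteq> {}" and t: "2 \<le> t"
  shows "\<exists>zs. set zs \<subseteq> carrier (CX t k2) \<and> length zs \<le> (t - 1) * k2 + 2 * (t - 1) \<and>
    mvar ` ({1..t} \<times> columns k2) \<subseteq> affine_prime.rational_closure (carrier (CX t k2)) P const_poly zs"
proof -
  let ?R = "carrier (CX t k2)" and ?f = "entry t k2" and ?\<Omega> = "{1..t}"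
  define E where "E = freeset k2 S"
  interpret affine_prime ?R P const_poly by (rule prime)
  have fR: "?f i c \<in> ?R" for i c
    using R_zero mpoly_carrier_mvar[of "(i, c)" "{1..t} \<times> columns k2"] by (auto simp: entry_def CX_def)
  have vanish: "subdet ?f rs cs \<in> P"
    if "minors t r U \<subseteq> P" "U \<subseteq> columns k2" "length rs = r" "length cs = r" "set rs \<subseteq> ?\<Omega>" "set cs \<subseteq> U"
    for r U rs cs
  proof -
    have "subdet ?f rs cs = subdet (\<lambda>i c. mvar (i, c)) rs cs"
      using that by (intro subdet_cong) (auto simp: entry_def)
    also have "\<dots> \<in> P" using that P_zero P_uminus by (intro subdet_mem_of_minors[of t r U]) auto
    finally show ?thesis .
  qed
  have Ecols: "(1, j) \<in> columns k2" "(2, j) \<in> columns k2" if "j \<in> E" for j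
    using that by (auto simp: E_def freeset_def columns_eq)
  have Cfree: "Cfree k2 S = {1, 2} \<times> E" by (simp add: Cfree_eq E_def)
  have zero: "?f i c \<in> P" if "i \<in> ?\<Omega>" "c \<in> S" for i c
  proof -
    have "minors t 1 S \<subseteq> P" using F by (auto simp: F_S_eq[OF S(2)])
    from vanish[OF this S(1), of "[i]" "[c]"] that show ?thesis by (simp add: subdet_single)
  qed
  have pairs: "?f i c * ?f i' c' - ?f i c' * ?f i' c \<in> P"
    if "j \<in> E" "i \<in> ?\<Omega>" "i' \<in> ?\<Omega>" "c \<in> Cset j" "c' \<in> Cset j" for i i' c c' j
  proof -
    have "minors t 2 (Cset j) \<subseteq> P" using F that(1) by (auto simp: F_S_eq[OF S(2)] E_def)
    moreover have "Cset j \<subseteq> columns k2" using Ecols[OF that(1)] by (auto simp: Cset_eq)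
    ultimately show ?thesis
      using vanish[of 2 "Cset j" "[i, i']" "[c, c']"] that by (simp add: subdet_pair)
  qed
  (* The column that represents a pair must not vanish modulo P if the other one does not:
     a zero column determines nothing about a column proportional to it. *)
  define \<sigma> where "\<sigma> j = (if \<exists>i\<in>?\<Omega>. ?f i (2, j) \<notin> P then 2 else 1 :: nat)" for j
  have \<sigma>: "\<sigma> j = 1 \<or> \<sigma> j = 2" for j by (simp add: \<sigma>_def)
  define UE where "UE = (\<lambda>j. (\<sigma> j, j)) ` E"
  have UE: "finite UE" "card UE = card E" "UE \<subseteq> Cfree k2 S"
    using \<sigma> by (auto simp: UE_def E_def card_image inj_on_def Cfree_eq)
  have Cfree_cols: "Cfree k2 S \<subseteq> columns k2" using Ecols by (auto simp: Cfree)
  have m1: "subdet ?f [] [] \<notin> P" using P_one by (simp add: subdet_def)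
  have m2: "subdet ?f rs cs \<in> P"
    if "length rs = t - 1" "length cs = t - 1" "set rs \<subseteq> ?\<Omega>" "set cs \<subseteq> set [] \<union> UE" for rs cs
  proof (rule vanish[of "t - 1" "Cfree k2 S"])
    show "minors t (t - 1) (Cfree k2 S) \<subseteq> P" using F sides by (auto simp: F_S_eq[OF S(2)])
    show "set cs \<subseteq> Cfree k2 S" using that(4) UE(3) by auto
  qed (use that Cfree_cols in auto)
  obtain rE cE zE where rE: "length rE = length cE" "length rE < t - 1" "set rE \<subseteq> ?\<Omega>"
    "set cE \<subseteq> UE" "length cE \<le> card UE" "subdet ?f rE cE \<notin> P" "set zE \<subseteq> ?R"
    and zE: "\<And>i c. i \<in> ?\<Omega> \<Longrightarrow> c \<in> UE \<Longrightarrow> ?f i c \<in> rational_closure zE"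
    and lE: "length zE = length rE * t + (card UE - length rE) * length rE"
    using columns_generated_by_minor[of "[]" ?\<Omega> UE ?f "[]" "[]" "t - 1"] fR UE(1) m1 m2 t
    by auto
  define r where "r = length rE"
  have other: "\<exists>z\<in>?R. \<forall>zs. set zs \<subseteq> ?R \<longrightarrow> z \<in> set zs \<longrightarrow> (\<forall>i\<in>?\<Omega>. ?f i (\<sigma> j, j) \<in> rational_closure zs) \<longrightarrow>
      (\<forall>i\<in>?\<Omega>. ?f i (3 - \<sigma> j, j) \<in> rational_closure zs)" if j: "j \<in> E" for j
  proof (cases "\<exists>i0\<in>?\<Omega>. ?f i0 (\<sigma> j, j) \<notin> P")
    case True
    then obtain i0 where i0: "i0 \<in> ?\<Omega>" "?f i0 (\<sigma> j, j) \<notin> P" by auto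
    show ?thesis
    proof (intro bexI[of _ "?f i0 (3 - \<sigma> j, j)"] allI impI ballI fR)
      fix zs i assume zs: "set zs \<subseteq> ?R" "?f i0 (3 - \<sigma> j, j) \<in> set zs"
        "\<forall>i\<in>?\<Omega>. ?f i (\<sigma> j, j) \<in> rational_closure zs" and i: "i \<in> ?\<Omega>"
      have "?f i0 (3 - \<sigma> j, j) * ?f i (\<sigma> j, j) \<in> rational_closure zs"
        using zs(3) i by (intro rational_closure_mult[OF zs(1) rational_closure_var[OF zs(1,2)]]) blast
      moreover have "?f i0 (3 - \<sigma> j, j) * ?f i (\<sigma> j, j) - ?f i0 (\<sigma> j, j) * ?f i (3 - \<sigma> j, j) \<in> P"
        using i i0 j \<sigma>[of j] by (intro pairs[of j]) (auto simp: Cset_eq)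
      ultimately have "?f i0 (\<sigma> j, j) * ?f i (3 - \<sigma> j, j) \<in> rational_closure zs"
        using rational_closure_cong R_mult fR zs(1) by blast
      then show "?f i (3 - \<sigma> j, j) \<in> rational_closure zs"
        using rational_closure_divide[OF zs(1) _ i0(2) fR] zs(3) i0(1) by blast
    qed
  next
    case False
    then have "\<not> (\<exists>i\<in>?\<Omega>. ?f i (2, j) \<notin> P)" by (auto simp: \<sigma>_def split: if_splits)
    then have "?f i (3 - \<sigma> j, j) \<in> P" if "i \<in> ?\<Omega>" for i using that by (simp add: \<sigma>_def)
    then show ?thesis using rational_closure_P R_zero by (intro bexI[of _ 0]) auto
  qed
  then obtain \<zeta> where \<zeta>: "\<And>j. j \<in> E \<Longrightarrow> \<zeta> j \<in> ?R"
    "\<And>j zs i. j \<in> E \<Longrightarrow> set zs \<subseteq> ?R \<Longrightarrow> \<zeta> j \<in> set zs \<Longrightarrow> \<forall>i\<in>?\<Omega>. ?f i (\<sigma> j, j) \<in> rational_closure zs \<Longrightarrow>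
      i \<in> ?\<Omega> \<Longrightarrow> ?f i (3 - \<sigma> j, j) \<in> rational_closure zs" by metis
  obtain es where es: "set es = E" "distinct es"
    using finite_distinct_list[of E] by (auto simp: E_def)
  have side: "\<exists>z. set z \<subseteq> ?R \<and> length z \<le> card (sideset k2 S p) * (t - 1) + (t - 1 - r) \<and>
      (\<forall>i\<in>?\<Omega>. \<forall>j\<in>sideset k2 S p. ?f i (p, j) \<in> rational_closure (zE @ z))" if p: "p \<in> {1, 2}" for p
  proof -
    let ?U = "Pair p ` sideset k2 S p"
    have cardU: "card ?U = card (sideset k2 S p)" by (simp add: card_image inj_on_def)
    have mt: "subdet ?f rs cs \<in> P"
      if "length rs = t" "length cs = t" "set rs \<subseteq> ?\<Omega>" "set cs \<subseteq> set cE \<union> ?U" for rs cs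
    proof (rule vanish[of t "(Rset k2 p - S) \<union> Cfree k2 S"])
      show "minors t t ((Rset k2 p - S) \<union> Cfree k2 S) \<subseteq> P" using F p by (auto simp: F_S_eq[OF S(2)])
      have "?U \<subseteq> Rset k2 p - S" by (auto simp: Rset_def sideset_def)
      with that(4) rE(4) UE(3) show "set cs \<subseteq> (Rset k2 p - S) \<union> Cfree k2 S" by blast
      show "(Rset k2 p - S) \<union> Cfree k2 S \<subseteq> columns k2"
        using p Cfree_cols by (auto simp: Rset_def columns_eq)
    qed (use that in auto)
    have "\<exists>z s. length rE + s < t \<and> s \<le> card ?U \<and> set z \<subseteq> ?R \<and>
        (\<forall>i\<in>?\<Omega>. \<forall>c\<in>?U. ?f i c \<in> rational_closure (zE @ z)) \<and>
        length z = s * card ?\<Omega> + (card ?U - s) * (length rE + s)"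
    proof (rule columns_generated_by_minor[of zE ?\<Omega> ?U ?f rE cE t])
      show "set zE \<subseteq> ?R" "\<And>i c. ?f i c \<in> ?R" by (rule rE(7) fR)+
      show "length rE = length cE" "length rE < t" "subdet ?f rE cE \<notin> P" "set rE \<subseteq> ?\<Omega>"
        using rE by auto
      show "?f i c \<in> rational_closure zE" if "i \<in> ?\<Omega>" "c \<in> set cE" for i c using zE[OF that(1)] that(2) rE(4) by blast
      show "subdet ?f rs cs \<in> P"
        if "length rs = t" "length cs = t" "set rs \<subseteq> ?\<Omega>" "set cs \<subseteq> set cE \<union> ?U" for rs cs
        using that by (rule mt)
      show "finite ?\<Omega>" "finite ?U" by simp_all
      fix rs1 cs1 z
      assume "length rs1 = length cs1" "length rE + length rs1 < t" "length cs1 \<le> card ?U" "set z \<subseteq> ?R"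
        "\<And>i c. i \<in> ?\<Omega> \<Longrightarrow> c \<in> ?U \<Longrightarrow> ?f i c \<in> rational_closure (zE @ z)"
        "length z = length rs1 * card ?\<Omega> + (card ?U - length rs1) * (length rE + length rs1)"
      then show "\<exists>z s. length rE + s < t \<and> s \<le> card ?U \<and> set z \<subseteq> ?R \<and>
        (\<forall>i\<in>?\<Omega>. \<forall>c\<in>?U. ?f i c \<in> rational_closure (zE @ z)) \<and>
        length z = s * card ?\<Omega> + (card ?U - s) * (length rE + s)"
        by (intro exI[of _ z] exI[of _ "length rs1"] conjI ballI) simp_all
    qed
    then obtain z s where 1: "length rE + s < t" "s \<le> card ?U" "set z \<subseteq> ?R"
      "\<forall>i\<in>?\<Omega>. \<forall>c\<in>?U. ?f i c \<in> rational_closure (zE @ z)"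
      "length z = s * card ?\<Omega> + (card ?U - s) * (length rE + s)" by blast
    have "length z \<le> card (sideset k2 S p) * (t - 1) + (t - 1 - r)"
      using side_count[of r s t "card ?U"] 1 by (simp add: r_def cardU)
    with 1 show ?thesis by blast
  qed
  obtain z1 where z1: "set z1 \<subseteq> ?R" "length z1 \<le> card (sideset k2 S 1) * (t - 1) + (t - 1 - r)"
    "\<forall>i\<in>?\<Omega>. \<forall>j\<in>sideset k2 S 1. ?f i (1, j) \<in> rational_closure (zE @ z1)" using side[of 1] by auto
  obtain z2 where z2: "set z2 \<subseteq> ?R" "length z2 \<le> card (sideset k2 S 2) * (t - 1) + (t - 1 - r)"
    "\<forall>i\<in>?\<Omega>. \<forall>j\<in>sideset k2 S 2. ?f i (2, j) \<in> rational_closure (zE @ z2)" using side[of 2] by auto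
  define zs where "zs = zE @ map \<zeta> es @ z1 @ z2"
  have zsR: "set zs \<subseteq> ?R" using rE(7) z1 z2 \<zeta>(1) es by (auto simp: zs_def)
  have "length zs \<le> (r * t + (card E - r) * r + card E + 2 * (t - 1 - r))
      + card (sideset k2 S 1) * (t - 1) + card (sideset k2 S 2) * (t - 1)"
    using lE z1(2) z2(2) es UE(2) distinct_card[OF es(2)] by (simp add: zs_def r_def)
  also have "r * t + (card E - r) * r + card E + 2 * (t - 1 - r) \<le> card E * (t - 1) + 2 * (t - 1)"
    using free_count[of r t "card E"] rE UE(2) by (simp add: r_def)
  finally have "length zs \<le> (card E + card (sideset k2 S 1) + card (sideset k2 S 2)) * (t - 1) + 2 * (t - 1)"
    by (simp add: algebra_simps)
  also have "\<dots> \<le> k2 * (t - 1) + 2 * (t - 1)"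
    using card_free_sides_le[of k2 S] by (intro add_mono mult_right_mono) (auto simp: E_def)
  finally have len: "length zs \<le> (t - 1) * k2 + 2 * (t - 1)" by (simp add: mult.commute)
  have main: "?f i (\<sigma> j, j) \<in> rational_closure zs" if "i \<in> ?\<Omega>" "j \<in> E" for i j
    using zE[OF that(1), of "(\<sigma> j, j)"] that(2) rational_closure_mono[OF zsR, of zE] by (auto simp: UE_def zs_def)
  have all: "?f i (p, j) \<in> rational_closure zs" if i: "i \<in> ?\<Omega>" and p: "p \<in> {1, 2}" and j: "j \<in> {1..k2}" for i p j
  proof (cases "(p, j) \<in> S")
    case True
    then show ?thesis using zero[OF i] rational_closure_P[OF zsR] by blast
  next
    case False
    show ?thesis
    proof (cases "(3 - p, j) \<in> S")
      case True
      with False j have "j \<in> sideset k2 S p" by (simp add: sideset_def)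
      moreover have "rational_closure (zE @ z1) \<subseteq> rational_closure zs" "rational_closure (zE @ z2) \<subseteq> rational_closure zs"
        by (intro rational_closure_mono[OF zsR]; auto simp: zs_def)+
      ultimately show ?thesis using z1(3) z2(3) i p by blast
    next
      case False': False
      have jE: "j \<in> E" using False False' j p by (auto simp: E_def freeset_def)
      have "?f i (3 - \<sigma> j, j) \<in> rational_closure zs"
        using main jE i es by (intro \<zeta>(2)[OF jE zsR]) (auto simp: zs_def)
      moreover have "p = \<sigma> j \<or> p = 3 - \<sigma> j" using p \<sigma>[of j] by auto
      ultimately show ?thesis using main[OF i jE] by auto
    qed
  qed
  have "mvar (i, c) \<in> rational_closure zs" if "i \<in> ?\<Omega>" "c \<in> columns k2" for i c
    using all[of i "fst c" "snd c"] that by (auto simp: entry_def columns_eq)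
  with zsR len show ?thesis by (intro exI[of _ zs]) auto
qed

lemma prime_chain_length_le:
  assumes S: "S \<subseteq> columns k2" "S \<noteq> {}" "sideset k2 S 1 \<noteq> {}" "sideset k2 S 2 \<noteq> {}" "2 \<le> t"
    and Q: "\<forall>i\<le>n. primeideal (Q i) (CX t k2) \<and> I_S t k2 t S \<subseteq> Q i" "\<forall>i<n. Q i \<subset> Q (Suc i)"
  shows "n \<le> (t - 1) * k2 + 2 * (t - 1)"
proof -
  let ?V = "{1..t} \<times> columns k2"
  have prime: "affine_prime (carrier (CX t k2)) (Q i) const_poly" if "i \<le> n" for i
    using primeideal_imp_affine_prime[of "Q i" ?V] Q(1) that by (simp add: CX_def)
  interpret R: cring "CX t k2" unfolding CX_def by (rule cring_mpoly_ring)
  have "F_S t k2 t S \<subseteq> Q 0"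
    using R.genideal_self[OF F_S_subset_carrier[OF S(1), of t t]] Q(1) by (auto simp: I_S_def)
  from entries_generated[OF prime[of 0] this S] obtain zs where zs: "set zs \<subseteq> carrier (CX t k2)"
    "length zs \<le> (t - 1) * k2 + 2 * (t - 1)"
    "mvar ` ?V \<subseteq> affine_prime.rational_closure (carrier (CX t k2)) (Q 0) const_poly zs" by auto
  have "finite ?V" by (simp add: columns_eq)
  have "n \<le> length zs"
  proof (rule affine_prime_chain_bound[where Q = Q and X = "mvar ` ?V", OF prime _ zs(1) _ zs(3)])
    show "ring_generated const_poly (mvar ` ?V) (carrier (CX t k2))"
      unfolding CX_def by (rule mpoly_ring_generated)
  qed (use Q(2) \<open>finite ?V\<close> in auto)
  with zs(2) show ?thesis by simp
qed

section \<open>Parametrisation and the lower bound\<close>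

text \<open>
  The parameters of the matrices in \<open>V(I\<^sub>S)\<close>, for columns of rank \<open>r\<close> over \<open>freeset\<close>: \<open>Scale j\<close> is the factor
  from the second to the first column of the pair \<open>j\<close>; \<open>FreeCoeff\<close> and \<open>SideCoeff\<close> are coefficients of columns
  in the spanning vectors of \<open>spanning_vec\<close>; \<open>Basis\<close> and \<open>Normal\<close> are entries of these vectors.
\<close>

datatype param = Scale nat | FreeCoeff nat nat | Basis nat nat | SideCoeff nat nat nat | Normal nat nat

text \<open>
  The order of specialisation. Once the coefficients of the free columns are fixed, these columns display the
  factors and the basis entries; once these are fixed too, the coefficients of the side columns are visible in
  rows below \<open>t\<close>; and once those are fixed, row \<open>t\<close> displays \<open>Normal\<close>.
\<close>

primrec stage :: "param \<Rightarrow> nat" where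
  "stage (Scale j) = 1"
| "stage (FreeCoeff j k) = 0"
| "stage (Basis i k) = 1"
| "stage (SideCoeff p j k) = 2"
| "stage (Normal p k) = 3"

text \<open>
  Entry \<open>i\<close> of the \<open>k\<close>-th of \<open>t - 1\<close> vectors in \<open>t\<close>-space that span a hyperplane. The first \<open>r\<close> of them, in
  reduced form, span the columns over \<open>freeset\<close> and do not depend on the side \<open>p\<close>; the others extend them to
  the hyperplane that contains the columns of side \<open>p\<close>.
\<close>

definition spanning_vec :: "nat \<Rightarrow> nat \<Rightarrow> (param \<Rightarrow> 'a::comm_ring_1) \<Rightarrow> nat \<Rightarrow> nat \<Rightarrow> nat \<Rightarrow> 'a" where
  "spanning_vec t r y p k i =
    (if k \<le> r then (if i \<le> r then (if i = k then 1 else 0) else y (Basis i k))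
     else if i < t then (if i = k then 1 else 0) else y (Normal p k))"

definition coeff_of :: "nat \<Rightarrow> col set \<Rightarrow> nat \<Rightarrow> (param \<Rightarrow> 'a::comm_ring_1) \<Rightarrow> col \<Rightarrow> nat \<Rightarrow> 'a" where
  "coeff_of k2 S r y c k =
    (if snd c \<in> freeset k2 S
       then if k \<le> r then (if fst c = 1 then y (Scale (snd c)) else 1) * y (FreeCoeff (snd c) k) else 0
     else if snd c \<in> sideset k2 S (fst c) then y (SideCoeff (fst c) (snd c) k) else 0)"

definition point :: "nat \<Rightarrow> nat \<Rightarrow> col set \<Rightarrow> nat \<Rightarrow> (param \<Rightarrow> 'a::comm_ring_1) \<Rightarrow> nat \<times> col \<Rightarrow> 'a" where
  "point t k2 S r y = (\<lambda>(i, c). \<Sum>k\<in>{1..t-1}. spanning_vec t r y (fst c) k i * coeff_of k2 S r y c k)"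

lemma poly_point: "poly (point t k2 S r y v) s = point t k2 S r (\<lambda>q. poly (y q) s) v"
proof -
  have "poly (spanning_vec t r y p k i) s = spanning_vec t r (\<lambda>q. poly (y q) s) p k i" for p k i
    by (simp add: spanning_vec_def)
  moreover have "poly (coeff_of k2 S r y c k) s = coeff_of k2 S r (\<lambda>q. poly (y q) s) c k" for c k
    by (simp add: coeff_of_def)
  ultimately show ?thesis by (simp add: point_def poly_sum split: prod.split)
qed

lemma point_zero: "c \<in> S \<Longrightarrow> c \<in> columns k2 \<Longrightarrow> point t k2 S r y (i, c) = 0"
  by (auto simp: point_def coeff_of_def freeset_def sideset_def columns_eq intro!: sum.neutral)

text \<open>
  The vectors with index at most \<open>r\<close> are common to both sides; the side \<open>0\<close> stands for any of them.
\<close>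

lemma point_free:
  assumes "j \<in> freeset k2 S" "r < t"
  shows "point t k2 S r y (i, (p, j)) = (\<Sum>k\<in>{1..r}. spanning_vec t r y 0 k i * coeff_of k2 S r y (p, j) k)"
proof -
  have "point t k2 S r y (i, (p, j))
      = (\<Sum>k\<in>{1..r}. spanning_vec t r y p k i * coeff_of k2 S r y (p, j) k)"
    using assms unfolding point_def prod.case fst_conv
    by (intro sum.mono_neutral_right) (auto simp: coeff_of_def)
  also have "\<dots> = (\<Sum>k\<in>{1..r}. spanning_vec t r y 0 k i * coeff_of k2 S r y (p, j) k)"
    by (intro sum.cong) (auto simp: spanning_vec_def)
  finally show ?thesis .
qed

lemma peval_subdet:
  "length rs = length cs \<Longrightarrow> peval w (subdet (\<lambda>i c. mvar (i, c)) rs cs) = subdet (\<lambda>i c. w (i, c)) rs cs"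
  by (simp add: subdet_def peval_det_mvar)

lemma minors_vanish_low_rank:
  fixes w :: "nat \<times> col \<Rightarrow> complex" and K :: "'k set"
  assumes "p \<in> minors d m U" "finite K" "card K < m"
    and "\<And>i c. i \<in> {1..d} \<Longrightarrow> c \<in> U \<Longrightarrow> w (i, c) = (\<Sum>k\<in>K. g k i * h k c)"
  shows "peval w p = 0"
proof -
  from assms(1) obtain rs cs where *: "p = subdet (\<lambda>i c. mvar (i, c)) rs cs" "length rs = m"
    "length cs = m" "set rs \<subseteq> {1..d}" "set cs \<subseteq> U" by (rule minorsE)
  have "subdet (\<lambda>i c. w (i, c)) rs cs = 0"
  proof (rule subdet_low_rank[where K = K and g = g and h = h])
    show "w (i, c) = (\<Sum>k\<in>K. g k i * h k c)" if "i \<in> set rs" "c \<in> set cs" for i c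
      using that * by (intro assms(4)) auto
  qed (use * assms(2,3) in auto)
  with * show ?thesis by (simp add: peval_subdet)
qed

text \<open>
  Each kind of generator is a minor of size larger than the number of spanning vectors of the columns
  involved: none for \<open>S\<close>, one for a pair, \<open>r\<close> for the free columns, and \<open>t - 1\<close> for a side with the free
  columns.
\<close>

lemma F_S_vanishes_at_point:
  assumes S: "S \<subseteq> columns k2" "S \<noteq> {}" and r: "r < t - 1" and p: "p \<in> F_S t k2 t S"
  shows "peval (point t k2 S r y) p = 0"
proof -
  let ?w = "point t k2 S r y :: nat \<times> col \<Rightarrow> complex"
  have rt: "r < t" using r by simp
  consider (zero) "p \<in> minors t 1 S" | (pair) j where "j \<in> freeset k2 S" "p \<in> minors t 2 (Cset j)"
    | (free) "p \<in> minors t (t - 1) (Cfree k2 S)"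
    | (side) q where "q \<in> {1, 2}" "p \<in> minors t t ((Rset k2 q - S) \<union> Cfree k2 S)"
    using p unfolding F_S_eq[OF S(2)] by (auto split: if_splits)
  then show ?thesis
  proof cases
    case zero
    show ?thesis
      by (rule minors_vanish_low_rank[OF zero, where K = "{} :: nat set"])
         (use S(1) in \<open>auto intro!: point_zero\<close>)
  next
    case pair
    let ?g = "\<lambda>_::unit. \<lambda>i. \<Sum>k\<in>{1..r}. spanning_vec t r y 0 k i * y (FreeCoeff j k)"
    let ?h = "\<lambda>_::unit. \<lambda>c::col. if fst c = 1 then y (Scale j) else 1"
    have "?w (i, c) = (\<Sum>u\<in>UNIV. ?g u i * ?h u c)" if "c \<in> Cset j" for i c
    proof -
      from that obtain q where c: "c = (q, j)" by (auto simp: Cset_eq)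
      show ?thesis unfolding c point_free[OF pair(1) rt]
        by (simp add: UNIV_unit coeff_of_def pair(1) sum_distrib_left mult_ac)
    qed
    then show ?thesis
      by (intro minors_vanish_low_rank[OF pair(2), where K = UNIV and g = ?g and h = ?h]) auto
  next
    case free
    have "?w (i, c) = (\<Sum>k\<in>{1..r}. spanning_vec t r y 0 k i * coeff_of k2 S r y c k)"
      if "c \<in> Cfree k2 S" for i c
      using that point_free[OF _ rt, of "snd c" k2 S y i "fst c"] by (auto simp: Cfree_eq)
    then show ?thesis
      by (intro minors_vanish_low_rank[OF free, where K = "{1..r}" and g = "spanning_vec t r y 0"
            and h = "\<lambda>k c. coeff_of k2 S r y c k"]) (use r in auto)
  next
    case side
    have "?w (i, c) = (\<Sum>k\<in>{1..t-1}. spanning_vec t r y q k i * coeff_of k2 S r y c k)"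
      if "c \<in> (Rset k2 q - S) \<union> Cfree k2 S" for i c
      unfolding point_def prod.case
    proof (intro sum.cong refl)
      fix k assume "k \<in> {1..t-1}"
      show "spanning_vec t r y (fst c) k i * coeff_of k2 S r y c k
          = spanning_vec t r y q k i * coeff_of k2 S r y c k"
        using that by (auto simp: Rset_def Cfree_eq spanning_vec_def coeff_of_def)
    qed
    then show ?thesis
      by (intro minors_vanish_low_rank[OF side(2), where K = "{1..t-1}" and g = "spanning_vec t r y q"
            and h = "\<lambda>k c. coeff_of k2 S r y c k"]) (use r in auto)
  qed
qed

lemma I_S_subset_vanishing:
  assumes S: "S \<subseteq> columns k2" and W: "\<And>w p. w \<in> W \<Longrightarrow> p \<in> F_S d k2 t S \<Longrightarrow> peval w p = 0"
  shows "I_S d k2 t S \<subseteq> vanishing ({1..d} \<times> columns k2) W"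
proof -
  interpret R: cring "CX d k2" unfolding CX_def by (rule cring_mpoly_ring)
  show ?thesis unfolding I_S_def
  proof (rule R.genideal_minimal)
    show "ideal (vanishing ({1..d} \<times> columns k2) W) (CX d k2)"
      unfolding CX_def by (rule ideal_vanishing)
    show "F_S d k2 t S \<subseteq> vanishing ({1..d} \<times> columns k2) W"
      using F_S_subset_carrier[OF S] W by (auto simp: vanishing_def CX_def)
  qed
qed

lemma ex_surj_on:
  assumes "finite A" "finite B" "card B \<le> card A" "B \<noteq> {} \<or> A = {}"
  shows "\<exists>f. f ` A = B"
proof (cases "B = {}")
  case False
  then obtain b where b: "b \<in> B" by auto
  obtain g where g: "inj_on g B" "g ` B \<subseteq> A"
    using card_le_inj[OF assms(2,1,3)] by auto
  have "(\<lambda>a. if a \<in> g ` B then inv_into B g a else b) ` A = B"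
  proof (intro equalityI subsetI)
    fix x assume "x \<in> B"
    then show "x \<in> (\<lambda>a. if a \<in> g ` B then inv_into B g a else b) ` A"
      using g by (intro image_eqI[of _ _ "g x"]) auto
  qed (use b in \<open>auto simp: inv_into_into split: if_splits\<close>)
  then show ?thesis by blast
qed (use assms in auto)

definition params :: "nat \<Rightarrow> nat \<Rightarrow> col set \<Rightarrow> nat \<Rightarrow> param set" where
  "params t k2 S r = Scale ` freeset k2 S \<union> case_prod FreeCoeff ` (freeset k2 S \<times> {1..r})
    \<union> case_prod Basis ` ({r+1..t} \<times> {1..r})
    \<union> (case_prod (SideCoeff 1) ` (sideset k2 S 1 \<times> {1..t-1})
    \<union> case_prod (SideCoeff 2) ` (sideset k2 S 2 \<times> {1..t-1}))
    \<union> (Normal 1 ` {r+1..t-1} \<union> Normal 2 ` {r+1..t-1})"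

lemma params_iff:
  "Scale j \<in> params t k2 S r \<longleftrightarrow> j \<in> freeset k2 S"
  "FreeCoeff j k \<in> params t k2 S r \<longleftrightarrow> j \<in> freeset k2 S \<and> k \<in> {1..r}"
  "Basis i k \<in> params t k2 S r \<longleftrightarrow> i \<in> {r+1..t} \<and> k \<in> {1..r}"
  "SideCoeff p j k \<in> params t k2 S r \<longleftrightarrow> p \<in> {1, 2} \<and> j \<in> sideset k2 S p \<and> k \<in> {1..t-1}"
  "Normal p k \<in> params t k2 S r \<longleftrightarrow> p \<in> {1, 2} \<and> k \<in> {r+1..t-1}"
  by (auto simp: params_def image_iff)

lemma finite_params: "finite (params t k2 S r)"
  by (simp add: params_def)

lemma card_params:
  "card (params t k2 S r) = card (freeset k2 S) + card (freeset k2 S) * r + (t - r) * r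
    + (card (sideset k2 S 1) + card (sideset k2 S 2)) * (t - 1) + 2 * (t - 1 - r)"
proof -
  have pairs: "card (case_prod f ` (A \<times> B)) = card A * card B"
    if "\<And>a b a' b'. f a b = f a' b' \<Longrightarrow> a = a' \<and> b = b'" for f :: "nat \<Rightarrow> nat \<Rightarrow> param" and A B
  proof -
    have "inj_on (case_prod f) (A \<times> B)" by (rule inj_onI) (auto dest!: that)
    then show ?thesis by (simp add: card_image card_cartesian_product)
  qed
  have disjoint: "card (A \<union> B \<union> C \<union> (D \<union> D') \<union> (E \<union> E'))
      = card A + card B + card C + (card D + card D') + (card E + card E')"
    if "finite A" "finite B" "finite C" "finite D" "finite D'" "finite E" "finite E'"
      "A \<inter> B = {}" "(A \<union> B) \<inter> C = {}" "D \<inter> D' = {}" "(A \<union> B \<union> C) \<inter> (D \<union> D') = {}"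
      "E \<inter> E' = {}" "(A \<union> B \<union> C \<union> (D \<union> D')) \<inter> (E \<union> E') = {}" for A B C D D' E E' :: "param set"
    using that by (simp add: card_Un_disjoint)
  have singles: "card (Scale ` freeset k2 S) = card (freeset k2 S)"
    "\<And>p. card (Normal p ` {r+1..t-1}) = t - 1 - r"
    by (simp_all add: card_image inj_on_def)
  have "card (params t k2 S r) = card (Scale ` freeset k2 S)
      + card (case_prod FreeCoeff ` (freeset k2 S \<times> {1..r}))
      + card (case_prod Basis ` ({r+1..t} \<times> {1..r}))
      + (card (case_prod (SideCoeff 1) ` (sideset k2 S 1 \<times> {1..t-1}))
      + card (case_prod (SideCoeff 2) ` (sideset k2 S 2 \<times> {1..t-1})))
      + (card (Normal 1 ` {r+1..t-1}) + card (Normal 2 ` {r+1..t-1}))"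
    unfolding params_def by (rule disjoint) auto
  moreover have "card (case_prod FreeCoeff ` (freeset k2 S \<times> {1..r})) = card (freeset k2 S) * r"
    "card (case_prod Basis ` ({r+1..t} \<times> {1..r})) = (t - r) * r"
    "\<And>p. card (case_prod (SideCoeff p) ` (sideset k2 S p \<times> {1..t-1})) = card (sideset k2 S p) * (t - 1)"
    by (subst pairs; simp)+
  ultimately show ?thesis unfolding singles by (simp only: distrib_right mult_2)
qed

text \<open>
  The base point \<open>c\<close> makes each spanning vector appear as a column: every one of the first \<open>r\<close> is a free
  column, and every later one is a column of each side. The bounds on \<open>r\<close> say that there are enough columns
  for this.
\<close>

lemma prime_chain_exists:
  assumes S: "S \<subseteq> columns k2" "S \<noteq> {}"
    and r: "r < t - 1" "r \<le> card (freeset k2 S)" "r \<noteq> 0 \<or> freeset k2 S = {}"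
    and sides: "\<And>p. p \<in> {1, 2} \<Longrightarrow> t - 1 \<le> r + card (sideset k2 S p)"
  shows "\<exists>P. (\<forall>i\<le>card (params t k2 S r). primeideal (P i) (CX t k2) \<and> I_S t k2 t S \<subseteq> P i) \<and>
    (\<forall>i<card (params t k2 S r). P i \<subset> P (Suc i))"
proof -
  let ?V = "{1..t} \<times> columns k2" and ?Q = "params t k2 S r"
  let ?x = "point t k2 S r :: (param \<Rightarrow> complex) \<Rightarrow> _"
  obtain \<phi> where \<phi>: "\<phi> ` freeset k2 S = {1..r}"
    using ex_surj_on[of "freeset k2 S" "{1..r}"] r by auto
  have "\<exists>f. f ` sideset k2 S p = {r+1..t-1}" if "p \<in> {1, 2}" for p
    using sides[OF that] r by (intro ex_surj_on) auto
  then obtain \<psi> where \<psi>: "\<And>p. p \<in> {1, 2} \<Longrightarrow> \<psi> p ` sideset k2 S p = {r+1..t-1}" by metis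
  (* The coefficients make column j equal to the spanning vector with index \<phi> j or \<psi> p j. *)
  define c :: "param \<Rightarrow> complex" where
    "c = rec_param (\<lambda>j. 0) (\<lambda>j k. if k = \<phi> j then 1 else 0) (\<lambda>i k. 0)
      (\<lambda>p j k. if k = \<psi> p j then 1 else 0) (\<lambda>p k. 0)"
  have c: "c (Scale j) = 0" "c (FreeCoeff j k) = (if k = \<phi> j then 1 else 0)" "c (Basis i k) = 0"
    "c (SideCoeff p j k) = (if k = \<psi> p j then 1 else 0)" "c (Normal p k) = 0" for i j k p
    by (simp_all add: c_def)
  have rt: "r < t" using r by simp
  have free_cols: "(1, j) \<in> columns k2" "(2, j) \<in> columns k2" if "j \<in> freeset k2 S" for j
    using that by (auto simp: freeset_def columns_eq)
  have side_cols: "(p, j) \<in> columns k2" "j \<notin> freeset k2 S" if "j \<in> sideset k2 S p" "p \<in> {1, 2}" for p j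
    using that by (auto simp: freeset_def sideset_def columns_eq)
  have coord: "\<exists>v\<in>?V. \<forall>y. (\<forall>q'\<in>?Q. stage q' < stage q \<longrightarrow> y q' = c q') \<longrightarrow> ?x y v = y q"
    if q: "q \<in> ?Q" for q
  proof (cases q)
    case (FreeCoeff j k)
    with q have jk: "j \<in> freeset k2 S" "k \<in> {1..r}" by (auto simp: params_iff)
    have "?x y (k, (2, j)) = y q" for y
    proof -
      have "?x y (k, (2, j)) = (\<Sum>l\<in>{1..r}. if l = k then y q else 0)"
        unfolding point_free[OF jk(1) rt] using jk
        by (intro sum.cong) (auto simp: spanning_vec_def coeff_of_def FreeCoeff)
      with jk show ?thesis by simp
    qed
    with jk free_cols rt show ?thesis by (intro bexI[of _ "(k, (2, j))"]) auto
  next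
    case (Scale j)
    with q have j: "j \<in> freeset k2 S" by (auto simp: params_iff)
    with \<phi> have \<phi>j: "\<phi> j \<in> {1..r}" by auto
    have "?x y (\<phi> j, (1, j)) = y q" if "\<forall>q'\<in>?Q. stage q' < stage q \<longrightarrow> y q' = c q'" for y
    proof -
      have *: "y (FreeCoeff j l) = (if l = \<phi> j then 1 else 0)" if "l \<in> {1..r}" for l
        using \<open>\<forall>q'\<in>?Q. _\<close>[rule_format, of "FreeCoeff j l"] j that by (auto simp: params_iff Scale c)
      have "?x y (\<phi> j, (1, j)) = (\<Sum>l\<in>{1..r}. if l = \<phi> j then y q else 0)"
        unfolding point_free[OF j rt] using j \<phi>j *
        by (intro sum.cong) (auto simp: spanning_vec_def coeff_of_def Scale)
      with \<phi>j show ?thesis by simp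
    qed
    with \<phi>j j free_cols rt show ?thesis by (intro bexI[of _ "(\<phi> j, (1, j))"]) auto
  next
    case (Basis i k)
    with q have ik: "i \<in> {r+1..t}" "k \<in> {1..r}" by (auto simp: params_iff)
    with \<phi> obtain j where j: "j \<in> freeset k2 S" "\<phi> j = k" by (metis imageE)
    have "?x y (i, (2, j)) = y q" if "\<forall>q'\<in>?Q. stage q' < stage q \<longrightarrow> y q' = c q'" for y
    proof -
      have *: "y (FreeCoeff j l) = (if l = k then 1 else 0)" if "l \<in> {1..r}" for l
        using \<open>\<forall>q'\<in>?Q. _\<close>[rule_format, of "FreeCoeff j l"] j that by (auto simp: params_iff Basis c)
      have "?x y (i, (2, j)) = (\<Sum>l\<in>{1..r}. if l = k then y q else 0)"
        unfolding point_free[OF j(1) rt] using j ik *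
        by (intro sum.cong) (auto simp: spanning_vec_def coeff_of_def Basis)
      with ik show ?thesis by simp
    qed
    with ik j free_cols show ?thesis by (intro bexI[of _ "(i, (2, j))"]) auto
  next
    case (SideCoeff p j k)
    with q have p: "p \<in> {1, 2}" and jk: "j \<in> sideset k2 S p" "k \<in> {1..t-1}"
      by (auto simp: params_iff)
    have "?x y (k, (p, j)) = y q" if "\<forall>q'\<in>?Q. stage q' < stage q \<longrightarrow> y q' = c q'" for y
    proof -
      have *: "y (Basis k l) = 0" if "l \<in> {1..r}" "\<not> k \<le> r" for l
        using \<open>\<forall>q'\<in>?Q. _\<close>[rule_format, of "Basis k l"] jk that
        by (auto simp: params_iff SideCoeff c)
      have "?x y (k, (p, j)) = (\<Sum>l\<in>{1..t-1}. if l = k then y q else 0)"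
        unfolding point_def prod.case using jk side_cols[OF jk(1) p] *
        by (intro sum.cong) (auto simp: spanning_vec_def coeff_of_def SideCoeff)
      with jk show ?thesis by simp
    qed
    with jk side_cols[OF jk(1) p] show ?thesis by (intro bexI[of _ "(k, (p, j))"]) auto
  next
    case (Normal p k)
    with q have p: "p \<in> {1, 2}" and k: "k \<in> {r+1..t-1}" by (auto simp: params_iff)
    with \<psi>[OF p] obtain j where j: "j \<in> sideset k2 S p" "\<psi> p j = k" by (metis imageE)
    have "?x y (t, (p, j)) = y q" if "\<forall>q'\<in>?Q. stage q' < stage q \<longrightarrow> y q' = c q'" for y
    proof -
      have *: "y (SideCoeff p j l) = (if l = k then 1 else 0)" if "l \<in> {1..t-1}" for l
        using \<open>\<forall>q'\<in>?Q. _\<close>[rule_format, of "SideCoeff p j l"] j p that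
        by (auto simp: params_iff Normal c)
      have "?x y (t, (p, j)) = (\<Sum>l\<in>{1..t-1}. if l = k then y q else 0)"
        unfolding point_def prod.case using j k side_cols[OF j(1) p] *
        by (intro sum.cong) (auto simp: spanning_vec_def coeff_of_def Normal)
      with k show ?thesis by simp
    qed
    with j side_cols[OF j(1) p] rt show ?thesis by (intro bexI[of _ "(t, (p, j))"]) auto
  qed
  have lines: "\<exists>Z. \<forall>s v. poly (Z v) s = ?x (\<lambda>q. y q + s * (y' q - y q)) v" for y y'
    by (intro exI[of _ "point t k2 S r (\<lambda>q. [:y q, y' q - y q:])"]) (simp add: poly_point)
  have sub: "I_S t k2 t S \<subseteq> vanishing ?V (range ?x)"
    by (rule I_S_subset_vanishing[OF S(1)]) (auto simp: F_S_vanishes_at_point[OF S r(1)])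
  from specialization_chain[OF finite_params lines coord] obtain P where P:
    "\<forall>i\<le>card ?Q. primeideal (P i) (mpoly_ring ?V) \<and> vanishing ?V (range ?x) \<subseteq> P i"
    "\<forall>i<card ?Q. P i \<subset> P (Suc i)" by blast
  have "\<forall>i\<le>card ?Q. primeideal (P i) (CX t k2) \<and> I_S t k2 t S \<subseteq> P i"
    using P(1) sub by (auto simp: CX_def)
  with P(2) show ?thesis by blast
qed

section \<open>Consequences of minimality\<close>

lemma ideal_of_idealI:
  assumes "ideal J (mpoly_ring V)"
  shows "ideal_of (carrier (mpoly_ring V)) J"
proof -
  interpret J: ideal J "mpoly_ring V" by fact
  show ?thesis
  proof
    show "0 \<in> J" using additive_subgroup.zero_closed[OF J.additive_subgroup_axioms]
      by (simp add: mpoly_ring_ops)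
    show "x + y \<in> J" if "x \<in> J" "y \<in> J" for x y
      using additive_subgroup.a_closed[OF J.additive_subgroup_axioms that] by (simp add: mpoly_ring_ops)
    show "r * x \<in> J" if "r \<in> carrier (mpoly_ring V)" "x \<in> J" for r x
      using J.I_l_closed[OF that(2,1)] by (simp add: mpoly_ring_ops)
  qed (simp_all add: mpoly_carrier_add mpoly_carrier_mult mpoly_carrier_uminus mpoly_carrier_one)
qed

lemma ideal_I_S: "S \<subseteq> columns k2 \<Longrightarrow> ideal (I_S d k2 t S) (CX d k2)"
proof -
  interpret R: cring "CX d k2" unfolding CX_def by (rule cring_mpoly_ring)
  show "S \<subseteq> columns k2 \<Longrightarrow> ideal (I_S d k2 t S) (CX d k2)"
    unfolding I_S_def by (intro R.genideal_ideal F_S_subset_carrier)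
qed

lemma F_S_subset_I_S: "S \<subseteq> columns k2 \<Longrightarrow> F_S d k2 t S \<subseteq> I_S d k2 t S"
proof -
  interpret R: cring "CX d k2" unfolding CX_def by (rule cring_mpoly_ring)
  show "S \<subseteq> columns k2 \<Longrightarrow> F_S d k2 t S \<subseteq> I_S d k2 t S"
    unfolding I_S_def by (intro R.genideal_self F_S_subset_carrier)
qed

lemma I_S_subsetI:
  assumes "S \<subseteq> columns k2" "F_S d k2 t S' \<subseteq> I_S d k2 t S"
  shows "I_S d k2 t S' \<subseteq> I_S d k2 t S"
proof -
  interpret R: cring "CX d k2" unfolding CX_def by (rule cring_mpoly_ring)
  show ?thesis
    unfolding I_S_def[of d k2 t S'] by (intro R.genideal_minimal ideal_I_S assms)
qed

lemma mvar_in_I_S: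
  assumes "S \<subseteq> columns k2" "c \<in> S" "i \<in> {1..d}"
  shows "mvar (i, c) \<in> I_S d k2 t S"
proof -
  have "subdet (\<lambda>i c. mvar (i, c)) [i] [c] \<in> minors d 1 S"
    unfolding minors_def subdet_def using assms
    by (intro CollectI exI[of _ "[i]"] exI[of _ "[c]"]) auto
  moreover have "minors d 1 S \<subseteq> I_S d k2 t S"
    using F_S_subset_I_S[OF assms(1), of d t] assms(2) F_S_eq[of S d k2 t] by auto
  ultimately show ?thesis by (auto simp: subdet_single)
qed

text \<open>
  A minor that uses a column of \<open>S\<close> lies in \<open>I_S\<close>, by expansion along that column.
\<close>

lemma minor_mem_if_mem_off_zero_columns:
  assumes S: "S \<subseteq> columns k2" and p: "p \<in> minors d r U" and U: "U \<subseteq> columns k2"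
    and rest: "minors d r (U - S) \<subseteq> I_S d k2 t S"
  shows "p \<in> I_S d k2 t S"
proof -
  let ?f = "\<lambda>i c. mvar (i, c) :: cpoly" and ?V = "{1..d} \<times> columns k2"
  interpret ideal_of "carrier (mpoly_ring ?V)" "I_S d k2 t S"
    using ideal_I_S[OF S] by (intro ideal_of_idealI) (simp add: CX_def)
  from p obtain rs cs where *: "p = subdet ?f rs cs" "length rs = r" "length cs = r"
    "set rs \<subseteq> {1..d}" "set cs \<subseteq> U" by (rule minorsE)
  show ?thesis
  proof (cases "set cs \<inter> S = {}")
    case True
    then show ?thesis unfolding *(1)
      using * by (intro subdet_mem_of_minors[OF rest J_zero J_uminus]) auto
  next
    case False
    then obtain q where q: "q < r" "cs ! q \<in> S" using *(3) by (metis disjoint_iff in_set_conv_nth)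
    show ?thesis unfolding *(1) subdet_def *(2)
    proof (rule det_zero_column[OF _ _ q(1)])
      show "mat r r (\<lambda>(a, b). ?f (rs ! a) (cs ! b)) $$ (i, q) \<in> I_S d k2 t S" if "i < r" for i
      proof -
        have "rs ! i \<in> {1..d}" using * that by (metis nth_mem subsetD)
        then show ?thesis using q that mvar_in_I_S[OF S q(2)] by simp
      qed
      show "mat r r (\<lambda>(a, b). ?f (rs ! a) (cs ! b)) $$ (i, j) \<in> carrier (mpoly_ring ?V)"
        if "i < r" "j < r" for i j
      proof -
        have "rs ! i \<in> {1..d}" "cs ! j \<in> columns k2" using * that U by (metis nth_mem subsetD)+
        then show ?thesis using that by (simp add: mpoly_carrier_mvar)
      qed
    qed simp
  qed
qed

text \<open>
  By the pigeonhole principle the minor contains both columns of some pair.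
\<close>

lemma minor_mem_of_repeated_pair:
  assumes J: "ideal J (CX d k2)" and p: "p \<in> minors d r U" and U: "U \<subseteq> {1, 2} \<times> A" "U \<subseteq> columns k2"
    and A: "finite A" "card A < r"
    and pairs: "\<And>j. j \<in> A \<Longrightarrow> {1, 2} \<times> {j} \<subseteq> U \<Longrightarrow> minors d 2 (Cset j) \<subseteq> J"
  shows "p \<in> J"
proof -
  let ?f = "\<lambda>i c. mvar (i, c) :: cpoly" and ?V = "{1..d} \<times> columns k2"
  interpret ideal_of "carrier (mpoly_ring ?V)" J
    using J by (intro ideal_of_idealI) (simp add: CX_def)
  from p obtain rs cs where *: "p = subdet ?f rs cs" "length rs = r" "length cs = r"
    "set rs \<subseteq> {1..d}" "set cs \<subseteq> U" "distinct cs" by (rule minorsE)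
  have "\<not> inj_on snd (set cs)"
  proof
    assume "inj_on snd (set cs)"
    then have "r = card (snd ` set cs)" using * by (simp add: card_image distinct_card)
    also have "\<dots> \<le> card A" using *(5) U(1) A by (intro card_mono) auto
    finally show False using A(2) by simp
  qed
  then obtain c c' where "c \<in> set cs" "c' \<in> set cs" "c \<noteq> c'" "snd c = snd c'"
    by (auto simp: inj_on_def)
  then obtain p0 q0 where "p0 < r" "q0 < r" "p0 \<noteq> q0" "snd (cs ! p0) = snd (cs ! q0)"
    using *(3) by (metis in_set_conv_nth)
  then obtain p1 q1 where pq: "p1 < q1" "q1 < r" "snd (cs ! p1) = snd (cs ! q1)"
    by (metis linorder_neqE_nat)
  define j where "j = snd (cs ! p1)"
  have in_U: "cs ! p1 \<in> U" "cs ! q1 \<in> U" using pq *(3,5) by auto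
  have ne: "cs ! p1 \<noteq> cs ! q1" using pq *(3,6) by (simp add: nth_eq_iff_index_eq)
  have cj: "cs ! p1 \<in> Cset j" "cs ! q1 \<in> Cset j" "j \<in> A"
    using in_U U(1) pq(3) by (auto simp: Cset_eq j_def mem_Times_iff prod_eq_iff)
  have "{1, 2} \<times> {j} \<subseteq> {cs ! p1, cs ! q1}"
    using ne cj(1,2) by (auto simp: Cset_eq)
  with in_U have "minors d 2 (Cset j) \<subseteq> J" using pairs[OF cj(3)] by auto
  note two = subdet_mem_of_minors[OF this J_zero J_uminus]
  show ?thesis unfolding *(1) subdet_def *(2)
  proof (rule det_dependent_columns[OF _ _ pq(1,2)])
    fix i i' assume "i < r" "i' < r"
    then have "rs ! i \<in> {1..d}" "rs ! i' \<in> {1..d}" using * by (metis nth_mem subsetD)+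
    then have "subdet ?f [rs ! i, rs ! i'] [cs ! p1, cs ! q1] \<in> J"
      using cj by (intro two) auto
    then show "mat r r (\<lambda>(a, b). ?f (rs ! a) (cs ! b)) $$ (i, p1) *
        mat r r (\<lambda>(a, b). ?f (rs ! a) (cs ! b)) $$ (i', q1) -
        mat r r (\<lambda>(a, b). ?f (rs ! a) (cs ! b)) $$ (i', p1) *
        mat r r (\<lambda>(a, b). ?f (rs ! a) (cs ! b)) $$ (i, q1) \<in> J"
      using \<open>i < r\<close> \<open>i' < r\<close> pq by (simp add: subdet_pair mult.commute)
  next
    fix i j assume "i < r" "j < r"
    then have "rs ! i \<in> {1..d}" "cs ! j \<in> columns k2" using * U by (metis nth_mem subsetD)+
    then show "mat r r (\<lambda>(a, b). ?f (rs ! a) (cs ! b)) $$ (i, j) \<in> carrier (mpoly_ring ?V)"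
      using \<open>i < r\<close> \<open>j < r\<close> by (simp add: mpoly_carrier_mvar)
  qed simp
qed

lemma minors_vanish_at_unit_point:
  assumes "p \<in> minors d m U" "1 < m \<or> 0 < m \<and> c0 \<notin> U"
  shows "peval (\<lambda>v. if v = (1, c0) then 1 else 0 :: complex) p = 0"
proof (cases "1 < m")
  case True
  show ?thesis
    by (rule minors_vanish_low_rank[OF assms(1), of "UNIV :: unit set" _ "\<lambda>_ i. if i = 1 then 1 else 0"
        "\<lambda>_ c. if c = c0 then 1 else 0"]) (use True in \<open>auto simp: UNIV_unit\<close>)
next
  case False
  then show ?thesis
    using assms(2) by (intro minors_vanish_low_rank[OF assms(1), of "{} :: nat set"]) auto
qed

text \<open>
  The matrix whose only nonzero entry is in column \<open>c0\<close> has rank one, so all minors of size at least two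
  vanish there. The remaining generators are the 1-minors of \<open>S\<close> and, if \<open>t = 2\<close>, those of \<open>G_S\<close>, and they
  avoid the column \<open>c0\<close>.
\<close>

lemma mvar_notin_I_S:
  assumes S: "S \<subseteq> columns k2" and c0: "c0 \<in> columns k2" "c0 \<notin> S"
    and t: "2 \<le> t" and free: "c0 \<in> Cfree k2 S \<Longrightarrow> S \<noteq> {} \<Longrightarrow> 3 \<le> t"
  shows "mvar (1, c0) \<notin> I_S d k2 t S"
proof
  let ?w = "\<lambda>v :: nat \<times> col. if v = (1, c0) then 1 else 0 :: complex"
  assume "mvar (1, c0) \<in> I_S d k2 t S"
  moreover have "I_S d k2 t S \<subseteq> vanishing ({1..d} \<times> columns k2) {?w}"
  proof (rule I_S_subset_vanishing[OF S])
    fix w p assume w: "w \<in> {?w}" and p: "p \<in> F_S d k2 t S"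
    have "peval ?w p = 0"
    proof (cases "S = {}")
      case True
      with p t obtain m U where "p \<in> minors d m U" "1 < m"
        unfolding F_S_def by fastforce
      then show ?thesis by (intro minors_vanish_at_unit_point disjI1)
    next
      case False
      from p consider "p \<in> minors d 1 S" | j where "p \<in> minors d 2 (Cset j)"
        | "p \<in> minors d (t - 1) (Cfree k2 S)" | U where "p \<in> minors d t U"
        unfolding F_S_eq[OF False] by (auto split: if_splits)
      then show ?thesis
        using c0 t free[OF _ False] by cases (erule minors_vanish_at_unit_point; auto)+
    qed
    with w show "peval w p = 0" by simp
  qed
  ultimately have "peval ?w (mvar (1, c0)) = 0" by (auto simp: vanishing_def)
  then show False by simp
qed

locale minimal_ideal =
  fixes t k2 :: nat and S :: "col set"
  assumes t: "2 \<le> t" "t \<le> k2" and S: "S \<subseteq> columns k2" "S \<noteq> {}"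
    and minimal: "\<And>S'. S' \<subseteq> columns k2 \<Longrightarrow> I_S t k2 t S' \<subseteq> I_S t k2 t S \<Longrightarrow> I_S t k2 t S' = I_S t k2 t S"
begin

lemma I_S_eq_of_minimal:
  assumes "S' \<subseteq> columns k2" "F_S t k2 t S' \<subseteq> I_S t k2 t S"
  shows "I_S t k2 t S' = I_S t k2 t S"
  using minimal[OF assms(1) I_S_subsetI[OF S(1) assms(2)]] .

lemma F_S_in: "F_S t k2 t S \<subseteq> I_S t k2 t S"
  by (rule F_S_subset_I_S[OF S(1)])

lemma pair_minors:
  assumes "j \<in> {1..k2}"
  shows "minors t 2 (Cset j) \<subseteq> I_S t k2 t S"
proof (cases "Cset j \<inter> S = {}")
  case True
  with assms have "j \<in> freeset k2 S" by (auto simp: freeset_def Cset_eq)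
  then show ?thesis using F_S_in by (auto simp: F_S_eq[OF S(2)])
next
  case False
  then obtain c where c: "c \<in> Cset j" "c \<in> S" by auto
  have "minors t 2 (Cset j - S) = {}"
  proof (rule ccontr)
    assume "minors t 2 (Cset j - S) \<noteq> {}"
    then obtain p where "p \<in> minors t 2 (Cset j - S)" by auto
    then obtain cs where cs: "length cs = 2" "set cs \<subseteq> Cset j - S" "distinct cs" by (metis minorsE)
    then have "2 \<le> card (Cset j - S)"
      by (metis card_mono distinct_card finite_Diff finite.emptyI finite.insertI Cset_eq)
    also have "\<dots> < card (Cset j)" using c by (intro psubset_card_mono) (auto simp: Cset_eq)
    finally show False by (simp add: Cset_eq)
  qed
  then show ?thesis
    using minor_mem_if_mem_off_zero_columns[OF S(1), of _ t 2 "Cset j" t] assms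
    by (auto simp: Cset_eq columns_eq)
qed

lemma side_minors:
  assumes p: "p \<in> {1, 2}" and U: "U \<subseteq> columns k2" "U - S \<subseteq> (Rset k2 p - S) \<union> Cfree k2 S"
  shows "minors t t U \<subseteq> I_S t k2 t S"
proof
  fix q assume "q \<in> minors t t U"
  then show "q \<in> I_S t k2 t S"
  proof (rule minor_mem_if_mem_off_zero_columns[OF S(1) _ U(1)])
    have "minors t t (U - S) \<subseteq> minors t t ((Rset k2 p - S) \<union> Cfree k2 S)"
      using U(2) by (fastforce simp: minors_def)
    also have "\<dots> \<subseteq> I_S t k2 t S"
      using F_S_in p by (auto simp: F_S_eq[OF S(2)])
    finally show "minors t t (U - S) \<subseteq> I_S t k2 t S" .
  qed
qed

text \<open>
  Otherwise all columns outside \<open>S\<close> belong to the other side or to free pairs, so all \<open>t\<close>-minors of \<open>X\<close> lie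
  in \<open>I_S\<close>, and \<open>I\<^sub>\<emptyset>\<close> is strictly smaller.
\<close>

lemma sides_nonempty: "sideset k2 S p \<noteq> {}" if p: "p \<in> {1, 2}" for p
proof
  assume empty: "sideset k2 S p = {}"
  have "columns k2 - S \<subseteq> (Rset k2 (3 - p) - S) \<union> Cfree k2 S"
  proof
    fix c assume c: "c \<in> columns k2 - S"
    then obtain q j where qj: "c = (q, j)" "q \<in> {1, 2}" "j \<in> {1..k2}" by (auto simp: columns_eq)
    with c empty p show "c \<in> (Rset k2 (3 - p) - S) \<union> Cfree k2 S"
      by (auto simp: Rset_def Cfree_eq freeset_def sideset_def)
  qed
  moreover have "3 - p \<in> {1, 2}" using p by auto
  ultimately have "minors t t (columns k2) \<subseteq> I_S t k2 t S" by (intro side_minors) auto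
  then have "F_S t k2 t {} \<subseteq> I_S t k2 t S"
    unfolding F_S_def if_P[OF refl] by (intro Un_least UN_least pair_minors)
  then have "I_S t k2 t {} = I_S t k2 t S" by (intro I_S_eq_of_minimal) simp_all
  moreover obtain c where c: "c \<in> S" using S(2) by auto
  ultimately show False
    using mvar_in_I_S[OF S(1) c, of 1 t t] mvar_notin_I_S[of "{}" k2 c t t] c S(1) t by auto
qed

text \<open>
  Removing \<open>(2, j)\<close> from \<open>S\<close> keeps both sides nonempty and the free pairs unchanged; the new minors only add a
  column that vanishes modulo \<open>I_S\<close>.
\<close>

lemma no_pair_deleted: "\<not> ((1, j) \<in> S \<and> (2, j) \<in> S)"
proof
  assume j: "(1, j) \<in> S \<and> (2, j) \<in> S"
  define S' where "S' = S - {(2, j)}"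
  have S': "S' \<subseteq> columns k2" "S' \<noteq> {}" using S j by (auto simp: S'_def)
  have free: "freeset k2 S' = freeset k2 S" using j by (auto simp: freeset_def S'_def)
  then have Cfree: "Cfree k2 S' = Cfree k2 S" by (simp add: Cfree_eq)
  have "F_S t k2 t S' \<subseteq> I_S t k2 t S"
    unfolding F_S_eq[OF S'(2)]
  proof (intro Un_least UN_least)
    have "minors t 1 S' \<subseteq> minors t 1 S" by (fastforce simp: minors_def S'_def)
    also have "\<dots> \<subseteq> I_S t k2 t S" using F_S_in by (auto simp: F_S_eq[OF S(2)])
    finally show "minors t 1 S' \<subseteq> I_S t k2 t S" .
    show "minors t 2 (Cset i) \<subseteq> I_S t k2 t S" if "i \<in> freeset k2 S'" for i
      using that by (intro pair_minors) (auto simp: freeset_def)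
    show "(if sideset k2 S' 1 \<noteq> {} \<and> sideset k2 S' 2 \<noteq> {} then minors t (t - 1) (Cfree k2 S') else {})
        \<subseteq> I_S t k2 t S"
      unfolding Cfree using F_S_in sides_nonempty[of 1] sides_nonempty[of 2] by (auto simp: F_S_eq[OF S(2)])
    show "minors t t ((Rset k2 p - S') \<union> Cfree k2 S') \<subseteq> I_S t k2 t S" if "p \<in> {1, 2}" for p
      unfolding Cfree
      by (rule side_minors[OF that]) (use that in \<open>auto simp: S'_def Rset_def columns_eq Cfree_eq freeset_def\<close>)
  qed
  then have "I_S t k2 t S' = I_S t k2 t S" by (rule I_S_eq_of_minimal[OF S'(1)])
  moreover have "mvar (1, (2, j)) \<in> I_S t k2 t S" using j t by (intro mvar_in_I_S S) auto
  moreover have "mvar (1, (2, j)) \<notin> I_S t k2 t S'"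
    using j S t by (intro mvar_notin_I_S S') (auto simp: S'_def Cfree_eq freeset_def)
  ultimately show False by simp
qed

lemma card_partition: "card (freeset k2 S) + card (sideset k2 S 1) + card (sideset k2 S 2) = k2"
proof -
  have "freeset k2 S \<union> sideset k2 S 1 \<union> sideset k2 S 2 = {1..k2}"
    using no_pair_deleted by (auto simp: freeset_def sideset_def)
  then show ?thesis using card_free_sides[of k2 S] by simp
qed

text \<open>
  For \<open>t = 2\<close> the set \<open>G_S\<close> consists of the variables of the free columns. Adding one of them to \<open>S\<close> therefore
  adds nothing new, while the other column of its pair is no longer forced to vanish.
\<close>

lemma free_empty_if_two:
  assumes "t = 2"
  shows "freeset k2 S = {}"
proof (rule ccontr)
  assume "freeset k2 S \<noteq> {}"
  then obtain j where j: "j \<in> freeset k2 S" by auto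
  then have jS: "(1, j) \<notin> S" "(2, j) \<notin> S" "j \<in> {1..k2}" by (auto simp: freeset_def)
  define S' where "S' = insert (1, j) S"
  have S': "S' \<subseteq> columns k2" "S' \<noteq> {}" using S jS by (auto simp: S'_def columns_eq)
  have "minors t 1 (Cfree k2 S) \<subseteq> F_S t k2 t S"
    using sides_nonempty[of 1] sides_nonempty[of 2] assms by (auto simp: F_S_eq[OF S(2)])
  then have G: "minors t 1 (Cfree k2 S) \<subseteq> I_S t k2 t S" using F_S_in by auto
  have Cfree: "Cfree k2 S' \<subseteq> Cfree k2 S" by (auto simp: S'_def Cfree_eq freeset_def)
  have mvar_free: "mvar (i, c) \<in> I_S t k2 t S" if "c \<in> Cfree k2 S" "i \<in> {1..t}" for i c
  proof -
    have "subdet (\<lambda>i c. mvar (i, c)) [i] [c] \<in> minors t 1 (Cfree k2 S)"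
      unfolding minors_def subdet_def using that
      by (intro CollectI exI[of _ "[i]"] exI[of _ "[c]"]) auto
    with G show ?thesis by (auto simp: subdet_single)
  qed
  have "F_S t k2 t S' \<subseteq> I_S t k2 t S"
    unfolding F_S_eq[OF S'(2)]
  proof (intro Un_least UN_least)
    show "minors t 1 S' \<subseteq> I_S t k2 t S"
    proof
      fix p assume "p \<in> minors t 1 S'"
      then obtain rs cs where rs: "p = subdet (\<lambda>i c. mvar (i, c)) rs cs" "length rs = 1" "length cs = 1"
        "set rs \<subseteq> {1..t}" "set cs \<subseteq> S'" by (rule minorsE)
      then obtain i c where "rs = [i]" "cs = [c]" by (auto simp: length_Suc_conv)
      with rs have ic: "p = mvar (i, c)" "i \<in> {1..t}" "c \<in> S'" by (auto simp: subdet_single)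
      show "p \<in> I_S t k2 t S"
      proof (cases "c \<in> S")
        case True
        then show ?thesis unfolding ic(1) using ic(2) by (intro mvar_in_I_S S)
      next
        case False
        with ic(3) have "c = (1, j)" by (simp add: S'_def)
        then show ?thesis unfolding ic(1) using ic(2) j by (intro mvar_free) (auto simp: Cfree_eq)
      qed
    qed
    show "minors t 2 (Cset i) \<subseteq> I_S t k2 t S" if "i \<in> freeset k2 S'" for i
      using that by (intro pair_minors) (auto simp: freeset_def)
    have "minors t (t - 1) (Cfree k2 S') \<subseteq> minors t (t - 1) (Cfree k2 S)"
      using Cfree by (fastforce simp: minors_def)
    with G assms show "(if sideset k2 S' 1 \<noteq> {} \<and> sideset k2 S' 2 \<noteq> {} then minors t (t - 1) (Cfree k2 S') else {})
        \<subseteq> I_S t k2 t S" by auto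
    show "minors t t ((Rset k2 p - S') \<union> Cfree k2 S') \<subseteq> I_S t k2 t S" if "p \<in> {1, 2}" for p
      by (rule side_minors[OF that]) (use that in \<open>auto simp: S'_def Rset_def columns_eq Cfree_eq freeset_def\<close>)
  qed
  then have "I_S t k2 t S' = I_S t k2 t S" by (rule I_S_eq_of_minimal[OF S'(1)])
  moreover have "mvar (1, (2, j)) \<in> I_S t k2 t S" using j t by (intro mvar_free) (auto simp: Cfree_eq)
  moreover have "mvar (1, (2, j)) \<notin> I_S t k2 t S'"
    using jS t by (intro mvar_notin_I_S S') (auto simp: S'_def Cfree_eq freeset_def columns_eq)
  ultimately show False by simp
qed

text \<open>
  If there are fewer columns, a pair of the other side can be made free by deleting its column from \<open>S\<close>.
  The minors of the free columns, and those of side \<open>p\<close> with the free columns, then contain both columns of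
  some pair; the minors of the other side only gain a column that vanishes modulo \<open>I_S\<close>.
\<close>

lemma side_large:
  assumes p: "p \<in> {1, 2}"
  shows "t - 1 \<le> card (freeset k2 S) + card (sideset k2 S p)"
proof (rule ccontr)
  assume small: "\<not> ?thesis"
  let ?q = "3 - p"
  have q: "?q \<in> {1, 2}" "3 - ?q = p" "?q \<noteq> p" using p by auto
  have pos: "0 < card (sideset k2 S p)" using sides_nonempty[OF p] by (simp add: card_gt_0_iff)
  have t3: "3 \<le> t" using small pos by linarith
  have part: "card (freeset k2 S) + card (sideset k2 S p) + card (sideset k2 S ?q) = k2"
    using card_partition p by auto
  have "2 \<le> card (sideset k2 S ?q)" using part small t by linarith
  then obtain j j' where j: "j \<in> sideset k2 S ?q" and j': "j' \<in> sideset k2 S ?q" "j' \<noteq> j"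
    using card_le_Suc0_iff_eq[of "sideset k2 S ?q"] by auto
  then have jS: "(?q, j) \<notin> S" "(p, j) \<in> S" "j \<in> {1..k2}" using q(2) by (auto simp: sideset_def)
  define S' where "S' = S - {(p, j)}"
  have S'sub: "S' \<subseteq> columns k2" using S by (auto simp: S'_def)
  from j' have "(p, j') \<in> S'" using q(2) by (auto simp: sideset_def S'_def)
  then have S': "S' \<noteq> {}" by auto
  have free': "freeset k2 S' = insert j (freeset k2 S)"
    using jS p by (auto simp: freeset_def S'_def)
  have Cfree': "Cfree k2 S' = Cfree k2 S \<union> {(p, j), (?q, j)}"
    using p by (auto simp: Cfree_eq free')
  have j_cols: "(p, j) \<in> columns k2" "(?q, j) \<in> columns k2" using p jS(3) by (auto simp: columns_eq)
  have Cfree_cols: "Cfree k2 S' \<subseteq> columns k2"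
    using j_cols by (auto simp: Cfree' ) (auto simp: Cfree_eq freeset_def columns_eq)
  have "F_S t k2 t S' \<subseteq> I_S t k2 t S"
    unfolding F_S_eq[OF S']
  proof (intro Un_least UN_least)
    have "minors t 1 S' \<subseteq> minors t 1 S" by (fastforce simp: minors_def S'_def)
    also have "\<dots> \<subseteq> I_S t k2 t S" using F_S_in by (auto simp: F_S_eq[OF S(2)])
    finally show "minors t 1 S' \<subseteq> I_S t k2 t S" .
    show "minors t 2 (Cset i) \<subseteq> I_S t k2 t S" if "i \<in> freeset k2 S'" for i
      using that by (intro pair_minors) (auto simp: freeset_def)
    have "minors t (t - 1) (Cfree k2 S') \<subseteq> I_S t k2 t S"
    proof
      fix x assume x: "x \<in> minors t (t - 1) (Cfree k2 S')"
      have "card (freeset k2 S') \<le> Suc (card (freeset k2 S))" unfolding free' by (simp add: card_insert_if)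
      then have "card (freeset k2 S') < t - 1" using small pos by linarith
      then show "x \<in> I_S t k2 t S"
        using pair_minors Cfree_cols
        by (intro minor_mem_of_repeated_pair[OF ideal_I_S[OF S(1)] x, of "freeset k2 S'"])
           (auto simp: Cfree_eq freeset_def)
    qed
    then show "(if sideset k2 S' 1 \<noteq> {} \<and> sideset k2 S' 2 \<noteq> {} then minors t (t - 1) (Cfree k2 S') else {})
        \<subseteq> I_S t k2 t S" by auto
    have sideq: "minors t t ((Rset k2 ?q - S') \<union> Cfree k2 S') \<subseteq> I_S t k2 t S"
    proof (rule side_minors[OF q(1)])
      show "Rset k2 ?q - S' \<union> Cfree k2 S' \<subseteq> columns k2"
        using Cfree_cols q(1) by (auto simp: Rset_def columns_eq)
      show "Rset k2 ?q - S' \<union> Cfree k2 S' - S \<subseteq> Rset k2 ?q - S \<union> Cfree k2 S"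
        unfolding Cfree' using jS q by (auto simp: S'_def Rset_def)
    qed
    have sidep: "minors t t ((Rset k2 p - S') \<union> Cfree k2 S') \<subseteq> I_S t k2 t S"
    proof
      fix x assume x: "x \<in> minors t t ((Rset k2 p - S') \<union> Cfree k2 S')"
      let ?A = "insert j (freeset k2 S \<union> sideset k2 S p)"
      have "card ?A \<le> Suc (card (freeset k2 S) + card (sideset k2 S p))"
        using card_Un_le[of "freeset k2 S" "sideset k2 S p"] by (simp add: card_insert_if)
      then have A: "card ?A < t" using small by linarith
      have U: "Rset k2 p - S' \<union> Cfree k2 S' \<subseteq> {1, 2} \<times> ?A"
        using p by (auto simp: Cfree_eq free' Rset_def S'_def sideset_def freeset_def)
      have Uc: "Rset k2 p - S' \<union> Cfree k2 S' \<subseteq> columns k2"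
        using Cfree_cols p by (auto simp: Rset_def columns_eq)
      show "x \<in> I_S t k2 t S"
        by (rule minor_mem_of_repeated_pair[OF ideal_I_S[OF S(1)] x U Uc _ A])
           (use pair_minors jS(3) in \<open>auto simp: freeset_def sideset_def\<close>)
    qed
    show "minors t t ((Rset k2 p' - S') \<union> Cfree k2 S') \<subseteq> I_S t k2 t S" if "p' \<in> {1, 2}" for p'
      using sidep sideq that p by (cases "p' = p") auto
  qed
  then have "I_S t k2 t S' = I_S t k2 t S" by (rule I_S_eq_of_minimal[OF S'sub])
  moreover have "mvar (1, (p, j)) \<in> I_S t k2 t S" using jS t by (intro mvar_in_I_S S) auto
  moreover have "mvar (1, (p, j)) \<notin> I_S t k2 t S'"
    using jS t3 j_cols by (intro mvar_notin_I_S S'sub) (auto simp: S'_def)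
  ultimately show False by simp
qed

end

text \<open>
  For \<open>r = e\<close> and for \<open>r = t - 2\<close>, the number of parameters does not depend on \<open>e\<close>.
\<close>

lemma parameter_count:
  fixes t r e b1 b2 k :: nat
  assumes "r = min e (t - 2)" "2 \<le> t" "e + b1 + b2 = k"
  shows "e + e * r + (t - r) * r + (b1 + b2) * (t - 1) + 2 * (t - 1 - r) = (t - 1) * k + 2 * (t - 1)"
proof (cases "e \<le> t - 2")
  case True
  then have r: "r = e" using assms by simp
  have "e + 2 \<le> t" using True assms(2) by simp
  then obtain w where w: "t = e + 2 + w" using le_Suc_ex by blast
  show ?thesis unfolding r w assms(3)[symmetric] by (simp add: algebra_simps)
next
  case False
  then have r: "r = t - 2" using assms by simp
  obtain w where w: "t = w + 2" using assms(2) le_Suc_ex[of 2 t] by (metis add.commute)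
  show ?thesis unfolding r w assms(3)[symmetric] by (simp add: algebra_simps)
qed

section \<open>The dimension\<close>

theorem theorem5p3:
  fixes d t k2 :: nat and S :: "(nat \<times> nat) set"
  assumes "2 \<le> d" and "d = t" and "t \<le> k2"
    and "S \<subseteq> columns k2" and "S \<noteq> {}"
    and "\<And>S'. S' \<subseteq> columns k2 \<Longrightarrow> I_S d k2 t S' \<subseteq> I_S d k2 t S \<Longrightarrow> I_S d k2 t S' = I_S d k2 t S"
  shows "ideal_dim d k2 (I_S d k2 t S)
       = ereal ((real t)^2 + (real t - 1) * real k2 - (real t - 1)^2 - 1)"
proof -
  have d: "d = t" by fact
  interpret minimal_ideal t k2 S
    using assms unfolding d by unfold_locales auto
  define e where "e = card (freeset k2 S)"
  define r where "r = min e (t - 2)"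
  have r1: "r < t - 1" "r \<le> card (freeset k2 S)" using t by (auto simp: r_def e_def)
  have r2: "r \<noteq> 0 \<or> freeset k2 S = {}"
    using free_empty_if_two t by (cases "t = 2") (auto simp: r_def e_def min_def)
  have sides: "t - 1 \<le> r + card (sideset k2 S p)" if p: "p \<in> {1, 2}" for p
  proof (cases "e \<le> t - 2")
    case True
    then show ?thesis using side_large[OF p] by (simp add: r_def e_def)
  next
    case False
    have "0 < card (sideset k2 S p)" using sides_nonempty[OF p] by (simp add: card_gt_0_iff)
    with False show ?thesis by (simp add: r_def)
  qed
  have N: "card (params t k2 S r) = (t - 1) * k2 + 2 * (t - 1)"
    unfolding card_params e_def[symmetric]
    using parameter_count[OF r_def t(1)] card_partition by (simp add: e_def)
  obtain P where P: "\<forall>i\<le>card (params t k2 S r). primeideal (P i) (CX t k2) \<and> I_S t k2 t S \<subseteq> P i"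
    "\<forall>i<card (params t k2 S r). P i \<subset> P (Suc i)"
    using prime_chain_exists[OF S r1 r2 sides] by blast
  have "krull_dim (CX t k2 Quot I_S t k2 t S) = ereal (real ((t - 1) * k2 + 2 * (t - 1)))"
  proof (rule krull_dim_quot_eqI[OF _ ideal_I_S[OF S(1)] P[unfolded N]])
    show "cring (CX t k2)" unfolding CX_def by (rule cring_mpoly_ring)
    show "n \<le> (t - 1) * k2 + 2 * (t - 1)"
      if "\<forall>i\<le>n. primeideal (Q i) (CX t k2) \<and> I_S t k2 t S \<subseteq> Q i" "\<forall>i<n. Q i \<subset> Q (Suc i)" for n Q
      using prime_chain_length_le[OF S sides_nonempty sides_nonempty t(1) that] by simp
  qed
  also have "real ((t - 1) * k2 + 2 * (t - 1)) = (real t)^2 + (real t - 1) * real k2 - (real t - 1)^2 - 1"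
  proof -
    have "real (t - 1) = real t - 1" using t(1) by (simp add: of_nat_diff)
    then show ?thesis
      unfolding of_nat_add of_nat_mult by (simp add: power2_eq_square algebra_simps)
  qed
  finally show ?thesis by (simp add: ideal_dim_def d)
qed

end
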